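(* Let $(X_i)_{i\ge1}$ be a sequence of iid random variables taking values in the ordered countably infinite alphabet $\mathcal{A}=\{\alpha_n\}_{n\ge1}$, $\alpha_1<\alpha_2<\cdots$, with $\mathbb{P}(X_1=\alpha_j)=p_j>0$ for $j\ge1$. Let $LI_n$ be the length of the longest increasing subsequence of $X_1,\dots,X_n$. Let $p_{max}=\max_{j\ge1}p_j$ and suppose $p_{max}=p_{j_1}=p_{j_2}=\cdots=p_{j_k}$, $1\le j_1<j_2<\cdots<j_k$, $k\ge1$, and $p_i<p_{max}$ otherwise. Then, as $n\to\infty$, $$\frac{LI_n-p_{max}n}{\sqrt n}\ \Rightarrow\ \sqrt{p_{max}}\left\{\sqrt{1-p_{max}k}\,Z_k+H_k\right\}.$$
   Context: Increasing subsequences are understood in the weak (nondecreasing) sense: $LI_n$ is the largest $\ell$ for which there are indices $1\le i_1<\cdots<i_\ell\le n$ with $X_{i_1}\le\cdots\le X_{i_\ell}$. The symbol $\Rightarrow$ denotes convergence in distribution. Let $(B^1(t),\dots,B^k(t))$, $0\le t\le1$, be a standard $k$-dimensional Brownian motion (independent standard one-dimensional Brownian motions started at $0$). Then $Z_k=\frac1k\sum_{i=1}^k B^i(1)$, and, for $k\ge2$, $$H_k=\sqrt2\left\{-\frac1k\sum_{i=1}^{k-1} i\,\tilde B^i(1)+\max_{0\le t_1\le\cdots\le t_{k-1}\le1}\sum_{i=1}^{k-1}\tilde B^i(t_i)\right\},\qquad \tilde B^i(t)=\frac{1}{\sqrt2}\left(B^i(t)-B^{i+1}(t)\right),\ 1\le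 i\le k-1,$$ while $H_1\equiv0$. *)

theory Defs
  imports "HOL-Probability.Probability"
begin

text \<open>Longest weakly increasing subsequence of \<open>x 1, \<dots>, x n\<close>. The set contains \<open>0\<close> and is bounded by
  \<open>n\<close>, so \<open>Max\<close> is a genuine maximum.\<close>

definition LI :: "(nat \<Rightarrow> 'a::linorder) \<Rightarrow> nat \<Rightarrow> nat" where
  "LI x n = Max {l. \<exists>i. strict_mono_on {1..l} i \<and> i ` {1..l} \<subseteq> {1..n} \<and> mono_on {1..l} (\<lambda>r. x (i r))}"

text \<open>The initial condition and path continuity are required for every outcome, not just almost
  every one, so that the maximum below is attained and is measurable without completing \<open>N\<close>.\<close>

locale standard_brownian_motion = prob_space N for N :: "'b measure" +
  fixes W :: "real \<Rightarrow> 'b \<Rightarrow> real"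
  assumes measurable: "\<And>t. t \<in> {0..1} \<Longrightarrow> random_variable borel (W t)"
    and initial: "\<And>\<omega>. \<omega> \<in> space N \<Longrightarrow> W 0 \<omega> = 0"
    and continuous_paths: "\<And>\<omega>. \<omega> \<in> space N \<Longrightarrow> continuous_on {0..1} (\<lambda>t. W t \<omega>)"
    and normal_increments: "\<And>s t. 0 \<le> s \<Longrightarrow> s < t \<Longrightarrow> t \<le> 1 \<Longrightarrow>
      distributed N lborel (\<lambda>\<omega>. W t \<omega> - W s \<omega>) (normal_density 0 (sqrt (t - s)))"
    and indep_increments: "\<And>(m::nat) \<tau>. strict_mono_on {0..m} \<tau> \<Longrightarrow> \<tau> ` {0..m} \<subseteq> {0..1} \<Longrightarrow>
      indep_vars (\<lambda>_. borel) (\<lambda>j \<omega>. W (\<tau> (Suc j)) \<omega> - W (\<tau> j) \<omega>) {..<m}"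

text \<open>Independence of the components is independence of whole processes, i.e. of random elements of
  \<open>\<real>\<^bsup>[0,1]\<^esup>\<close> with the product sigma-algebra.\<close>

locale standard_multidim_brownian_motion = prob_space N for N :: "'b measure" +
  fixes k :: nat and B :: "nat \<Rightarrow> real \<Rightarrow> 'b \<Rightarrow> real"
  assumes components: "\<And>i. i \<in> {1..k} \<Longrightarrow> standard_brownian_motion N (B i)"
    and indep_components:
      "indep_vars (\<lambda>_. \<Pi>\<^sub>M t\<in>{0..1::real}. (borel :: real measure))
        (\<lambda>i \<omega>. \<lambda>t\<in>{0..1}. B i t \<omega>) {1..k}"

text \<open>In the following, \<open>b i t\<close> is a single path \<open>B i t \<omega>\<close>.\<close>

definition Z_lim :: "nat \<Rightarrow> (nat \<Rightarrow> real \<Rightarrow> real) \<Rightarrow> real" where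
  "Z_lim k b = (1 / real k) * (\<Sum>i=1..k. b i 1)"

definition b_tilde :: "(nat \<Rightarrow> real \<Rightarrow> real) \<Rightarrow> nat \<Rightarrow> real \<Rightarrow> real" where
  "b_tilde b i t = (1 / sqrt 2) * (b i t - b (i + 1) t)"

text \<open>The supremum is a maximum because the paths are continuous and the ordered time vectors
  \<open>0 \<le> t 1 \<le> \<dots> \<le> t (k-1) \<le> 1\<close> form a compact set.\<close>

definition H_lim :: "nat \<Rightarrow> (nat \<Rightarrow> real \<Rightarrow> real) \<Rightarrow> real" where
  "H_lim k b = (if k = 1 then 0 else
     sqrt 2 * (- (1 / real k) * (\<Sum>i=1..k-1. real i * b_tilde b i 1)
       + (SUP t \<in> {t :: nat \<Rightarrow> real. mono_on {1..k-1} t \<and> t ` {1..k-1} \<subseteq> {0..1}}.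
            \<Sum>i=1..k-1. b_tilde b i (t i))))"

end

theory Submission
  imports Defs "HOL-Real_Asymp.Real_Asymp"
begin

text \<open>
  The theorem rests on the fact that a longest nondecreasing subsequence is a last passage problem. Cut
  the time interval \<open>{1..n}\<close> into consecutive blocks, assign to the blocks increasing letters, and count
  in each block the occurrences of its letter; the maximum over all cuts is \<open>LI\<close>. The proof compares
  three such maxima.

  \<^emph>\<open>Only the most probable letters matter\<close> (\<open>LI_last_passage_comparison\<close>). Lumping all letters beyond a large
  index into one letter can only lengthen increasing subsequences, and the lumped letter still has
  probability below \<open>p_max\<close>. So it suffices to bound the gain from using, on some time interval, one of
  finitely many letters of probability \<open>u < p_max\<close> instead of a most probable one. The difference of
  the two counts is a random walk \<open>D\<close> with negative drift for which \<open>(p_max / u) powr D\<close> has expectation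
  \<open>1\<close>, as in the gambler's ruin problem (\<open>excess_bound\<close>). Hence the gain exceeds \<open>n powr (1/4)\<close> on some
  interval only with probability tending to \<open>0\<close>, and \<open>n powr (1/4)\<close> is negligible against \<open>sqrt n\<close>.

  \<^emph>\<open>Invariance\<close> (\<open>last_passage_universality\<close>). Restricted to the \<open>k\<close> most probable letters, the centred
  indicators of the letters form iid vectors, and the last passage value is a function of \<open>n\<close> such
  vectors. Lindeberg's method replaces them one at a time by Gaussian vectors with the same first and
  second moments. The maximum is not smooth, so it is first replaced by the logarithm of a sum of
  exponentials at inverse temperature \<open>b\<close>. As there are at most \<open>(n + 1) ^ k\<close> cuts, this costs
  \<open>k * ln (n + 1) / b\<close>, while the third derivatives are of order \<open>b\<^sup>2\<close>, so that all replacements together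
  cost \<open>n * b\<^sup>2 * n powr (-3/2)\<close>. Both errors vanish for \<open>b = n powr (1/8)\<close>. The comparison takes place at the
  level of \<open>n\<close> steps, with a Gaussian problem that can be read off from a Brownian motion on a grid.

  \<^emph>\<open>The Gaussian problem\<close> (\<open>gaussian_last_passage_tendsto\<close>). The increments of the Brownian motion over the
  grid \<open>i / n\<close>, rescaled by \<open>sqrt (p_max * n)\<close> and with their mean over the \<open>k\<close> coordinates shrunk by the
  factor \<open>sqrt (1 - p_max * k)\<close>, are Gaussian vectors with exactly the required
  covariance \<open>p_max * of_bool (r = s) - p_max\<^sup>2\<close>. Summation by parts turns the last passage value over
  the grid into the functional of the limit with times restricted to the grid, and continuity of the
  paths gives convergence for every outcome (\<open>last_passage_tendsto\<close>).

  Together these give convergence of expectations of smooth test functions; sine and cosine are such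
  functions, so the characteristic functions converge and Levy's theorem applies.
\<close>

section \<open>A smooth approximation of the maximum\<close>

text \<open>The free energy of the energies \<open>g\<close> at inverse temperature \<open>b\<close>: a smooth substitute for the maximum.\<close>

definition smooth_max :: "real \<Rightarrow> 'c set \<Rightarrow> ('c \<Rightarrow> real) \<Rightarrow> real" where
  "smooth_max b T g = ln (\<Sum>c\<in>T. exp (b * g c)) / b"

lemma sum_exp_pos:
  assumes "finite T" "T \<noteq> {}"
  shows "(\<Sum>c\<in>T. exp (h c) :: real) > 0"
  using assms by (intro sum_pos) auto

lemma smooth_max_bounds:
  assumes T: "finite T" "T \<noteq> {}" and b: "b > 0"
  shows "Max (g ` T) \<le> smooth_max b T g"
    and "smooth_max b T g \<le> Max (g ` T) + ln (real (card T)) / b"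
proof -
  obtain c0 where c0: "c0 \<in> T" "g c0 = Max (g ` T)"
  proof -
    have "Max (g ` T) \<in> g ` T" using T by (intro Max_in) auto
    then show ?thesis using that by auto
  qed
  have "exp (b * Max (g ` T)) = (\<Sum>c\<in>{c0}. exp (b * g c))"
    using c0 by simp
  also have "\<dots> \<le> (\<Sum>c\<in>T. exp (b * g c))"
    using T c0 by (intro sum_mono2) auto
  finally have "b * Max (g ` T) \<le> ln (\<Sum>c\<in>T. exp (b * g c))"
    using sum_exp_pos[OF T] by (simp add: ln_ge_iff)
  then show "Max (g ` T) \<le> smooth_max b T g"
    using b by (simp add: smooth_max_def field_simps)
  have "(\<Sum>c\<in>T. exp (b * g c)) \<le> (\<Sum>c\<in>T. exp (b * Max (g ` T)))"
    using T b by (intro sum_mono) auto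
  then have "(\<Sum>c\<in>T. exp (b * g c)) \<le> real (card T) * exp (b * Max (g ` T))"
    by simp
  then have "ln (\<Sum>c\<in>T. exp (b * g c)) \<le> ln (real (card T) * exp (b * Max (g ` T)))"
    using sum_exp_pos[OF T] T by (subst ln_le_cancel_iff) (auto simp: card_gt_0_iff)
  also have "\<dots> = ln (real (card T)) + b * Max (g ` T)"
    using T by (subst ln_mult) (auto simp: card_gt_0_iff)
  finally show "smooth_max b T g \<le> Max (g ` T) + ln (real (card T)) / b"
    using b by (simp add: smooth_max_def field_simps)
qed

text \<open>The first derivatives of \<open>smooth_max\<close>.\<close>

definition gibbs_weight :: "real \<Rightarrow> 'c set \<Rightarrow> ('c \<Rightarrow> real) \<Rightarrow> 'c \<Rightarrow> real" where
  "gibbs_weight b T g c = exp (b * g c) / (\<Sum>c\<in>T. exp (b * g c))"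

text \<open>Along the line \<open>g + s * v\<close> the derivatives of the free energy are the cumulants of \<open>v\<close> under the Gibbs
  measure: the mean, \<open>b\<close> times the variance, and \<open>b\<^sup>2\<close> times the third cumulant. This is where the factor
  \<open>b\<^sup>2\<close> of the remainder comes from. What matters for the exchange of random vectors is that the main
  part is a polynomial of degree two in \<open>v\<close>, whose coefficients depend on \<open>g\<close> only.\<close>

lemma smooth_max_taylor:
  fixes f f1 f2 f3 :: "real \<Rightarrow> real" and g v :: "'c \<Rightarrow> real"
  assumes T: "finite T" "T \<noteq> {}" and b: "b \<ge> 1"
    and v: "\<And>c. c \<in> T \<Longrightarrow> \<bar>v c\<bar> \<le> a"
    and f: "\<And>x. (f has_real_derivative f1 x) (at x)"
      "\<And>x. (f1 has_real_derivative f2 x) (at x)"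
      "\<And>x. (f2 has_real_derivative f3 x) (at x)"
    and A: "\<And>x. \<bar>f1 x\<bar> \<le> A" "\<And>x. \<bar>f2 x\<bar> \<le> A" "\<And>x. \<bar>f3 x\<bar> \<le> A"
  defines "u \<equiv> smooth_max b T g"
    and "m1 \<equiv> \<Sum>c\<in>T. gibbs_weight b T g c * v c"
    and "m2 \<equiv> \<Sum>c\<in>T. gibbs_weight b T g c * (v c)\<^sup>2"
  shows "\<bar>f (smooth_max b T (\<lambda>c. g c + v c))
    - (f u + f1 u * m1 + (f2 u * m1\<^sup>2 + f1 u * (b * (m2 - m1\<^sup>2))) / 2)\<bar> \<le> 3 * A * b\<^sup>2 * a ^ 3"
proof -
  define S where "S j s = (\<Sum>c\<in>T. v c ^ j * exp (b * (g c + s * v c)))" for j :: nat and s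
  have S_deriv: "(S j has_real_derivative b * S (Suc j) s) (at s)" for j s
    unfolding S_def
    by (auto intro!: derivative_eq_intros sum.cong simp: sum_distrib_left)
  have S0: "S 0 s > 0" for s
    unfolding S_def using sum_exp_pos[OF T] by simp
  have a0: "a \<ge> 0"
    using v T(2) by (meson abs_ge_zero all_not_in_conv order_trans)
  have S_bound: "\<bar>S j s / S 0 s\<bar> \<le> a ^ j" for j s
  proof -
    have "\<bar>S j s\<bar> \<le> (\<Sum>c\<in>T. \<bar>v c ^ j * exp (b * (g c + s * v c))\<bar>)"
      unfolding S_def by (rule sum_abs)
    also have "\<dots> \<le> (\<Sum>c\<in>T. a ^ j * exp (b * (g c + s * v c)))"
      using v by (intro sum_mono) (auto simp: abs_mult power_abs intro!: mult_right_mono power_mono)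
    also have "\<dots> = a ^ j * S 0 s"
      by (simp add: S_def sum_distrib_left)
    finally show ?thesis
      using S0[of s] by (simp add: field_simps)
  qed
  define R where "R j s = S j s / S 0 s" for j s
  \<comment> \<open>\<open>R j\<close> is the \<open>j\<close>-th moment of \<open>v\<close> under the Gibbs measure of \<open>g + s * v\<close>.\<close>
  have R_deriv: "(R j has_real_derivative b * (R (Suc j) s - R j s * R 1 s)) (at s)" for j s
  proof -
    have "((\<lambda>s. S j s / S 0 s) has_real_derivative
        (b * S (Suc j) s * S 0 s - S j s * (b * S (Suc 0) s)) / (S 0 s * S 0 s)) (at s)"
      using S0[of s] by (intro DERIV_divide S_deriv) auto
    then show ?thesis
      using S0[of s] by (simp add: R_def[abs_def] diff_divide_distrib right_diff_distrib mult.left_commute)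
  qed
  have R_bound: "\<bar>R j s\<bar> \<le> a ^ j" for j s
    using S_bound by (simp add: R_def)
  \<comment> \<open>\<open>U\<close> is the free energy along the line; \<open>D1\<close>, \<open>D2\<close>, \<open>D3\<close> are the derivatives of its composition with \<open>f\<close>.\<close>
  define U where "U s = ln (S 0 s) / b" for s
  have U_deriv: "(U has_real_derivative R 1 s) (at s)" for s
  proof -
    have "((\<lambda>s. ln (S 0 s)) has_real_derivative 1 / S 0 s * (b * S (Suc 0) s)) (at s)"
      by (rule DERIV_chain2[OF DERIV_ln_divide[OF S0] S_deriv])
    from DERIV_cdivide[OF this, of b] show ?thesis
      using b by (simp add: U_def[abs_def] R_def)
  qed
  define D1 where "D1 s = f1 (U s) * R 1 s" for s
  define D2 where "D2 s = f2 (U s) * (R 1 s)\<^sup>2 + f1 (U s) * (b * (R 2 s - (R 1 s)\<^sup>2))" for s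
  define D3 where "D3 s = f3 (U s) * R 1 s ^ 3 + 3 * f2 (U s) * R 1 s * (b * (R 2 s - (R 1 s)\<^sup>2))
     + f1 (U s) * (b\<^sup>2 * (R 3 s - 3 * R 1 s * R 2 s + 2 * R 1 s ^ 3))" for s
  have fU: "((\<lambda>s. f (U s)) has_real_derivative f1 (U s) * R 1 s) (at s)"
    "((\<lambda>s. f1 (U s)) has_real_derivative f2 (U s) * R 1 s) (at s)"
    "((\<lambda>s. f2 (U s)) has_real_derivative f3 (U s) * R 1 s) (at s)" for s
    using DERIV_chain2[OF f(1) U_deriv] DERIV_chain2[OF f(2) U_deriv] DERIV_chain2[OF f(3) U_deriv]
    by auto
  have D1: "(D1 has_real_derivative D2 s) (at s)" for s
    using DERIV_mult[OF fU(2) R_deriv[of 1 s]] unfolding D1_def[abs_def] D2_def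
    by (simp add: algebra_simps power2_eq_square numeral_2_eq_2)
  have R2: "((\<lambda>s. R 2 s - (R 1 s)\<^sup>2) has_real_derivative
      b * (R 3 s - 3 * R 1 s * R 2 s + 2 * R 1 s ^ 3)) (at s)" for s
  proof -
    have "((\<lambda>s. R 2 s - R 1 s * R 1 s) has_real_derivative
       b * (R 3 s - R 2 s * R 1 s) - (b * (R 2 s - R 1 s * R 1 s) * R 1 s
         + b * (R 2 s - R 1 s * R 1 s) * R 1 s)) (at s)"
      using R_deriv[of 1 s] R_deriv[of 2 s]
      by (intro DERIV_diff DERIV_mult) (simp_all add: numeral_2_eq_2 numeral_3_eq_3)
    then show ?thesis
      by (simp add: power2_eq_square power3_eq_cube algebra_simps)
  qed
  have R1_sq: "((\<lambda>s. (R 1 s)\<^sup>2) has_real_derivative 2 * R 1 s * (b * (R 2 s - (R 1 s)\<^sup>2))) (at s)" for s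
    using DERIV_mult[OF R_deriv[of 1 s] R_deriv[of 1 s]]
    by (simp add: power2_eq_square numeral_2_eq_2 algebra_simps)
  have D2: "(D2 has_real_derivative D3 s) (at s)" for s
    using DERIV_add[OF DERIV_mult[OF fU(3) R1_sq] DERIV_mult[OF fU(2) DERIV_cmult[OF R2, of b]]]
    unfolding D2_def[abs_def] D3_def
    by (simp add: algebra_simps power2_eq_square power3_eq_cube)
  define diff where "diff m = (if m = 0 then (\<lambda>s. f (U s)) else if m = 1 then D1
    else if m = 2 then D2 else D3)" for m :: nat
  have "\<exists>t. 0 < t \<and> t < 1 \<and> f (U 1) =
     (\<Sum>m<3. (diff m 0 / fact m) * 1 ^ m) + (diff 3 t / fact 3) * 1 ^ 3"
  proof (rule Maclaurin)
    show "\<forall>m t. m < 3 \<and> 0 \<le> t \<and> t \<le> 1 \<longrightarrow> (diff m has_real_derivative diff (Suc m) t) (at t)"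
    proof (intro allI impI)
      fix m :: nat and t :: real
      assume "m < 3 \<and> 0 \<le> t \<and> t \<le> 1"
      then have "m = 0 \<or> m = 1 \<or> m = 2" by auto
      then show "(diff m has_real_derivative diff (Suc m) t) (at t)"
        using fU(1)[of t] D1[of t] D2[of t] by (auto simp: diff_def D1_def)
    qed
  qed (auto simp: diff_def)
  then obtain t where t: "f (U 1) = f (U 0) + D1 0 + D2 0 / 2 + D3 t / 6"
    by (auto simp: diff_def eval_nat_numeral fact_reduce)
  have r1: "\<bar>R 1 t\<bar> \<le> a" and r2: "\<bar>R 2 t\<bar> \<le> a\<^sup>2" and r3: "\<bar>R 3 t\<bar> \<le> a ^ 3"
    using R_bound[of 1 t] R_bound[of 2 t] R_bound[of 3 t] by auto
  have r11: "(R 1 t)\<^sup>2 \<le> a\<^sup>2"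
    using r1 a0 by (simp add: abs_le_square_iff[symmetric])
  have r111: "\<bar>R 1 t ^ 3\<bar> \<le> a ^ 3"
    using power_mono[OF r1, of 3] by (simp add: power_abs)
  have A0: "A \<ge> 0" using A(1)[of 0] by linarith
  have k2: "\<bar>R 2 t - (R 1 t)\<^sup>2\<bar> \<le> 2 * a\<^sup>2"
    using r2 r11 zero_le_power2[of "R 1 t"] unfolding abs_le_iff by (intro conjI) linarith+
  have r12: "\<bar>R 1 t * R 2 t\<bar> \<le> a ^ 3"
    using mult_mono[OF r1 r2] a0 by (simp add: abs_mult power3_eq_cube power2_eq_square)
  have k3: "\<bar>R 3 t - 3 * R 1 t * R 2 t + 2 * R 1 t ^ 3\<bar> \<le> 6 * a ^ 3"
    using r3 r12 r111 by linarith
  have t1: "\<bar>f3 (U t) * R 1 t ^ 3\<bar> \<le> A * a ^ 3"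
    unfolding abs_mult by (intro mult_mono A r111 A0) auto
  have t2: "\<bar>3 * f2 (U t) * R 1 t * (b * (R 2 t - (R 1 t)\<^sup>2))\<bar> \<le> 6 * (A * b * a ^ 3)"
  proof -
    have "\<bar>f2 (U t)\<bar> * (\<bar>R 1 t\<bar> * (b * \<bar>R 2 t - (R 1 t)\<^sup>2\<bar>)) \<le> A * (a * (b * (2 * a\<^sup>2)))"
      using b by (intro mult_mono A r1 k2 A0 a0 order_refl mult_nonneg_nonneg) auto
    moreover have "\<bar>3 * f2 (U t) * R 1 t * (b * (R 2 t - (R 1 t)\<^sup>2))\<bar>
        = 3 * (\<bar>f2 (U t)\<bar> * (\<bar>R 1 t\<bar> * (b * \<bar>R 2 t - (R 1 t)\<^sup>2\<bar>)))"
      using b unfolding abs_mult by simp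
    moreover have "A * (a * (b * (2 * a\<^sup>2))) = 2 * (A * b * a ^ 3)"
      by (simp add: power3_eq_cube power2_eq_square)
    ultimately show ?thesis by linarith
  qed
  have t3: "\<bar>f1 (U t) * (b\<^sup>2 * (R 3 t - 3 * R 1 t * R 2 t + 2 * R 1 t ^ 3))\<bar> \<le> 6 * (A * b\<^sup>2 * a ^ 3)"
  proof -
    have "\<bar>f1 (U t)\<bar> * (b\<^sup>2 * \<bar>R 3 t - 3 * R 1 t * R 2 t + 2 * R 1 t ^ 3\<bar>) \<le> A * (b\<^sup>2 * (6 * a ^ 3))"
      by (intro mult_mono A k3 A0 order_refl mult_nonneg_nonneg) auto
    moreover have "A * (b\<^sup>2 * (6 * a ^ 3)) = 6 * (A * b\<^sup>2 * a ^ 3)"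
      by simp
    ultimately show ?thesis unfolding abs_mult[of "f1 (U t)"] abs_mult[of "b\<^sup>2"] by simp
  qed
  have Aa: "A * a ^ 3 \<ge> 0" using A0 a0 by simp
  have bb: "b \<le> b\<^sup>2" "1 \<le> b\<^sup>2"
    using b by (auto simp: power2_eq_square mult_le_cancel_left1 intro: order_trans)
  have "A * a ^ 3 \<le> A * b\<^sup>2 * a ^ 3" "A * b * a ^ 3 \<le> A * b\<^sup>2 * a ^ 3"
    using mult_right_mono[OF bb(2) Aa] mult_right_mono[OF bb(1) Aa] by (auto simp: algebra_simps)
  then have "\<bar>D3 t\<bar> \<le> 13 * (A * b\<^sup>2 * a ^ 3)"
    unfolding D3_def using t1 t2 t3 by linarith
  then have D3_bound: "\<bar>D3 t / 6\<bar> \<le> 3 * A * b\<^sup>2 * a ^ 3"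
    using abs_ge_zero[of "D3 t"] by (simp add: abs_divide)
  have R1: "R 1 0 = m1" "R 2 0 = m2"
    by (simp_all add: R_def S_def m1_def m2_def gibbs_weight_def sum_divide_distrib mult.commute)
  have U: "U 0 = u" "U 1 = smooth_max b T (\<lambda>c. g c + v c)"
    by (simp_all add: U_def S_def u_def smooth_max_def)
  show ?thesis
    using t D3_bound unfolding D1_def D2_def R1 U by simp
qed

section \<open>Lindeberg's exchange of random vectors\<close>

lemma (in prob_space) abs_integral_le:
  fixes f :: "'a \<Rightarrow> real"
  assumes "\<And>x. \<bar>f x\<bar> \<le> C"
  shows "\<bar>integral\<^sup>L M f\<bar> \<le> C"
proof (cases "integrable M f")
  case True
  have "\<bar>integral\<^sup>L M f\<bar> \<le> (\<integral>x. \<bar>f x\<bar> \<partial>M)"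
    by (rule integral_abs_bound)
  also have "\<dots> \<le> (\<integral>x. C \<partial>M)"
    using True assms by (intro integral_mono) auto
  finally show ?thesis by (simp add: prob_space)
next
  case False
  moreover have "0 \<le> C" using assms[of undefined] by linarith
  ultimately show ?thesis by (simp add: not_integrable_integral_eq)
qed

text \<open>Lindeberg's exchange: the hybrid product measures that use \<open>Q\<close> on a growing set of coordinates
  interpolate between the two powers, and by Fubini two neighbouring hybrids differ only in an inner
  integral over a single coordinate.\<close>

lemma integral_PiM_diff_le:
  fixes F :: "('i \<Rightarrow> 'e) \<Rightarrow> real"
  assumes P: "prob_space P" and Q: "prob_space Q" and sets: "sets P = sets Q"
    and I: "finite I"
    and F: "F \<in> borel_measurable (PiM I (\<lambda>_. P))"
    and bdd: "\<And>x. \<bar>F x\<bar> \<le> C"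
    and swap: "\<And>i x. i \<in> I \<Longrightarrow>
      \<bar>(\<integral>y. F (x(i := y)) \<partial>P) - (\<integral>y. F (x(i := y)) \<partial>Q)\<bar> \<le> \<epsilon>"
  shows "\<bar>integral\<^sup>L (PiM I (\<lambda>_. P)) F - integral\<^sup>L (PiM I (\<lambda>_. Q)) F\<bar> \<le> real (card I) * \<epsilon>"
proof -
  define H where "H J = (\<lambda>i. if i \<in> J then Q else P)" for J :: "'i set"
  have H_prob: "prob_space (H J i)" for J i
    using P Q by (simp add: H_def)
  have sigma: "product_sigma_finite (H J)" for J
    unfolding product_sigma_finite_def using H_prob by (blast intro: prob_space_imp_sigma_finite)
  have sets_H: "sets (PiM K (H J)) = sets (PiM K (\<lambda>_. P))" for K J
    by (intro sets_PiM_cong) (auto simp: H_def sets)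
  have F_H: "F \<in> borel_measurable (PiM I (H J))" for J
    using F sets_H[of I J] by (simp cong: measurable_cong_sets)
  have int_H: "integrable (PiM I (H J)) F" for J
  proof -
    interpret prob_space "PiM I (H J)" by (intro prob_space_PiM H_prob)
    show ?thesis using F_H bdd by (intro integrable_const_bound[of _ C]) auto
  qed
  have main: "\<bar>integral\<^sup>L (PiM I (\<lambda>_. P)) F - integral\<^sup>L (PiM I (H J)) F\<bar> \<le> real (card J) * \<epsilon>"
    if "J \<subseteq> I" for J
    using finite_subset[OF that I] that
  proof (induction J rule: finite_induct)
    case empty
    then show ?case by (simp add: H_def)
  next
    case (insert i J)
    define K where "K = I - {i}"
    have K: "I = insert i K" "i \<notin> K" "finite K"
      using insert.prems I by (auto simp: K_def)
    define g where "g R x = (\<integral>y. F (x(i := y)) \<partial>R)" for R x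
    have step: "integral\<^sup>L (PiM I (H L)) F = (\<integral>x. g (H L i) x \<partial>PiM K (H L))" for L
    proof -
      interpret product_sigma_finite "H L" by (rule sigma)
      show ?thesis
        using product_integral_insert[OF K(3) K(2), of F] int_H[of L] K(1) by (simp add: g_def)
    qed
    have same: "PiM K (H (insert i J)) = PiM K (H J)"
      using K(2) by (intro PiM_cong) (auto simp: H_def)
    interpret prob_space "PiM K (H J)" by (intro prob_space_PiM H_prob)
    have g_int: "integrable (PiM K (H J)) (g R)" if R: "R = P \<or> R = Q" for R
    proof (rule integrable_const_bound[of _ C])
      interpret R: prob_space R using R P Q by auto
      have sR: "sets R = sets P" using R sets by auto
      have "(\<lambda>(x, y). F (x(i := y))) \<in> borel_measurable (PiM K (H J) \<Otimes>\<^sub>M R)"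
      proof -
        have "(\<lambda>(x, y). x(i := y)) \<in> measurable (PiM K (\<lambda>_. P) \<Otimes>\<^sub>M P) (PiM (insert i K) (\<lambda>_. P))"
          by (rule measurable_add_dim)
        then have "(\<lambda>z. F ((\<lambda>(x, y). x(i := y)) z)) \<in> borel_measurable (PiM K (\<lambda>_. P) \<Otimes>\<^sub>M P)"
          using F unfolding K(1) by (rule measurable_compose)
        moreover have "sets (PiM K (H J) \<Otimes>\<^sub>M R) = sets (PiM K (\<lambda>_. P) \<Otimes>\<^sub>M P)"
          by (intro sets_pair_measure_cong sets_H sR)
        ultimately show ?thesis
          by (simp add: case_prod_unfold cong: measurable_cong_sets)
      qed
      then show "g R \<in> borel_measurable (PiM K (H J))"
        unfolding g_def by (rule R.borel_measurable_lebesgue_integral)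
      have "\<bar>g R x\<bar> \<le> C" for x
        unfolding g_def
        using bdd by (rule R.abs_integral_le)
      then show "AE x in PiM K (H J). norm (g R x) \<le> C" by simp
    qed
    have "\<bar>integral\<^sup>L (PiM I (H J)) F - integral\<^sup>L (PiM I (H (insert i J))) F\<bar>
        = \<bar>\<integral>x. g P x - g Q x \<partial>PiM K (H J)\<bar>"
      using insert.hyps g_int[of P] g_int[of Q] by (simp add: step same) (simp add: H_def)
    also have "\<dots> \<le> (\<integral>x. \<bar>g P x - g Q x\<bar> \<partial>PiM K (H J))"
      by (rule integral_abs_bound)
    also have "\<dots> \<le> (\<integral>x. \<epsilon> \<partial>PiM K (H J))"
    proof (rule integral_mono)
      show "integrable (PiM K (H J)) (\<lambda>x. \<bar>g P x - g Q x\<bar>)"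
        using g_int[of P] g_int[of Q] by auto
    qed (use swap insert.prems in \<open>auto simp: g_def\<close>)
    also have "\<dots> = \<epsilon>" by (simp add: prob_space)
    finally show ?case
      using insert.IH insert.prems insert.hyps by (simp add: algebra_simps)
  qed
  have "PiM I (H I) = PiM I (\<lambda>_. Q)"
    by (intro PiM_cong) (auto simp: H_def)
  then show ?thesis using main[of I] by simp
qed

text \<open>The law of a random vector with coordinates in \<open>R\<close>. The parameter \<open>second_moment\<close> collects the
  expectations of \<open>y r * y s\<close>; two laws that interpret this locale with the same parameters can be
  exchanged up to third order.\<close>

locale moment_law = prob_space P for P :: "('r \<Rightarrow> real) measure" +
  fixes R :: "'r set" and mean :: "'r \<Rightarrow> real" and second_moment :: "'r \<Rightarrow> 'r \<Rightarrow> real"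
  assumes fin: "finite R"
    and sets_P: "sets P = sets (PiM R (\<lambda>_. borel))"
    and first: "\<And>r. r \<in> R \<Longrightarrow> has_bochner_integral P (\<lambda>y. y r) (mean r)"
    and second: "\<And>r s. r \<in> R \<Longrightarrow> s \<in> R \<Longrightarrow> has_bochner_integral P (\<lambda>y. y r * y s) (second_moment r s)"
    and third: "integrable P (\<lambda>y. (\<Sum>r\<in>R. \<bar>y r\<bar>) ^ 3)"
begin

lemma component_measurable: "r \<in> R \<Longrightarrow> (\<lambda>y. y r) \<in> borel_measurable P"
  using sets_P by (simp cong: measurable_cong_sets)

text \<open>The expectation of the Taylor polynomial involves only the first and second moments of the law.\<close>

lemma smooth_max_expectation:
  fixes f f1 f2 f3 :: "real \<Rightarrow> real" and g :: "'c \<Rightarrow> real" and \<rho> :: "'c \<Rightarrow> 'r"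
  assumes T: "finite T" "T \<noteq> {}" and \<rho>: "\<rho> \<in> T \<rightarrow> R" and b: "b \<ge> 1" and h: "h \<ge> 0"
    and f: "\<And>x. (f has_real_derivative f1 x) (at x)"
      "\<And>x. (f1 has_real_derivative f2 x) (at x)"
      "\<And>x. (f2 has_real_derivative f3 x) (at x)"
    and A: "\<And>x. \<bar>f x\<bar> \<le> A" "\<And>x. \<bar>f1 x\<bar> \<le> A" "\<And>x. \<bar>f2 x\<bar> \<le> A" "\<And>x. \<bar>f3 x\<bar> \<le> A"
  defines "u \<equiv> smooth_max b T g"
    and "w \<equiv> gibbs_weight b T g"
  defines "e1 \<equiv> \<Sum>c\<in>T. w c * (h * mean (\<rho> c))"
    and "e11 \<equiv> \<Sum>c\<in>T. \<Sum>d\<in>T. w c * w d * (h\<^sup>2 * second_moment (\<rho> c) (\<rho> d))"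
    and "e2 \<equiv> \<Sum>c\<in>T. w c * (h\<^sup>2 * second_moment (\<rho> c) (\<rho> c))"
  shows "\<bar>(\<integral>y. f (smooth_max b T (\<lambda>c. g c + h * y (\<rho> c))) \<partial>P)
      - (f u + f1 u * e1 + (f2 u * e11 + f1 u * (b * (e2 - e11))) / 2)\<bar>
    \<le> 3 * A * b\<^sup>2 * h ^ 3 * (\<integral>y. (\<Sum>r\<in>R. \<bar>y r\<bar>) ^ 3 \<partial>P)"
proof -
  define F where "F y = f (smooth_max b T (\<lambda>c. g c + h * y (\<rho> c)))" for y
  define m1 where "m1 y = (\<Sum>c\<in>T. w c * (h * y (\<rho> c)))" for y
  define m2 where "m2 y = (\<Sum>c\<in>T. w c * (h * y (\<rho> c))\<^sup>2)" for y
  define t where "t y = f u + f1 u * m1 y + (f2 u * (m1 y)\<^sup>2 + f1 u * (b * (m2 y - (m1 y)\<^sup>2))) / 2" for y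
  have [measurable]: "f \<in> borel_measurable borel"
    using f(1) by (intro borel_measurable_continuous_onI continuous_at_imp_continuous_on)
      (auto intro: DERIV_isCont)
  have comp [measurable]: "c \<in> T \<Longrightarrow> (\<lambda>y. y (\<rho> c)) \<in> borel_measurable P" for c
    using funcset_mem[OF \<rho>] component_measurable by auto
  have F_int: "integrable P F"
  proof (rule integrable_const_bound[of _ A])
    show "F \<in> borel_measurable P"
      unfolding F_def smooth_max_def by measurable
  qed (use A in \<open>auto simp: F_def\<close>)
  have m1: "has_bochner_integral P m1 e1"
    unfolding m1_def e1_def using \<rho>
    by (intro has_bochner_integral_sum has_bochner_integral_mult_right first) auto
  have "(m1 y)\<^sup>2 = (\<Sum>c\<in>T. \<Sum>d\<in>T. w c * w d * (h\<^sup>2 * (y (\<rho> c) * y (\<rho> d))))" for y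
    by (simp add: m1_def power2_eq_square sum_product algebra_simps)
  then have m11: "has_bochner_integral P (\<lambda>y. (m1 y)\<^sup>2) e11"
    unfolding e11_def using \<rho>
    by (simp only:) (intro has_bochner_integral_sum has_bochner_integral_mult_right second; auto)
  have "m2 y = (\<Sum>c\<in>T. w c * (h\<^sup>2 * (y (\<rho> c) * y (\<rho> c))))" for y
    by (simp add: m2_def power2_eq_square algebra_simps)
  then have m2: "has_bochner_integral P m2 e2"
    unfolding e2_def using \<rho>
    by (simp only: fun_eq_iff[symmetric] cong: has_bochner_integral_cong)
       (intro has_bochner_integral_sum has_bochner_integral_mult_right second; auto)
  have const: "has_bochner_integral P (\<lambda>y. f u) (f u)"
    by (simp add: has_bochner_integral_iff prob_space)
  have t: "has_bochner_integral P t (f u + f1 u * e1 + (f2 u * e11 + f1 u * (b * (e2 - e11))) / 2)"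
    unfolding t_def
    by (intro has_bochner_integral_add has_bochner_integral_mult_right has_bochner_integral_diff
        has_bochner_integral_divide_zero const m1 m11 m2)
  have pointwise: "\<bar>F y - t y\<bar> \<le> 3 * A * b\<^sup>2 * h ^ 3 * (\<Sum>r\<in>R. \<bar>y r\<bar>) ^ 3" for y
  proof -
    have v: "\<bar>h * y (\<rho> c)\<bar> \<le> h * (\<Sum>r\<in>R. \<bar>y r\<bar>)" if "c \<in> T" for c
      using h member_le_sum[of "\<rho> c" R "\<lambda>r. \<bar>y r\<bar>"] funcset_mem[OF \<rho> that] fin
      by (simp add: abs_mult mult_left_mono)
    show ?thesis
      using smooth_max_taylor[OF T b v f A(2-4)] unfolding F_def t_def m1_def m2_def u_def w_def
      by (simp add: power_mult_distrib mult.assoc)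
  qed
  have "\<bar>(\<integral>y. F y \<partial>P) - (\<integral>y. t y \<partial>P)\<bar> = \<bar>\<integral>y. F y - t y \<partial>P\<bar>"
    using F_int t by (simp add: has_bochner_integral_iff)
  also have "\<dots> \<le> (\<integral>y. \<bar>F y - t y\<bar> \<partial>P)"
    by (rule integral_abs_bound)
  also have "\<dots> \<le> (\<integral>y. 3 * A * b\<^sup>2 * h ^ 3 * (\<Sum>r\<in>R. \<bar>y r\<bar>) ^ 3 \<partial>P)"
    using F_int t third pointwise by (intro integral_mono) (auto simp: has_bochner_integral_iff)
  also have "\<dots> = 3 * A * b\<^sup>2 * h ^ 3 * (\<integral>y. (\<Sum>r\<in>R. \<bar>y r\<bar>) ^ 3 \<partial>P)"
    by simp
  finally show ?thesis
    using t by (simp add: F_def has_bochner_integral_iff)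
qed

end

text \<open>One summand of the Lindeberg exchange sees the vector in coordinate \<open>i\<close> only through the energies
  \<open>h * y (c i)\<close> that it adds to those of the other coordinates.\<close>

lemma smooth_max_invariance:
  fixes f f1 f2 f3 :: "real \<Rightarrow> real" and T :: "('i \<Rightarrow> 'r) set"
  assumes P: "moment_law P R mean second_moment" and Q: "moment_law Q R mean second_moment"
    and I: "finite I" and T: "finite T" "T \<noteq> {}" "T \<subseteq> I \<rightarrow> R"
    and b: "b \<ge> 1" and h: "h \<ge> 0"
    and f: "\<And>x. (f has_real_derivative f1 x) (at x)"
      "\<And>x. (f1 has_real_derivative f2 x) (at x)"
      "\<And>x. (f2 has_real_derivative f3 x) (at x)"
    and A: "\<And>x. \<bar>f x\<bar> \<le> A" "\<And>x. \<bar>f1 x\<bar> \<le> A" "\<And>x. \<bar>f2 x\<bar> \<le> A" "\<And>x. \<bar>f3 x\<bar> \<le> A"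
  defines "F \<equiv> \<lambda>y. f (smooth_max b T (\<lambda>c. h * (\<Sum>i\<in>I. y i (c i))))"
  shows "\<bar>integral\<^sup>L (PiM I (\<lambda>_. P)) F - integral\<^sup>L (PiM I (\<lambda>_. Q)) F\<bar> \<le> real (card I) *
    (3 * A * b\<^sup>2 * h ^ 3 * ((\<integral>y. (\<Sum>r\<in>R. \<bar>y r\<bar>) ^ 3 \<partial>P) + (\<integral>y. (\<Sum>r\<in>R. \<bar>y r\<bar>) ^ 3 \<partial>Q)))"
proof -
  interpret P: moment_law P R mean second_moment by (rule P)
  interpret Q: moment_law Q R mean second_moment by (rule Q)
  have [measurable]: "f \<in> borel_measurable borel"
    using f(1) by (intro borel_measurable_continuous_onI continuous_at_imp_continuous_on)
      (auto intro: DERIV_isCont)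
  have meas: "F \<in> borel_measurable (PiM I (\<lambda>_. P))"
  proof -
    have [measurable]: "(\<lambda>y. y i (c i)) \<in> borel_measurable (PiM I (\<lambda>_. P))" if "c \<in> T" "i \<in> I" for c i
      using measurable_compose[OF measurable_component_singleton[OF that(2)] P.component_measurable]
        subsetD[OF T(3) that(1)] that(2) by blast
    show ?thesis
      unfolding F_def smooth_max_def by measurable
  qed
  show ?thesis
  proof (rule integral_PiM_diff_le[OF P.prob_space_axioms Q.prob_space_axioms _ I meas])
    show "sets P = sets Q" by (simp add: P.sets_P Q.sets_P)
    show "\<bar>F x\<bar> \<le> A" for x using A by (simp add: F_def)
    fix i x assume i: "i \<in> I"
    define g where "g c = h * (\<Sum>i\<in>I - {i}. x i (c i))" for c :: "'i \<Rightarrow> 'r"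
    have F: "F (x(i := y)) = f (smooth_max b T (\<lambda>c. g c + h * y (c i)))" for y
    proof -
      have "(\<Sum>i'\<in>I. (x(i := y)) i' (c i')) = y (c i) + (\<Sum>i'\<in>I - {i}. x i' (c i'))" for c
        using I i by (subst sum.remove[of I i]) (auto intro!: sum.cong)
      then show ?thesis
        by (simp add: F_def g_def algebra_simps)
    qed
    have \<rho>: "(\<lambda>c. c i) \<in> T \<rightarrow> R" using T(3) i by auto
    show "\<bar>(\<integral>y. F (x(i := y)) \<partial>P) - (\<integral>y. F (x(i := y)) \<partial>Q)\<bar> \<le>
     3 * A * b\<^sup>2 * h ^ 3 * ((\<integral>y. (\<Sum>r\<in>R. \<bar>y r\<bar>) ^ 3 \<partial>P) + (\<integral>y. (\<Sum>r\<in>R. \<bar>y r\<bar>) ^ 3 \<partial>Q))"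
      using P.smooth_max_expectation[where f = f and ?f1.0 = f1 and ?f2.0 = f2 and ?f3.0 = f3 and g = g and \<rho> = "\<lambda>c. c i", OF T(1,2) \<rho> b h f A]
        Q.smooth_max_expectation[where f = f and ?f1.0 = f1 and ?f2.0 = f2 and ?f3.0 = f3 and g = g and \<rho> = "\<lambda>c. c i", OF T(1,2) \<rho> b h f A]
      unfolding F distrib_left by linarith
  qed
qed

section \<open>Longest increasing subsequences as last passage values\<close>

text \<open>A nondecreasing labelling of the times \<open>1, \<dots>, n\<close> by \<open>1, \<dots>, k\<close> is the same as a partition of the times into
  \<open>k\<close> consecutive blocks, some of which may be empty. Labellings are easier to compose than vectors of
  break points.\<close>

definition labellings :: "nat \<Rightarrow> nat \<Rightarrow> (nat \<Rightarrow> nat) set" where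
  "labellings n k = {c \<in> {1..n} \<rightarrow>\<^sub>E {1..k}. mono_on {1..n} c}"

definition last_passage :: "nat \<Rightarrow> nat \<Rightarrow> (nat \<Rightarrow> nat \<Rightarrow> real) \<Rightarrow> real" where
  "last_passage n k y = Max ((\<lambda>c. \<Sum>i=1..n. y i (c i)) ` labellings n k)"

lemma finite_labellings: "finite (labellings n k)"
  unfolding labellings_def by (rule finite_subset[OF _ finite_PiE[of "{1..n}" "\<lambda>_. {1..k}"]]) auto

lemma labellings_nonempty: "k \<ge> 1 \<Longrightarrow> labellings n k \<noteq> {}"
proof -
  assume "k \<ge> 1"
  then have "(\<lambda>i\<in>{1..n}. 1) \<in> labellings n k"
    by (auto simp: labellings_def monotone_on_def)
  then show ?thesis by blast
qed

lemma labellings_range: "c \<in> labellings n k \<Longrightarrow> i \<in> {1..n} \<Longrightarrow> c i \<in> {1..k}"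
  by (auto simp: labellings_def)

text \<open>The times with label at most \<open>r\<close> form an initial segment, so a labelling is determined by the
  numbers of these times.\<close>

lemma labelling_le_iff:
  assumes c: "c \<in> labellings n k" and i: "i \<in> {1..n}"
  shows "c i \<le> r \<longleftrightarrow> i \<le> card {i \<in> {1..n}. c i \<le> r}"
proof -
  have mono: "c a \<le> c b" if "1 \<le> a" "a \<le> b" "b \<le> n" for a b
    using c that by (auto simp: labellings_def monotone_on_def)
  show ?thesis
  proof
    assume "c i \<le> r"
    then have "{1..i} \<subseteq> {i \<in> {1..n}. c i \<le> r}"
      using i mono[of _ i] by (auto intro: order_trans[of _ "c i"])
    then have "card {1..i} \<le> card {i \<in> {1..n}. c i \<le> r}"
      by (intro card_mono) auto
    then show "i \<le> card {i \<in> {1..n}. c i \<le> r}" by simp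
  next
    assume le: "i \<le> card {i \<in> {1..n}. c i \<le> r}"
    show "c i \<le> r"
    proof (rule ccontr)
      assume "\<not> c i \<le> r"
      then have "{i \<in> {1..n}. c i \<le> r} \<subseteq> {1..<i}"
        using i mono[of i] by (auto simp: not_le) (meson le_trans linorder_not_le)
      then have "card {i \<in> {1..n}. c i \<le> r} \<le> card {1..<i}"
        by (intro card_mono) auto
      then show False using le i by (cases i) auto
    qed
  qed
qed

lemma labelling_interval:
  assumes c: "c \<in> labellings n k" and l: "l \<ge> 1"
  obtains s t where "s \<le> t" "t \<le> n" "{i \<in> {1..n}. c i = l} = {s<..t}"
proof
  define N where "N r = card {i \<in> {1..n}. c i \<le> r}" for r
  show "N (l - 1) \<le> N l"
    unfolding N_def by (intro card_mono) auto
  have "N l \<le> card {1..n}"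
    unfolding N_def by (intro card_mono) auto
  then show le: "N l \<le> n" by simp
  have iff: "c i = l \<longleftrightarrow> N (l - 1) < i \<and> i \<le> N l" if "i \<in> {1..n}" for i
    using labelling_le_iff[OF c that, of l] labelling_le_iff[OF c that, of "l - 1"] l
    unfolding N_def[symmetric] by linarith
  then show "{i \<in> {1..n}. c i = l} = {N (l - 1)<..N l}"
  proof (intro set_eqI)
    fix i
    show "i \<in> {i \<in> {1..n}. c i = l} \<longleftrightarrow> i \<in> {N (l - 1)<..N l}"
      using iff[of i] le by (cases "i \<in> {1..n}") auto
  qed
qed

text \<open>Only polynomially many labellings exist, because each is encoded by \<open>k\<close> break points.\<close>

lemma card_labellings: "card (labellings n k) \<le> (n + 1) ^ k"
proof -
  define \<Phi> where "\<Phi> c = (\<lambda>r\<in>{1..k}. card {i \<in> {1..n}. c i \<le> r})" for c :: "nat \<Rightarrow> nat"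
  have "inj_on \<Phi> (labellings n k)"
  proof (rule inj_onI)
    fix c d assume cd: "c \<in> labellings n k" "d \<in> labellings n k" and eq: "\<Phi> c = \<Phi> d"
    have iff: "c i \<le> r \<longleftrightarrow> d i \<le> r" if "i \<in> {1..n}" "r \<in> {1..k}" for i r
    proof -
      have "card {i \<in> {1..n}. c i \<le> r} = card {i \<in> {1..n}. d i \<le> r}"
        using fun_cong[OF eq, of r] that by (simp add: \<Phi>_def)
      then show ?thesis
        using labelling_le_iff[OF cd(1) that(1)] labelling_le_iff[OF cd(2) that(1)] by simp
    qed
    have "c i = d i" if "i \<in> {1..n}" for i
      using iff[OF that, of "c i"] iff[OF that, of "d i"] labellings_range[OF cd(1) that]
        labellings_range[OF cd(2) that] by auto
    then show "c = d"
      using cd by (intro PiE_ext[of c "{1..n}" "\<lambda>_. {1..k}"]) (auto simp: labellings_def)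
  qed
  moreover have "\<Phi> ` labellings n k \<subseteq> {1..k} \<rightarrow>\<^sub>E {0..n}"
  proof -
    have "card {i \<in> {1..n}. c i \<le> r} \<le> n" for c :: "nat \<Rightarrow> nat" and r
      using card_mono[of "{1..n}" "{i \<in> {1..n}. c i \<le> r}"] by force
    then show ?thesis
      unfolding \<Phi>_def by (intro image_subsetI restrict_PiE_iff[THEN iffD2]) simp
  qed
  ultimately have "card (labellings n k) \<le> card ({1..k} \<rightarrow>\<^sub>E {0..n})"
    by (intro card_inj_on_le finite_PiE) auto
  then show ?thesis by (simp add: card_PiE)
qed

lemma last_passage_cong:
  assumes "\<And>i r. i \<in> {1..n} \<Longrightarrow> r \<in> {1..k} \<Longrightarrow> y i r = z i r"
  shows "last_passage n k y = last_passage n k z"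
  unfolding last_passage_def using assms labellings_range
  by (intro arg_cong[of _ _ Max] image_cong sum.cong refl) blast

lemma last_passage_ge:
  "c \<in> labellings n k \<Longrightarrow> (\<Sum>i=1..n. y i (c i)) \<le> last_passage n k y"
  unfolding last_passage_def by (intro Max_ge finite_imageI finite_labellings imageI)

lemma last_passage_attained:
  assumes "k \<ge> 1"
  obtains c where "c \<in> labellings n k" "last_passage n k y = (\<Sum>i=1..n. y i (c i))"
proof -
  have "last_passage n k y \<in> (\<lambda>c. \<Sum>i=1..n. y i (c i)) ` labellings n k"
    unfolding last_passage_def using finite_labellings labellings_nonempty[OF assms]
    by (intro Max_in) auto
  then show ?thesis using that by auto
qed

lemma last_passage_affine:
  assumes "k \<ge> 1" "a \<ge> 0"
  shows "last_passage n k (\<lambda>i r. a * y i r + b i) = a * last_passage n k y + (\<Sum>i=1..n. b i)"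
proof (rule antisym)
  obtain c where c: "c \<in> labellings n k"
    "last_passage n k (\<lambda>i r. a * y i r + b i) = (\<Sum>i=1..n. a * y i (c i) + b i)"
    using last_passage_attained[OF assms(1)] .
  show "last_passage n k (\<lambda>i r. a * y i r + b i) \<le> a * last_passage n k y + (\<Sum>i=1..n. b i)"
    using c mult_left_mono[OF last_passage_ge[OF c(1), of y] assms(2)]
    by (simp add: sum.distrib sum_distrib_left)
  obtain d where d: "d \<in> labellings n k" "last_passage n k y = (\<Sum>i=1..n. y i (d i))"
    using last_passage_attained[OF assms(1)] .
  show "a * last_passage n k y + (\<Sum>i=1..n. b i) \<le> last_passage n k (\<lambda>i r. a * y i r + b i)"
    using last_passage_ge[OF d(1), of "\<lambda>i r. a * y i r + b i"] d(2)
    by (simp add: sum.distrib sum_distrib_left)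
qed

text \<open>Relabelling along a monotone \<open>\<phi>\<close> keeps a labelling nondecreasing; since each of the \<open>d\<close> blocks is an
  interval, it costs at most \<open>D\<close> per block.\<close>

lemma last_passage_compress:
  assumes d: "d \<ge> 1" and \<phi>: "mono_on {1..d} \<phi>" "\<phi> ` {1..d} \<subseteq> {1..k}"
    and gain: "\<And>l s t. l \<in> {1..d} \<Longrightarrow> s \<le> t \<Longrightarrow> t \<le> n \<Longrightarrow> (\<Sum>i\<in>{s<..t}. y i l - z i (\<phi> l)) \<le> D"
  shows "last_passage n d y \<le> last_passage n k z + real d * D"
proof -
  obtain c where c: "c \<in> labellings n d" "last_passage n d y = (\<Sum>i=1..n. y i (c i))"
    using last_passage_attained[OF d] .
  have c_range: "c i \<in> {1..d}" if "i \<in> {1..n}" for i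
    using labellings_range[OF c(1) that] .
  define c' where "c' = (\<lambda>i\<in>{1..n}. \<phi> (c i))"
  have c': "c' \<in> labellings n k"
    using c(1) \<phi> c_range by (auto simp: labellings_def c'_def monotone_on_def image_subset_iff)
  have "(\<Sum>i=1..n. y i (c i) - z i (c' i)) = (\<Sum>i=1..n. y i (c i) - z i (\<phi> (c i)))"
    by (simp add: c'_def)
  also have "\<dots> = (\<Sum>l=1..d. \<Sum>i\<in>{i \<in> {1..n}. c i = l}. y i (c i) - z i (\<phi> (c i)))"
    using c_range by (intro sum.group[symmetric]) auto
  also have "\<dots> = (\<Sum>l=1..d. \<Sum>i\<in>{i \<in> {1..n}. c i = l}. y i l - z i (\<phi> l))"
    by (intro sum.cong) auto
  also have "\<dots> \<le> (\<Sum>l=1..d. D)"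
  proof (rule sum_mono)
    fix l assume l: "l \<in> {1..d}"
    then obtain s t where "s \<le> t" "t \<le> n" "{i \<in> {1..n}. c i = l} = {s<..t}"
      using labelling_interval[OF c(1), of l] by auto
    then show "(\<Sum>i\<in>{i \<in> {1..n}. c i = l}. y i l - z i (\<phi> l)) \<le> D"
      using gain[OF l] by metis
  qed
  finally show ?thesis
    using c(2) last_passage_ge[OF c', of z] by (simp add: sum_subtractf)
qed

text \<open>An increasing sequence of positions carries the same information as the set of its values.\<close>

lemma LI_set_iff:
  "l \<in> {l. \<exists>i. strict_mono_on {1..l} i \<and> i ` {1..l} \<subseteq> {1..n} \<and> mono_on {1..l} (\<lambda>r. x (i r))}
    \<longleftrightarrow> (\<exists>S\<subseteq>{1..n::nat}. mono_on S x \<and> card S = l)" for x :: "nat \<Rightarrow> 'a::linorder"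
proof
  assume "l \<in> {l. \<exists>i. strict_mono_on {1..l} i \<and> i ` {1..l} \<subseteq> {1..n} \<and> mono_on {1..l} (\<lambda>r. x (i r))}"
  then obtain i where i: "strict_mono_on {1..l} i" "i ` {1..l} \<subseteq> {1..n}" "mono_on {1..l} (\<lambda>r. x (i r))"
    by blast
  have "mono_on (i ` {1..l}) x"
    using i(3) strict_mono_on_less_eq[OF i(1)] by (auto simp: monotone_on_def)
  moreover have "card (i ` {1..l}) = l"
    using strict_mono_on_imp_inj_on[OF i(1)] by (simp add: card_image)
  ultimately show "\<exists>S\<subseteq>{1..n}. mono_on S x \<and> card S = l" using i(2) by blast
next
  assume "\<exists>S\<subseteq>{1..n}. mono_on S x \<and> card S = l"
  then obtain S where S: "S \<subseteq> {1..n}" "mono_on S x" "card S = l" by blast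
  have fin: "finite S" using S(1) finite_subset by auto
  define xs where "xs = sorted_list_of_set S"
  have xs: "set xs = S" "length xs = l" "sorted_wrt (<) xs"
    using fin S(3) by (auto simp: xs_def)
  have lt: "xs ! (r - 1) < xs ! (s - 1)" if "r \<in> {1..l}" "s \<in> {1..l}" "r < s" for r s
    using that xs(2,3) by (auto simp: sorted_wrt_iff_nth_less)
  have mem: "xs ! (r - 1) \<in> S" if "r \<in> {1..l}" for r
    using that xs(1,2) nth_mem[of "r - 1" xs] by auto
  have "strict_mono_on {1..l} (\<lambda>r. xs ! (r - 1))"
    using lt by (auto simp: strict_mono_on_def)
  moreover have "mono_on {1..l} (\<lambda>r. x (xs ! (r - 1)))"
    using S(2) mem lt by (auto simp: monotone_on_def le_less)
  ultimately show "l \<in> {l. \<exists>i. strict_mono_on {1..l} i \<and> i ` {1..l} \<subseteq> {1..n} \<and> mono_on {1..l} (\<lambda>r. x (i r))}"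
    using mem S(1) by (intro CollectI exI[of _ "\<lambda>r. xs ! (r - 1)"]) auto
qed

lemma LI_eq_Max_card: "LI x n = Max (card ` {S. S \<subseteq> {1..n} \<and> mono_on S x})"
proof -
  have "{l. \<exists>i. strict_mono_on {1..l} i \<and> i ` {1..l} \<subseteq> {1..n} \<and> mono_on {1..l} (\<lambda>r. x (i r))}
      = card ` {S. S \<subseteq> {1..n} \<and> mono_on S x}"
    by (intro set_eqI, unfold LI_set_iff) auto
  then show ?thesis unfolding LI_def by simp
qed

lemma LI_ge_card:
  assumes "S \<subseteq> {1..n}" "mono_on S x"
  shows "card S \<le> LI x n"
  unfolding LI_eq_Max_card using assms by (intro Max_ge) auto

lemma LI_attained:
  obtains S where "S \<subseteq> {1..n}" "mono_on S x" "card S = LI x n"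
proof -
  have "{} \<in> {S. S \<subseteq> {1..n} \<and> mono_on S x}" by (simp add: monotone_on_def)
  then have "LI x n \<in> card ` {S. S \<subseteq> {1..n} \<and> mono_on S x}"
    unfolding LI_eq_Max_card by (intro Max_in) auto
  then show ?thesis using that by auto
qed

lemma LI_cong:
  assumes "\<And>i. i \<in> {1..n} \<Longrightarrow> x i = y i"
  shows "LI x n = LI y n"
proof -
  have "S \<subseteq> {1..n} \<and> mono_on S x \<longleftrightarrow> S \<subseteq> {1..n} \<and> mono_on S y" for S
    using assms by (auto simp: monotone_on_def subset_iff)
  then show ?thesis unfolding LI_eq_Max_card by simp
qed

text \<open>The times at which the observed letter agrees with the letter of the block form an increasing subsequence.\<close>

lemma last_passage_le_LI:
  fixes x :: "nat \<Rightarrow> 'a::linorder"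
  assumes k: "k \<ge> 1" and a: "mono_on {1..k} a"
  shows "last_passage n k (\<lambda>i r. of_bool (x i = a r)) \<le> real (LI x n)"
proof -
  obtain c where c: "c \<in> labellings n k"
    "last_passage n k (\<lambda>i r. of_bool (x i = a r)) = (\<Sum>i=1..n. of_bool (x i = a (c i)))"
    using last_passage_attained[OF k] .
  define S where "S = {1..n} \<inter> {i. x i = a (c i)}"
  have "mono_on S x"
    using a c(1) labellings_range[OF c(1)]
    by (auto simp: S_def monotone_on_def labellings_def)
  then have "card S \<le> LI x n"
    by (intro LI_ge_card) (auto simp: S_def)
  then show ?thesis
    using c(2) by (simp add: S_def)
qed

text \<open>Label each time with the largest letter that the subsequence has used so far. Lumping letters by a
  monotone \<open>g\<close> is harmless, as the subsequence stays nondecreasing.\<close>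

lemma LI_le_last_passage:
  fixes x :: "nat \<Rightarrow> 'a::linorder"
  assumes d: "d \<ge> 1" and g: "mono_on (x ` {1..n}) g" "g ` x ` {1..n} \<subseteq> {1..d}"
  shows "real (LI x n) \<le> last_passage n d (\<lambda>i l. of_bool (g (x i) = l))"
proof -
  obtain S where S: "S \<subseteq> {1..n}" "mono_on S x" "card S = LI x n"
    using LI_attained .
  have fin: "finite S" using S(1) finite_subset by auto
  have g_range: "g (x i) \<in> {1..d}" if "i \<in> {1..n}" for i
    using g(2) that by blast
  have one: "(1::nat) \<in> {1..d}" using d by simp
  define c where "c = (\<lambda>i\<in>{1..n}. Max (insert 1 (g ` x ` {s \<in> S. s \<le> i})))"
  have "c \<in> labellings n d"
  proof -
    have "c i \<in> {1..d}" if "i \<in> {1..n}" for i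
    proof -
      have "Max (insert 1 (g ` x ` {s \<in> S. s \<le> i})) \<in> insert 1 (g ` x ` {s \<in> S. s \<le> i})"
        using fin by (intro Max_in) auto
      moreover have "insert 1 (g ` x ` {s \<in> S. s \<le> i}) \<subseteq> {1..d}"
        using g_range S(1) one by blast
      ultimately have "Max (insert 1 (g ` x ` {s \<in> S. s \<le> i})) \<in> {1..d}" by blast
      then show ?thesis using that by (simp add: c_def)
    qed
    moreover have "mono_on {1..n} c"
      unfolding c_def using fin by (auto simp: monotone_on_def intro!: Max_mono)
    ultimately show ?thesis by (auto simp: labellings_def c_def)
  qed
  moreover have "c s = g (x s)" if s: "s \<in> S" for s
  proof -
    have "Max (insert 1 (g ` x ` {t \<in> S. t \<le> s})) = g (x s)"
    proof (rule Max_eqI)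
      fix v assume "v \<in> insert 1 (g ` x ` {t \<in> S. t \<le> s})"
      moreover have "1 \<le> g (x s)" using g_range[of s] s S(1) by auto
      moreover have "g (x t) \<le> g (x s)" if "t \<in> S" "t \<le> s" for t
      proof -
        have "x t \<le> x s" using monotone_onD[OF S(2) that(1) s that(2)] .
        then show ?thesis using monotone_onD[OF g(1)] that(1) s S(1) by blast
      qed
      ultimately show "v \<le> g (x s)" by auto
    qed (use fin s in auto)
    then show ?thesis using s S(1) by (auto simp: c_def)
  qed
  then have "card S \<le> card ({1..n} \<inter> {i. g (x i) = c i})"
    using S(1) by (intro card_mono) auto
  then have "real (LI x n) \<le> (\<Sum>i=1..n. of_bool (g (x i) = c i))"
    using S(3) by simp
  ultimately show ?thesis
    using last_passage_ge[of c n d "\<lambda>i l. of_bool (g (x i) = l)"] by linarith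
qed

section \<open>Universality of last passage values\<close>

lemma smooth_max_last_passage_bound:
  assumes k: "k \<ge> 1" and b: "b > 0" and h: "h \<ge> 0"
  shows "\<bar>smooth_max b (labellings n k) (\<lambda>c. h * (\<Sum>i=1..n. y i (c i))) - h * last_passage n k y\<bar>
    \<le> real k * ln (real n + 1) / b"
proof -
  let ?T = "labellings n k" and ?g = "\<lambda>c. h * (\<Sum>i=1..n. y i (c i))"
  have "h * last_passage n k y = last_passage n k (\<lambda>i r. h * y i r + 0)"
    using last_passage_affine[OF k h, of n y "\<lambda>_. 0"] by simp
  then have eq: "h * last_passage n k y = Max (?g ` ?T)"
    by (simp add: last_passage_def sum_distrib_left)
  have card: "card ?T > 0"
    using finite_labellings labellings_nonempty[OF k] by (simp add: card_gt_0_iff)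
  have "real (card ?T) \<le> real ((n + 1) ^ k)"
    using card_labellings by (simp only: of_nat_le_iff)
  then have "ln (real (card ?T)) \<le> ln ((real n + 1) ^ k)"
    using card by (subst ln_le_cancel_iff) (auto simp: add.commute)
  also have "\<dots> = real k * ln (real n + 1)"
    by (simp add: ln_realpow)
  finally have "ln (real (card ?T)) / b \<le> real k * ln (real n + 1) / b"
    using b by (simp add: divide_right_mono)
  then show ?thesis
    using smooth_max_bounds[OF finite_labellings[of n k] labellings_nonempty[OF k, of n] b, where g = ?g] eq
    by linarith
qed

lemma bounded_derivative_lipschitz:
  fixes f f1 :: "real \<Rightarrow> real"
  assumes "\<And>x. (f has_real_derivative f1 x) (at x)" "\<And>x. \<bar>f1 x\<bar> \<le> A"
  shows "\<bar>f x - f y\<bar> \<le> A * \<bar>x - y\<bar>"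
  using field_differentiable_bound[of UNIV f f1 A x y] assms by auto

lemma last_passage_measurable:
  assumes "moment_law P {1..k} mean second_moment"
  shows "last_passage n k \<in> borel_measurable (PiM {1..n} (\<lambda>_. P))"
proof -
  interpret moment_law P "{1..k}" mean second_moment by (rule assms)
  have [measurable]: "(\<lambda>y. y i (c i)) \<in> borel_measurable (PiM {1..n} (\<lambda>_. P))"
    if "c \<in> labellings n k" "i \<in> {1..n}" for c i
    using measurable_compose[OF measurable_component_singleton[OF that(2)] component_measurable]
      labellings_range[OF that] by blast
  show ?thesis
    unfolding last_passage_def[abs_def]
    by (rule borel_measurable_Max[OF finite_labellings]) measurable
qed

text \<open>For \<open>b\<close> a power of \<open>n\<close>, the smoothing error \<open>ln n / b\<close> and the exchange error \<open>b\<^sup>2 / sqrt n\<close> both vanish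
  when the exponent lies strictly between \<open>0\<close> and \<open>1/4\<close>; the proof takes \<open>1/8\<close>.\<close>

theorem last_passage_universality:
  fixes f f1 f2 f3 :: "real \<Rightarrow> real"
  assumes P: "moment_law P {1..k} mean second_moment" and Q: "moment_law Q {1..k} mean second_moment" and k: "k \<ge> 1"
    and f: "\<And>x. (f has_real_derivative f1 x) (at x)"
      "\<And>x. (f1 has_real_derivative f2 x) (at x)"
      "\<And>x. (f2 has_real_derivative f3 x) (at x)"
    and A: "\<And>x. \<bar>f x\<bar> \<le> A" "\<And>x. \<bar>f1 x\<bar> \<le> A" "\<And>x. \<bar>f2 x\<bar> \<le> A" "\<And>x. \<bar>f3 x\<bar> \<le> A"
  shows "(\<lambda>n. (\<integral>y. f (last_passage n k y / sqrt (real n)) \<partial>PiM {1..n} (\<lambda>_. P))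
    - (\<integral>y. f (last_passage n k y / sqrt (real n)) \<partial>PiM {1..n} (\<lambda>_. Q))) \<longlonglongrightarrow> 0"
proof -
  define third where "third R = (\<integral>y. (\<Sum>r=1..k. \<bar>y r\<bar>) ^ 3 \<partial>R)" for R :: "(nat \<Rightarrow> real) measure"
  define b where "b n = real n powr (1/8)" for n :: nat
  define E where "E n R = (\<integral>y. f (last_passage n k y / sqrt (real n)) \<partial>PiM {1..n} (\<lambda>_. R))"
    for n :: nat and R :: "(nat \<Rightarrow> real) measure"
  define G where "G n y = f (smooth_max (b n) (labellings n k)
    (\<lambda>c. (1 / sqrt (real n)) * (\<Sum>i\<in>{1..n}. y i (c i))))" for n :: nat and y :: "nat \<Rightarrow> nat \<Rightarrow> real"
  have A0: "A \<ge> 0" using A(1)[of 0] by linarith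
  have [measurable]: "f \<in> borel_measurable borel"
    using f(1) by (intro borel_measurable_continuous_onI continuous_at_imp_continuous_on)
      (auto intro: DERIV_isCont)
  have smoothing: "\<bar>E n R - (\<integral>y. G n y \<partial>PiM {1..n} (\<lambda>_. R))\<bar> \<le> A * (real k * ln (real n + 1) / b n)"
    if R: "moment_law R {1..k} mean second_moment" and n: "n \<ge> 1" for R n
  proof -
    interpret R: moment_law R "{1..k}" mean second_moment by (rule R)
    interpret prob_space "PiM {1..n} (\<lambda>_. R)"
      by (intro prob_space_PiM R.prob_space_axioms)
    have [measurable]: "last_passage n k \<in> borel_measurable (PiM {1..n} (\<lambda>_. R))"
      using R by (rule last_passage_measurable)
    have i1: "integrable (PiM {1..n} (\<lambda>_. R)) (\<lambda>y. f (last_passage n k y / sqrt (real n)))"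
      by (rule integrable_const_bound[of _ A]) (simp add: A(1), measurable)
    have [measurable]: "(\<lambda>y. y i (c i)) \<in> borel_measurable (PiM {1..n} (\<lambda>_. R))"
      if "c \<in> labellings n k" "i \<in> {1..n}" for c i
      using measurable_compose[OF measurable_component_singleton[OF that(2)] R.component_measurable]
        labellings_range[OF that] by blast
    have "G n \<in> borel_measurable (PiM {1..n} (\<lambda>_. R))"
      unfolding G_def smooth_max_def by measurable
    then have i2: "integrable (PiM {1..n} (\<lambda>_. R)) (G n)"
      using A(1) by (intro integrable_const_bound[of _ A]) (auto simp: G_def)
    have pt: "\<bar>f (last_passage n k y / sqrt (real n)) - G n y\<bar> \<le> A * (real k * ln (real n + 1) / b n)" for y
    proof -
      have "\<bar>f (last_passage n k y / sqrt (real n)) - G n y\<bar>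
        \<le> A * \<bar>smooth_max (b n) (labellings n k) (\<lambda>c. (1 / sqrt (real n)) * (\<Sum>i=1..n. y i (c i)))
           - (1 / sqrt (real n)) * last_passage n k y\<bar>"
        unfolding G_def
        using bounded_derivative_lipschitz[OF f(1) A(2), of "(1 / sqrt (real n)) * last_passage n k y"
          "smooth_max (b n) (labellings n k) (\<lambda>c. (1 / sqrt (real n)) * (\<Sum>i=1..n. y i (c i)))"]
        by (simp add: abs_minus_commute)
      also have "\<dots> \<le> A * (real k * ln (real n + 1) / b n)"
        using n by (intro mult_left_mono A0 smooth_max_last_passage_bound k) (auto simp: b_def)
      finally show ?thesis .
    qed
    have "\<bar>E n R - (\<integral>y. G n y \<partial>PiM {1..n} (\<lambda>_. R))\<bar>
       = \<bar>\<integral>y. f (last_passage n k y / sqrt (real n)) - G n y \<partial>PiM {1..n} (\<lambda>_. R)\<bar>"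
      unfolding E_def using i1 i2 by simp
    also have "\<dots> \<le> A * (real k * ln (real n + 1) / b n)"
      using pt by (rule abs_integral_le)
    finally show ?thesis .
  qed
  define C where "C = third P + third Q"
  have swapping: "\<bar>(\<integral>y. G n y \<partial>PiM {1..n} (\<lambda>_. P)) - (\<integral>y. G n y \<partial>PiM {1..n} (\<lambda>_. Q))\<bar>
      \<le> real n * (3 * A * (b n)\<^sup>2 * (1 / sqrt (real n)) ^ 3 * C)" if n: "n \<ge> 1" for n
  proof -
    have "labellings n k \<subseteq> {1..n} \<rightarrow> {1..k}" using labellings_range by blast
    then show ?thesis
      using smooth_max_invariance[where I = "{1..n}" and T = "labellings n k" and b = "b n"
        and h = "1 / sqrt (real n)" and f = f and ?f1.0 = f1 and ?f2.0 = f2 and ?f3.0 = f3,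
        OF P Q _ finite_labellings labellings_nonempty[OF k] _ _ _ f A] n
      by (simp add: G_def[abs_def] b_def third_def C_def ge_one_powr_ge_zero)
  qed
  have "(\<lambda>n. E n P - E n Q) \<longlonglongrightarrow> 0"
  proof (rule Lim_null_comparison)
    show "\<forall>\<^sub>F n in sequentially. norm (E n P - E n Q) \<le> 2 * (A * (real k * ln (real n + 1) / b n))
        + real n * (3 * A * (b n)\<^sup>2 * (1 / sqrt (real n)) ^ 3 * C)"
      using eventually_ge_at_top[of 1]
    proof eventually_elim
      case (elim n)
      show ?case using smoothing[OF P elim] smoothing[OF Q elim] swapping[OF elim]
        unfolding real_norm_def by linarith
    qed
    show "(\<lambda>n. 2 * (A * (real k * ln (real n + 1) / b n))
        + real n * (3 * A * (b n)\<^sup>2 * (1 / sqrt (real n)) ^ 3 * C)) \<longlonglongrightarrow> 0"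
    proof -
      have "(\<lambda>n. ln (real n + 1) / b n) \<longlonglongrightarrow> 0"
        unfolding b_def by real_asymp
      then have 1: "(\<lambda>n. 2 * A * real k * (ln (real n + 1) / b n)) \<longlonglongrightarrow> 2 * A * real k * 0"
        by (intro tendsto_intros)
      have "(\<lambda>n. real n * (b n)\<^sup>2 * (1 / sqrt (real n)) ^ 3) \<longlonglongrightarrow> 0"
        unfolding b_def by real_asymp
      then have 2: "(\<lambda>n. 3 * A * C * (real n * (b n)\<^sup>2 * (1 / sqrt (real n)) ^ 3)) \<longlonglongrightarrow> 3 * A * C * 0"
        by (intro tendsto_intros)
      show ?thesis using tendsto_add[OF 1 2] by (simp add: algebra_simps)
    qed
  qed
  then show ?thesis by (simp add: E_def)
qed

section \<open>Reduction to the most probable letters\<close>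

text \<open>With \<open>R = v / u\<close> the variable \<open>R powr d\<close>, where \<open>d\<close> is \<open>1\<close> on \<open>U\<close>, \<open>-1\<close> on \<open>V\<close> and \<open>0\<close> elsewhere, has expectation
  \<open>1 + u * (R - 1) + v * (1 / R - 1) = 1\<close>. This is the exponential martingale of the gambler's ruin
  problem; Markov's inequality for the product of these variables gives the bound, uniformly in the
  number of steps.\<close>

lemma (in prob_space) excess_bound:
  fixes Y :: "'i \<Rightarrow> 'a \<Rightarrow> 'c" and u v b :: real
  assumes I: "finite I" and indep: "indep_vars (\<lambda>_. S) Y I"
    and UV: "U \<in> sets S" "V \<in> sets S" "U \<inter> V = {}"
    and u: "\<And>i. i \<in> I \<Longrightarrow> prob (Y i -` U \<inter> space M) = u"
    and v: "\<And>i. i \<in> I \<Longrightarrow> prob (Y i -` V \<inter> space M) = v"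
    and uv: "0 < u" "u < v"
  shows "prob {\<omega> \<in> space M. b < (\<Sum>i\<in>I. of_bool (Y i \<omega> \<in> U) - of_bool (Y i \<omega> \<in> V))} \<le> (u / v) powr b"
proof -
  define R where "R = v / u"
  have R: "R > 1" using uv by (simp add: R_def)
  define D where "D \<omega> = (\<Sum>i\<in>I. of_bool (Y i \<omega> \<in> U) - of_bool (Y i \<omega> \<in> V) :: real)" for \<omega>
  define w where "w y = 1 + (R - 1) * indicator U y + (1 / R - 1) * indicator V y" for y
  have w_eq: "w y = R powr (of_bool (y \<in> U) - of_bool (y \<in> V))" for y
    using UV(3) R by (auto simp: w_def indicator_def powr_minus_divide)
  have [measurable]: "w \<in> borel_measurable S"
    unfolding w_def using UV by measurable
  have rv: "Y i \<in> measurable M S" if "i \<in> I" for i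
    using indep that by (auto simp: indep_vars_def)
  have indicator_int: "has_bochner_integral M (\<lambda>\<omega>. indicator C (Y i \<omega>)) (prob (Y i -` C \<inter> space M))"
    if "i \<in> I" "C \<in> sets S" for i C
  proof -
    have "has_bochner_integral M (indicator (Y i -` C \<inter> space M) :: _ \<Rightarrow> real) (prob (Y i -` C \<inter> space M))"
      using rv[OF that(1)] that(2) by (intro has_bochner_integral_real_indicator) (auto simp: emeasure_eq_measure)
    then show ?thesis
      by (rule has_bochner_integral_cong[THEN iffD1, rotated -1]) (auto simp: indicator_def)
  qed
  have one: "has_bochner_integral M (\<lambda>\<omega>. 1 :: real) 1"
    by (simp add: has_bochner_integral_iff prob_space)
  have w_int: "has_bochner_integral M (\<lambda>\<omega>. w (Y i \<omega>)) 1" if i: "i \<in> I" for i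
  proof -
    have "has_bochner_integral M (\<lambda>\<omega>. w (Y i \<omega>)) (1 + (R - 1) * u + (1 / R - 1) * v)"
      unfolding w_def u[OF i, symmetric] v[OF i, symmetric]
      by (intro has_bochner_integral_add has_bochner_integral_mult_right indicator_int one i UV)
    moreover have "1 + (R - 1) * u + (1 / R - 1) * v = 1"
      using uv by (simp add: R_def field_simps)
    ultimately show ?thesis by simp
  qed
  have indep_w: "indep_vars (\<lambda>_. borel) (\<lambda>i \<omega>. w (Y i \<omega>)) I"
    by (rule indep_vars_compose2[OF indep]) measurable
  have prod: "(\<Prod>i\<in>I. w (Y i \<omega>)) = R powr D \<omega>" for \<omega>
    using R by (simp add: w_eq D_def powr_sum)
  have int: "integrable M (\<lambda>\<omega>. R powr D \<omega>)" and mean: "(\<integral>\<omega>. R powr D \<omega> \<partial>M) = 1"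
  proof -
    show "integrable M (\<lambda>\<omega>. R powr D \<omega>)"
      unfolding prod[symmetric] using w_int
      by (intro indep_vars_integrable[OF I indep_w]) (auto simp: has_bochner_integral_iff)
    have "(\<integral>\<omega>. (\<Prod>i\<in>I. w (Y i \<omega>)) \<partial>M) = (\<Prod>i\<in>I. \<integral>\<omega>. w (Y i \<omega>) \<partial>M)"
      using w_int by (intro indep_vars_lebesgue_integral[OF I indep_w]) (auto simp: has_bochner_integral_iff)
    also have "\<dots> = 1"
      using w_int by (intro prod.neutral) (auto simp: has_bochner_integral_iff)
    finally show "(\<integral>\<omega>. R powr D \<omega> \<partial>M) = 1" by (simp add: prod)
  qed
  have "prob {\<omega> \<in> space M. b < D \<omega>} \<le> prob {\<omega> \<in> space M. R powr b \<le> R powr D \<omega>}"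
  proof (rule finite_measure_mono)
    show "{\<omega> \<in> space M. b < D \<omega>} \<subseteq> {\<omega> \<in> space M. R powr b \<le> R powr D \<omega>}"
      using R by (auto intro: powr_mono)
    have [measurable]: "(\<lambda>\<omega>. R powr D \<omega>) \<in> borel_measurable M" using int by auto
    show "{\<omega> \<in> space M. R powr b \<le> R powr D \<omega>} \<in> sets M" by measurable
  qed
  also have "\<dots> \<le> (\<integral>\<omega>. R powr D \<omega> \<partial>M) / R powr b"
    using int R by (intro integral_Markov_inequality_measure[where A = "{}"]) auto
  also have "\<dots> = (u / v) powr b"
    unfolding mean using uv by (simp add: R_def powr_divide)
  finally show ?thesis by (simp add: D_def)
qed

lemma (in prob_space) abs_integral_diff_le:
  fixes f :: "real \<Rightarrow> real" and U V :: "'a \<Rightarrow> real"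
  assumes f: "f \<in> borel_measurable borel" "\<And>x. \<bar>f x\<bar> \<le> A" "\<And>x y. \<bar>f x - f y\<bar> \<le> A * \<bar>x - y\<bar>"
    and UV: "U \<in> borel_measurable M" "V \<in> borel_measurable M"
    and Bad: "Bad \<in> events"
    and close: "\<And>\<omega>. \<omega> \<in> space M - Bad \<Longrightarrow> \<bar>U \<omega> - V \<omega>\<bar> \<le> \<delta>" and \<delta>: "\<delta> \<ge> 0"
  shows "\<bar>(\<integral>\<omega>. f (U \<omega>) \<partial>M) - (\<integral>\<omega>. f (V \<omega>) \<partial>M)\<bar> \<le> A * \<delta> + 2 * A * prob Bad"
proof -
  note [measurable] = f(1) UV Bad
  have A0: "A \<ge> 0" using f(2)[of 0] by linarith
  have int: "integrable M (\<lambda>\<omega>. f (U \<omega>))" "integrable M (\<lambda>\<omega>. f (V \<omega>))"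
    using f(2) by (intro integrable_const_bound[of _ A]; auto)+
  have int_Bad: "integrable M (indicator Bad :: _ \<Rightarrow> real)"
    using Bad by (simp add: integrable_indicator_iff emeasure_eq_measure)
  have "\<bar>f (U \<omega>) - f (V \<omega>)\<bar> \<le> A * \<delta> + 2 * A * indicator Bad \<omega>" if "\<omega> \<in> space M" for \<omega>
  proof (cases "\<omega> \<in> Bad")
    case True
    have "0 \<le> A * \<delta>" using A0 \<delta> by simp
    then show ?thesis using True f(2)[of "U \<omega>"] f(2)[of "V \<omega>"] by simp
  next
    case False
    have "\<bar>f (U \<omega>) - f (V \<omega>)\<bar> \<le> A * \<bar>U \<omega> - V \<omega>\<bar>" by (rule f(3))
    also have "\<dots> \<le> A * \<delta>" using close False that A0 by (intro mult_left_mono) auto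
    finally show ?thesis using False by simp
  qed
  then have "(\<integral>\<omega>. \<bar>f (U \<omega>) - f (V \<omega>)\<bar> \<partial>M) \<le> (\<integral>\<omega>. A * \<delta> + 2 * A * indicator Bad \<omega> \<partial>M)"
    using int int_Bad by (intro integral_mono) auto
  also have "\<dots> = A * \<delta> + 2 * A * prob Bad"
    using int_Bad Bad by (simp add: prob_space)
  finally have "(\<integral>\<omega>. \<bar>f (U \<omega>) - f (V \<omega>)\<bar> \<partial>M) \<le> A * \<delta> + 2 * A * prob Bad" .
  moreover have "\<bar>(\<integral>\<omega>. f (U \<omega>) \<partial>M) - (\<integral>\<omega>. f (V \<omega>) \<partial>M)\<bar> \<le> (\<integral>\<omega>. \<bar>f (U \<omega>) - f (V \<omega>)\<bar> \<partial>M)"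
    using int integral_abs_bound[of M "\<lambda>\<omega>. f (U \<omega>) - f (V \<omega>)"] by simp
  ultimately show ?thesis by linarith
qed

locale iid_letters = prob_space M for M :: "'m measure" +
  fixes \<alpha> :: "nat \<Rightarrow> 'a::linorder" and X :: "nat \<Rightarrow> 'm \<Rightarrow> 'a" and p :: "nat \<Rightarrow> real"
  assumes alphabet: "strict_mono_on {1..} \<alpha>"
    and indep: "indep_vars (\<lambda>_. count_space (\<alpha> ` {1..})) X {1..}"
    and ident: "\<And>i. i \<ge> 1 \<Longrightarrow> distr M (count_space (\<alpha> ` {1..})) (X i) = distr M (count_space (\<alpha> ` {1..})) (X 1)"
    and letter_prob: "\<And>i. i \<ge> 1 \<Longrightarrow> \<P>(\<omega> in M. X 1 \<omega> = \<alpha> i) = p i"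
    and pos: "\<And>i. i \<ge> 1 \<Longrightarrow> p i > 0"
begin

abbreviation letters :: "'a measure" where
  "letters \<equiv> count_space (\<alpha> ` {1..})"

definition letter_index :: "'a \<Rightarrow> nat" where
  "letter_index = the_inv_into {1..} \<alpha>"

lemma alphabet_inj: "inj_on \<alpha> {1..}"
  using alphabet by (rule strict_mono_on_imp_inj_on)

lemma letter_index_alpha [simp]: "i \<ge> 1 \<Longrightarrow> letter_index (\<alpha> i) = i"
  unfolding letter_index_def using alphabet_inj by (intro the_inv_into_f_f) auto

lemma letter_index_mono: "mono_on (\<alpha> ` {1..}) letter_index"
proof (rule mono_onI)
  fix a b assume "a \<in> \<alpha> ` {1..}" "b \<in> \<alpha> ` {1..}" "a \<le> b"
  then show "letter_index a \<le> letter_index b"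
    using strict_mono_on_less_eq[OF alphabet] by auto
qed

lemma X_measurable: "i \<ge> 1 \<Longrightarrow> X i \<in> measurable M letters"
  using indep by (auto simp: indep_vars_def)

lemma X_letter: "i \<ge> 1 \<Longrightarrow> \<omega> \<in> space M \<Longrightarrow> X i \<omega> \<in> \<alpha> ` {1..}"
  using measurable_space[OF X_measurable] by auto

lemma prob_X: "i \<ge> 1 \<Longrightarrow> C \<subseteq> \<alpha> ` {1..} \<Longrightarrow> prob (X i -` C \<inter> space M) = prob (X 1 -` C \<inter> space M)"
  using arg_cong[OF ident, of i "\<lambda>D. measure D C"] X_measurable[of i] X_measurable[of 1]
  by (simp add: measure_distr)

lemma prob_X_letter: "i \<ge> 1 \<Longrightarrow> l \<ge> 1 \<Longrightarrow> prob (X i -` {\<alpha> l} \<inter> space M) = p l"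
  using prob_X[of i "{\<alpha> l}"] letter_prob[of l] by (simp add: vimage_def Int_def conj_commute)

lemma sum_p_le_1:
  assumes "finite F" "F \<subseteq> {1..}"
  shows "(\<Sum>l\<in>F. p l) \<le> 1"
proof -
  have "(\<Sum>l\<in>F. p l) = (\<Sum>l\<in>F. prob (X 1 -` {\<alpha> l} \<inter> space M))"
    using assms by (intro sum.cong) (auto simp: prob_X_letter subset_iff)
  also have "\<dots> = prob (\<Union>l\<in>F. X 1 -` {\<alpha> l} \<inter> space M)"
  proof (rule finite_measure_finite_Union[symmetric])
    show "(\<lambda>l. X 1 -` {\<alpha> l} \<inter> space M) ` F \<subseteq> events"
      using assms X_measurable[of 1] by (auto intro!: measurable_sets)
    show "disjoint_family_on (\<lambda>l. X 1 -` {\<alpha> l} \<inter> space M) F"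
      using inj_onD[OF inj_on_subset[OF alphabet_inj assms(2)]]
      by (fastforce simp: disjoint_family_on_def)
  qed (rule assms)
  finally show ?thesis by simp
qed

lemma tail_prob_tendsto: "(\<lambda>m. prob (X 1 -` (\<alpha> ` {m<..}) \<inter> space M)) \<longlonglongrightarrow> 0"
proof -
  have "(\<lambda>m. prob (X 1 -` (\<alpha> ` {m<..}) \<inter> space M)) \<longlonglongrightarrow> prob (\<Inter>m. X 1 -` (\<alpha> ` {m<..}) \<inter> space M)"
  proof (rule finite_Lim_measure_decseq)
    show "range (\<lambda>m. X 1 -` (\<alpha> ` {m<..}) \<inter> space M) \<subseteq> events"
      using X_measurable[of 1] by (auto intro!: measurable_sets)
    show "decseq (\<lambda>m. X 1 -` (\<alpha> ` {m<..}) \<inter> space M)"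
      by (auto simp: decseq_def)
  qed
  moreover have "(\<Inter>m. X 1 -` (\<alpha> ` {m<..}) \<inter> space M) = {}"
  proof -
    have "\<omega> \<notin> (\<Inter>m. X 1 -` (\<alpha> ` {m<..}) \<inter> space M)" for \<omega>
    proof
      assume \<omega>: "\<omega> \<in> (\<Inter>m. X 1 -` (\<alpha> ` {m<..}) \<inter> space M)"
      then obtain l where l: "l \<ge> 1" "X 1 \<omega> = \<alpha> l" using X_letter[of 1 \<omega>] by auto
      from \<omega> have "X 1 \<omega> \<in> \<alpha> ` {l<..}" by blast
      then obtain l' where "l' > l" "\<alpha> l' = \<alpha> l" using l by auto
      then show False using inj_onD[OF alphabet_inj, of l' l] l by simp
    qed
    then show ?thesis by blast
  qed
  ultimately show ?thesis by simp
qed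

text \<open>There are only countably many words of length \<open>n\<close>, so the product sigma-algebra on them is discrete.\<close>

lemma word_functional_measurable:
  fixes h :: "(nat \<Rightarrow> 'a) \<Rightarrow> real"
  assumes h: "\<And>x y. (\<And>i. i \<in> {1..n} \<Longrightarrow> x i = y i) \<Longrightarrow> h x = h y"
  shows "(\<lambda>\<omega>. h (\<lambda>i. X i \<omega>)) \<in> borel_measurable M"
proof -
  have "(\<lambda>\<omega>. \<lambda>i\<in>{1..n}. X i \<omega>) \<in> measurable M (PiM {1..n} (\<lambda>_. letters))"
    by (intro measurable_restrict X_measurable) auto
  also have "PiM {1..n} (\<lambda>_. letters) = count_space ({1..n} \<rightarrow>\<^sub>E \<alpha> ` {1..})"
    by (rule count_space_PiM_finite) auto
  finally have "(\<lambda>\<omega>. h (\<lambda>i\<in>{1..n}. X i \<omega>)) \<in> borel_measurable M"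
    by (rule measurable_compose) simp
  moreover have "h (\<lambda>i\<in>{1..n}. X i \<omega>) = h (\<lambda>i. X i \<omega>)" for \<omega>
    by (rule h) simp
  ultimately show ?thesis by simp
qed

lemma LI_measurable: "(\<lambda>\<omega>. real (LI (\<lambda>i. X i \<omega>) n)) \<in> borel_measurable M"
  by (rule word_functional_measurable[of n "\<lambda>x. real (LI x n)"]) (auto intro: LI_cong)

end

locale iid_letters_max = iid_letters M \<alpha> X p
  for M :: "'m measure" and \<alpha> :: "nat \<Rightarrow> 'a::linorder" and X p +
  fixes k :: nat and j :: "nat \<Rightarrow> nat" and q :: real
  assumes k: "k \<ge> 1" and j_mono: "strict_mono_on {1..k} j" and j_range: "j ` {1..k} \<subseteq> {1..}"
    and p_max: "\<And>r. r \<in> {1..k} \<Longrightarrow> p (j r) = q"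
    and p_less: "\<And>i. i \<ge> 1 \<Longrightarrow> i \<notin> j ` {1..k} \<Longrightarrow> p i < q"
begin

lemma j_ge_1: "r \<in> {1..k} \<Longrightarrow> j r \<ge> 1"
  using j_range by (auto simp: image_subset_iff)

lemma q_pos: "q > 0"
  using p_max[of 1] pos[OF j_ge_1[of 1]] k by auto

lemma q_times_k: "q * real k \<le> 1"
proof -
  have "(\<Sum>l\<in>j ` {1..k}. p l) = (\<Sum>r=1..k. p (j r))"
    using strict_mono_on_imp_inj_on[OF j_mono] by (simp add: sum.reindex)
  also have "\<dots> = q * real k"
    by (simp add: p_max mult.commute)
  finally show ?thesis
    using sum_p_le_1[of "j ` {1..k}"] j_range by simp
qed

definition letter_vector :: "nat \<Rightarrow> 'm \<Rightarrow> nat \<Rightarrow> real" where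
  "letter_vector i \<omega> = (\<lambda>r\<in>{1..k}. of_bool (X i \<omega> = \<alpha> (j r)) - q)"

definition letter_law :: "(nat \<Rightarrow> real) measure" where
  "letter_law = distr M (PiM {1..k} (\<lambda>_. borel)) (letter_vector 1)"

lemma letter_vector_map:
  "(\<lambda>a. \<lambda>r\<in>{1..k}. of_bool (a = \<alpha> (j r)) - q) \<in> measurable letters (PiM {1..k} (\<lambda>_. borel :: real measure))"
  by (intro measurable_restrict) simp

lemma letter_vector_measurable: "i \<ge> 1 \<Longrightarrow> letter_vector i \<in> measurable M (PiM {1..k} (\<lambda>_. borel))"
  unfolding letter_vector_def[abs_def] by (rule measurable_compose[OF X_measurable letter_vector_map])

lemma letter_vector_distr:
  assumes i: "i \<ge> 1"
  shows "distr M (PiM {1..k} (\<lambda>_. borel)) (letter_vector i) = letter_law"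
proof -
  have "distr M (PiM {1..k} (\<lambda>_. borel)) (letter_vector i)
      = distr (distr M letters (X i)) (PiM {1..k} (\<lambda>_. borel)) (\<lambda>a. \<lambda>r\<in>{1..k}. of_bool (a = \<alpha> (j r)) - q)"
    if "i \<ge> 1" for i
    by (subst distr_distr[OF letter_vector_map X_measurable[OF that]])
      (simp add: comp_def letter_vector_def[abs_def])
  then show ?thesis
    using i ident[OF i] by (simp add: letter_law_def)
qed

lemma letter_vectors_distr:
  assumes n: "n \<ge> 1"
  shows "distr M (PiM {1..n} (\<lambda>_. PiM {1..k} (\<lambda>_. borel))) (\<lambda>\<omega>. \<lambda>i\<in>{1..n}. letter_vector i \<omega>)
    = PiM {1..n} (\<lambda>_. letter_law)"
proof -
  have "indep_vars (\<lambda>_. letters) X {1..n}"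
    using indep by (rule indep_vars_subset) auto
  then have "indep_vars (\<lambda>_. PiM {1..k} (\<lambda>_. borel)) (\<lambda>i \<omega>. (\<lambda>a. \<lambda>r\<in>{1..k}. of_bool (a = \<alpha> (j r)) - q) (X i \<omega>)) {1..n}"
    by (rule indep_vars_compose2) (rule letter_vector_map)
  then have "indep_vars (\<lambda>_. PiM {1..k} (\<lambda>_. borel)) letter_vector {1..n}"
    by (simp add: letter_vector_def[abs_def])
  then have "distr M (PiM {1..n} (\<lambda>_. PiM {1..k} (\<lambda>_. borel))) (\<lambda>\<omega>. \<lambda>i\<in>{1..n}. letter_vector i \<omega>)
      = PiM {1..n} (\<lambda>i. distr M (PiM {1..k} (\<lambda>_. borel)) (letter_vector i))"
    using n letter_vector_measurable by (subst (asm) indep_vars_iff_distr_eq_PiM') auto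
  also have "\<dots> = PiM {1..n} (\<lambda>_. letter_law)"
    using letter_vector_distr by (intro PiM_cong refl) auto
  finally show ?thesis .
qed

lemma moment_law_letters: "moment_law letter_law {1..k} (\<lambda>_. 0) (\<lambda>r s. q * of_bool (r = s) - q\<^sup>2)"
proof -
  have lv [measurable]: "letter_vector 1 \<in> measurable M (PiM {1..k} (\<lambda>_. borel))"
    by (rule letter_vector_measurable) simp
  have transfer: "has_bochner_integral letter_law f c \<longleftrightarrow> has_bochner_integral M (\<lambda>\<omega>. f (letter_vector 1 \<omega>)) c"
    if "f \<in> borel_measurable (PiM {1..k} (\<lambda>_. borel))" for f :: "(nat \<Rightarrow> real) \<Rightarrow> real" and c
    unfolding letter_law_def has_bochner_integral_iff using that
    by (subst integrable_distr_eq integral_distr, measurable)+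
  define e where "e r \<omega> = (of_bool (X 1 \<omega> = \<alpha> (j r)) :: real)" for r \<omega>
  have lv_eq: "letter_vector 1 \<omega> r = e r \<omega> - q" if "r \<in> {1..k}" for r \<omega>
    using that by (simp add: letter_vector_def e_def)
  have e_int: "has_bochner_integral M (e r) q" if r: "r \<in> {1..k}" for r
  proof -
    have "X 1 -` {\<alpha> (j r)} \<inter> space M \<in> events"
      using X_measurable[of 1] j_ge_1[OF r] by (intro measurable_sets[of _ _ letters]) auto
    then have "has_bochner_integral M (indicator (X 1 -` {\<alpha> (j r)} \<inter> space M) :: _ \<Rightarrow> real) (prob (X 1 -` {\<alpha> (j r)} \<inter> space M))"
      by (intro has_bochner_integral_real_indicator) (auto simp: emeasure_eq_measure)
    moreover have "prob (X 1 -` {\<alpha> (j r)} \<inter> space M) = q"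
      using prob_X_letter[of 1 "j r"] j_ge_1[OF r] p_max[OF r] by simp
    ultimately have "has_bochner_integral M (indicator (X 1 -` {\<alpha> (j r)} \<inter> space M) :: _ \<Rightarrow> real) q" by simp
    then show ?thesis
      by (rule has_bochner_integral_cong[THEN iffD1, rotated -1]) (auto simp: indicator_def e_def)
  qed
  have const: "has_bochner_integral M (\<lambda>\<omega>. c) (c :: real)" for c
    by (simp add: has_bochner_integral_iff prob_space)
  \<comment> \<open>Different letters exclude each other; this produces the covariance \<open>- q\<^sup>2\<close>.\<close>
  have ee: "e r \<omega> * e s \<omega> = of_bool (r = s) * e r \<omega>" if "r \<in> {1..k}" "s \<in> {1..k}" for r s \<omega>
  proof -
    have "\<alpha> (j r) = \<alpha> (j s) \<longleftrightarrow> r = s"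
      using that inj_onD[OF alphabet_inj] inj_onD[OF strict_mono_on_imp_inj_on[OF j_mono]] j_ge_1 by force
    then show ?thesis by (auto simp: e_def)
  qed
  show ?thesis
  proof (intro moment_law.intro moment_law_axioms.intro)
    show "prob_space letter_law"
      unfolding letter_law_def by (rule prob_space_distr) (rule lv)
    show "finite {1..k}" by simp
    show "sets letter_law = sets (PiM {1..k} (\<lambda>_. borel))" by (simp add: letter_law_def)
  next
    fix r assume r: "r \<in> {1..k}"
    have "has_bochner_integral M (\<lambda>\<omega>. e r \<omega> - q) (q - q)"
      by (intro has_bochner_integral_diff e_int const r)
    then have "has_bochner_integral M (\<lambda>\<omega>. letter_vector 1 \<omega> r) 0"
      unfolding lv_eq[OF r] by simp
    then show "has_bochner_integral letter_law (\<lambda>y. y r) 0"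
      using r by (subst transfer) auto
  next
    fix r s assume r: "r \<in> {1..k}" and s: "s \<in> {1..k}"
    have "has_bochner_integral M (\<lambda>\<omega>. of_bool (r = s) * e r \<omega> - q * e r \<omega> - q * e s \<omega> + q * q)
        (of_bool (r = s) * q - q * q - q * q + q * q)"
      by (intro has_bochner_integral_add has_bochner_integral_diff has_bochner_integral_mult_right e_int const r s)
    moreover have "letter_vector 1 \<omega> r * letter_vector 1 \<omega> s = of_bool (r = s) * e r \<omega> - q * e r \<omega> - q * e s \<omega> + q * q" for \<omega>
      unfolding ee[OF r s, symmetric] lv_eq[OF r] lv_eq[OF s] by (simp add: algebra_simps)
    moreover have "of_bool (r = s) * q - q * q - q * q + q * q = q * of_bool (r = s) - q\<^sup>2"
      by (simp add: power2_eq_square)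
    ultimately have "has_bochner_integral M (\<lambda>\<omega>. letter_vector 1 \<omega> r * letter_vector 1 \<omega> s) (q * of_bool (r = s) - q\<^sup>2)"
      by (simp only:)
    then show "has_bochner_integral letter_law (\<lambda>y. y r * y s) (q * of_bool (r = s) - q\<^sup>2)"
      using r s by (subst transfer) auto
  next
    have meas: "(\<lambda>y. (\<Sum>r=1..k. \<bar>y r\<bar>) ^ 3) \<in> borel_measurable (PiM {1..k} (\<lambda>_. borel :: real measure))"
      by measurable
    have "\<bar>letter_vector 1 \<omega> r\<bar> \<le> 1 + q" if "r \<in> {1..k}" for r \<omega>
      unfolding lv_eq[OF that] e_def using q_pos by (auto simp: abs_le_iff)
    then have "(\<Sum>r=1..k. \<bar>letter_vector 1 \<omega> r\<bar>) ^ 3 \<le> (\<Sum>r=1..k. 1 + q) ^ 3" for \<omega>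
      by (intro power_mono sum_mono sum_nonneg) auto
    then have "integrable M (\<lambda>\<omega>. (\<Sum>r=1..k. \<bar>letter_vector 1 \<omega> r\<bar>) ^ 3)"
      using measurable_compose[OF lv meas]
      by (intro integrable_const_bound[of _ "(\<Sum>r=1..k. 1 + q) ^ 3"]) (auto simp: sum_nonneg)
    then show "integrable letter_law (\<lambda>y. (\<Sum>r=1..k. \<bar>y r\<bar>) ^ 3)"
      unfolding letter_law_def integrable_distr_eq[OF lv meas] by blast
  qed
qed

definition best_letters_passage :: "nat \<Rightarrow> 'm \<Rightarrow> real" where
  "best_letters_passage n \<omega> = last_passage n k (\<lambda>i r. of_bool (X i \<omega> = \<alpha> (j r)))"

lemma last_passage_letter_vectors:
  "last_passage n k (\<lambda>i\<in>{1..n}. letter_vector i \<omega>) = best_letters_passage n \<omega> - q * real n"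
proof -
  have "last_passage n k (\<lambda>i\<in>{1..n}. letter_vector i \<omega>)
      = last_passage n k (\<lambda>i r. 1 * of_bool (X i \<omega> = \<alpha> (j r)) + (- q))"
    by (rule last_passage_cong) (simp add: letter_vector_def)
  also have "\<dots> = 1 * best_letters_passage n \<omega> + (\<Sum>i=1..n. - q)"
    unfolding best_letters_passage_def using k by (intro last_passage_affine) auto
  finally show ?thesis by (simp add: mult.commute)
qed

lemma best_letters_le_LI: "best_letters_passage n \<omega> \<le> real (LI (\<lambda>i. X i \<omega>) n)"
proof -
  have "mono_on {1..k} (\<lambda>r. \<alpha> (j r))"
    using strict_mono_on_less_eq[OF alphabet] strict_mono_on_less_eq[OF j_mono] j_ge_1
    by (auto simp: monotone_on_def)
  then show ?thesis
    unfolding best_letters_passage_def by (rule last_passage_le_LI[OF k])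
qed

text \<open>The position, among the most probable letters, of the last one that does not exceed \<open>l\<close>. The
  truncation at \<open>1\<close> sends the letters before the first of them to this first one.\<close>

definition rank :: "nat \<Rightarrow> nat" where
  "rank l = max 1 (card {r \<in> {1..k}. j r \<le> l})"

lemma rank_mono: "l \<le> l' \<Longrightarrow> rank l \<le> rank l'"
  unfolding rank_def by (intro max.mono card_mono order_refl) auto

lemma rank_range: "rank l \<in> {1..k}"
  using k card_mono[of "{1..k}" "{r \<in> {1..k}. j r \<le> l}"] by (force simp: rank_def)

lemma rank_j: "r \<in> {1..k} \<Longrightarrow> rank (j r) = r"
proof -
  assume r: "r \<in> {1..k}"
  then have "{s \<in> {1..k}. j s \<le> j r} = {1..r}"
    using strict_mono_on_less_eq[OF j_mono _ r] by auto
  then show ?thesis using r by (simp add: rank_def)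
qed

text \<open>All letters beyond \<open>m\<close> are lumped into the single letter \<open>m + 1\<close>, and the letters outside \<open>j ` {1..k}\<close> are
  then replaced by the most probable letter of their rank.\<close>

lemma LI_le_best_letters:
  assumes m: "m \<ge> j k" and \<omega>: "\<omega> \<in> space M" and D: "D \<ge> 0"
    and gain: "\<And>l s t. l \<in> {1..m + 1} - j ` {1..k} \<Longrightarrow> s \<le> t \<Longrightarrow> t \<le> n \<Longrightarrow>
      (\<Sum>i\<in>{s<..t}. of_bool (min (letter_index (X i \<omega>)) (m + 1) = l) - of_bool (X i \<omega> = \<alpha> (j (rank l)))) \<le> D"
  shows "real (LI (\<lambda>i. X i \<omega>) n) \<le> best_letters_passage n \<omega> + real (m + 1) * D"
proof -
  have letters: "X i \<omega> \<in> \<alpha> ` {1..}" if "i \<ge> 1" for i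
    using X_letter[OF that \<omega>] .
  have "real (LI (\<lambda>i. X i \<omega>) n) \<le> last_passage n (m + 1) (\<lambda>i l. of_bool (min (letter_index (X i \<omega>)) (m + 1) = l))"
  proof (rule LI_le_last_passage[where g = "\<lambda>a. min (letter_index a) (m + 1)"])
    show "mono_on ((\<lambda>i. X i \<omega>) ` {1..n}) (\<lambda>a. min (letter_index a) (m + 1))"
    proof (rule mono_onI)
      fix a b assume "a \<in> (\<lambda>i. X i \<omega>) ` {1..n}" "b \<in> (\<lambda>i. X i \<omega>) ` {1..n}" "a \<le> b"
      then have "letter_index a \<le> letter_index b"
        using letters by (intro mono_onD[OF letter_index_mono]) auto
      then show "min (letter_index a) (m + 1) \<le> min (letter_index b) (m + 1)" by simp
    qed
    show "(\<lambda>a. min (letter_index a) (m + 1)) ` (\<lambda>i. X i \<omega>) ` {1..n} \<subseteq> {1..m + 1}"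
    proof (intro image_subsetI)
      fix a assume "a \<in> (\<lambda>i. X i \<omega>) ` {1..n}"
      then obtain i where "i \<in> {1..n}" "a = X i \<omega>" by blast
      then obtain l where "l \<ge> 1" "a = \<alpha> l" using letters[of i] by auto
      then show "min (letter_index a) (m + 1) \<in> {1..m + 1}" by simp
    qed
  qed simp
  also have "\<dots> \<le> last_passage n k (\<lambda>i r. of_bool (X i \<omega> = \<alpha> (j r))) + real (m + 1) * D"
  proof (rule last_passage_compress[where \<phi> = rank])
    show "mono_on {1..m + 1} rank" by (intro mono_onI rank_mono)
    show "rank ` {1..m + 1} \<subseteq> {1..k}" using rank_range by blast
    fix l s t :: nat assume l: "l \<in> {1..m + 1}" and st: "s \<le> t" "t \<le> n"
    show "(\<Sum>i\<in>{s<..t}. of_bool (min (letter_index (X i \<omega>)) (m + 1) = l) - of_bool (X i \<omega> = \<alpha> (j (rank l)))) \<le> D"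
    proof (cases "l \<in> j ` {1..k}")
      case True
      then obtain r where r: "r \<in> {1..k}" "l = j r" by blast
      have "j r \<le> j k" using strict_mono_on_less_eq[OF j_mono, of r k] r k by auto
      then have lm: "l \<le> m" "l \<ge> 1" using r m j_ge_1 by auto
      have "min (letter_index (X i \<omega>)) (m + 1) = l \<longleftrightarrow> X i \<omega> = \<alpha> l" if "i \<ge> 1" for i
      proof -
        obtain l' where l': "l' \<ge> 1" "X i \<omega> = \<alpha> l'" using letters[OF \<open>i \<ge> 1\<close>] by auto
        then have "X i \<omega> = \<alpha> l \<longleftrightarrow> l' = l" using inj_onD[OF alphabet_inj, of l' l] lm by auto
        then show ?thesis using l' lm by auto
      qed
      then have "(\<Sum>i\<in>{s<..t}. of_bool (min (letter_index (X i \<omega>)) (m + 1) = l) - of_bool (X i \<omega> = \<alpha> (j (rank l)))) = (\<Sum>i\<in>{s<..t}. 0 :: real)"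
        using rank_j[OF r(1)] r(2) by (intro sum.cong) auto
      then show ?thesis using D by simp
    next
      case False
      then show ?thesis using gain[of l s t] l st by blast
    qed
  qed simp
  finally show ?thesis by (simp add: best_letters_passage_def)
qed

lemma best_letters_measurable: "best_letters_passage n \<in> borel_measurable M"
  unfolding best_letters_passage_def
  by (rule word_functional_measurable[of n "\<lambda>x. last_passage n k (\<lambda>i r. of_bool (x i = \<alpha> (j r)))"])
    (auto intro: last_passage_cong)

text \<open>The union bound runs over the finitely many letters of the lumped alphabet and the \<open>(n + 1)\<^sup>2\<close> time
  intervals; it converges to \<open>0\<close> because \<open>(u / q) powr (n powr (1/4))\<close> decays faster than any power of \<open>n\<close>.\<close>

theorem LI_last_passage_comparison:
  fixes f f1 :: "real \<Rightarrow> real"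
  assumes f: "\<And>x. (f has_real_derivative f1 x) (at x)"
    and A: "\<And>x. \<bar>f x\<bar> \<le> A" "\<And>x. \<bar>f1 x\<bar> \<le> A"
  shows "(\<lambda>n. (\<integral>\<omega>. f ((real (LI (\<lambda>i. X i \<omega>) n) - q * real n) / sqrt (real n)) \<partial>M)
    - (\<integral>y. f (last_passage n k y / sqrt (real n)) \<partial>PiM {1..n} (\<lambda>_. letter_law))) \<longlonglongrightarrow> 0"
proof -
  have A0: "A \<ge> 0" using A(1)[of 0] by linarith
  have f_meas [measurable]: "f \<in> borel_measurable borel"
    using f by (intro borel_measurable_continuous_onI continuous_at_imp_continuous_on)
      (auto intro: DERIV_isCont)
  have "\<forall>\<^sub>F m in sequentially. prob (X 1 -` (\<alpha> ` {m<..}) \<inter> space M) < q \<and> j k \<le> m"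
    using order_tendstoD(2)[OF tail_prob_tendsto q_pos] eventually_ge_at_top[of "j k"]
    by eventually_elim simp
  then obtain m where m: "prob (X 1 -` (\<alpha> ` {m<..}) \<inter> space M) < q" "j k \<le> m"
    unfolding eventually_sequentially by blast
  \<comment> \<open>\<open>U l\<close> consists of the letters that are lumped into \<open>l\<close>, and \<open>V l\<close> of the competing most probable letter.\<close>
  define U where "U l = {a \<in> \<alpha> ` {1..}. min (letter_index a) (m + 1) = l}" for l
  define V where "V l = {\<alpha> (j (rank l))}" for l
  define u where "u l = prob (X 1 -` U l \<inter> space M)" for l
  define L where "L = {1..m + 1} - j ` {1..k}"
  have U_eq: "U l = (if l \<le> m then {\<alpha> l} else \<alpha> ` {m<..})" if "l \<in> {1..m + 1}" for l
    using that by (auto simp: U_def min_def split: if_splits)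
  have U_sub: "U l \<subseteq> \<alpha> ` {1..}" for l by (auto simp: U_def)
  have V_sub: "V l \<subseteq> \<alpha> ` {1..}" for l
    using j_ge_1[OF rank_range] by (auto simp: V_def)
  have u_less: "u l < q" if l: "l \<in> L" for l
  proof (cases "l \<le> m")
    case True
    then have "u l = p l" using U_eq[of l] l prob_X_letter[of 1 l] by (simp add: u_def L_def)
    then show ?thesis using p_less l by (auto simp: L_def)
  next
    case False
    then show ?thesis using U_eq[of l] l m(1) by (simp add: u_def L_def)
  qed
  have u_pos: "u l > 0" if l: "l \<in> L" for l
  proof -
    have "\<alpha> l \<in> U l" "l \<ge> 1" using l U_def by (auto simp: L_def)
    then have "prob (X 1 -` {\<alpha> l} \<inter> space M) \<le> u l"
      unfolding u_def using X_measurable[of 1] U_sub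
      by (intro finite_measure_mono) (auto intro!: measurable_sets[of _ _ letters])
    then show ?thesis using prob_X_letter[of 1 l] pos[of l] \<open>l \<ge> 1\<close> by simp
  qed
  have UV: "U l \<inter> V l = {}" if l: "l \<in> L" for l
  proof -
    have "j (rank l) \<in> j ` {1..k}" using rank_range by blast
    then have ne: "j (rank l) \<noteq> l" using l by (auto simp: L_def)
    have "j (rank l) \<le> j k" using strict_mono_on_less_eq[OF j_mono, of "rank l" k] rank_range[of l] k by auto
    then have "min (letter_index (\<alpha> (j (rank l)))) (m + 1) = j (rank l)"
      using m(2) j_ge_1[OF rank_range] by simp
    then show ?thesis using ne by (auto simp: U_def V_def)
  qed
  \<comment> \<open>A tolerance with \<open>ln n\<close> negligible against \<open>d n\<close> and \<open>d n\<close> negligible against \<open>sqrt n\<close>.\<close>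
  define d where "d n = real n powr (1/4)" for n :: nat
  define Bad1 where "Bad1 n l s t = {\<omega> \<in> space M. d n < (\<Sum>i\<in>{s<..t}. of_bool (X i \<omega> \<in> U l) - of_bool (X i \<omega> \<in> V l))}"
    for n l s t :: nat
  define Bad where "Bad n = (\<Union>z\<in>L \<times> {0..n} \<times> {0..n}. Bad1 n (fst z) (fst (snd z)) (snd (snd z)))" for n
  have Bad1_event: "Bad1 n l s t \<in> events" for n l s t
  proof -
    have [measurable]: "(\<lambda>\<omega>. of_bool (X i \<omega> \<in> U l) - of_bool (X i \<omega> \<in> V l) :: real) \<in> borel_measurable M"
      if "i \<in> {s<..t}" for i
      by (rule measurable_compose[OF X_measurable]) (use that in auto)
    show ?thesis unfolding Bad1_def by measurable
  qed
  have Bad1_prob: "prob (Bad1 n l s t) \<le> (u l / q) powr d n" if l: "l \<in> L" for n l s t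
    unfolding Bad1_def
  proof (rule excess_bound)
    show "indep_vars (\<lambda>_. letters) X {s<..t}"
      using indep by (rule indep_vars_subset) auto
    show "prob (X i -` U l \<inter> space M) = u l" if "i \<in> {s<..t}" for i
      unfolding u_def using that U_sub by (intro prob_X) auto
    show "prob (X i -` V l \<inter> space M) = q" if "i \<in> {s<..t}" for i
      using that prob_X_letter[of i "j (rank l)"] j_ge_1[OF rank_range] p_max[OF rank_range] by (simp add: V_def)
  qed (use U_sub V_sub UV[OF l] u_less[OF l] u_pos[OF l] in auto)
  have finL: "finite L" by (simp add: L_def)
  have Bad_event: "Bad n \<in> events" for n
    unfolding Bad_def using finL Bad1_event by (intro sets.finite_UN) auto
  have Bad_prob: "prob (Bad n) \<le> (\<Sum>l\<in>L. (real n + 1)\<^sup>2 * (u l / q) powr d n)" for n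
  proof -
    have "prob (Bad n) \<le> (\<Sum>z\<in>L \<times> {0..n} \<times> {0..n}. prob (Bad1 n (fst z) (fst (snd z)) (snd (snd z))))"
      unfolding Bad_def using finL Bad1_event by (intro finite_measure_subadditive_finite) auto
    also have "\<dots> \<le> (\<Sum>z\<in>L \<times> {0..n} \<times> {0..n}. (u (fst z) / q) powr d n)"
      by (intro sum_mono Bad1_prob) auto
    also have "\<dots> = (\<Sum>l\<in>L. \<Sum>st\<in>{0..n} \<times> {0..n}. (u l / q) powr d n)"
      by (simp only: sum.cartesian_product case_prod_unfold)
    also have "\<dots> = (\<Sum>l\<in>L. (real n + 1)\<^sup>2 * (u l / q) powr d n)"
      by (simp add: power2_eq_square algebra_simps)
    finally show ?thesis .
  qed
  have outside: "\<bar>(real (LI (\<lambda>i. X i \<omega>) n) - q * real n) / sqrt (real n)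
      - (best_letters_passage n \<omega> - q * real n) / sqrt (real n)\<bar> \<le> real (m + 1) * d n / sqrt (real n)"
    if \<omega>: "\<omega> \<in> space M - Bad n" for n \<omega>
  proof -
    have "real (LI (\<lambda>i. X i \<omega>) n) \<le> best_letters_passage n \<omega> + real (m + 1) * d n"
    proof (rule LI_le_best_letters[OF m(2)])
      show "\<omega> \<in> space M" using \<omega> by simp
      show "0 \<le> d n" by (simp add: d_def)
      fix l s t assume l: "l \<in> {1..m + 1} - j ` {1..k}" and st: "s \<le> t" "t \<le> n"
      have "\<omega> \<notin> Bad1 n l s t"
        using \<omega> l st unfolding Bad_def L_def by force
      then have "(\<Sum>i\<in>{s<..t}. of_bool (X i \<omega> \<in> U l) - of_bool (X i \<omega> \<in> V l)) \<le> d n"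
        using \<omega> by (simp add: Bad1_def)
      moreover have "(\<Sum>i\<in>{s<..t}. of_bool (X i \<omega> \<in> U l) - of_bool (X i \<omega> \<in> V l) :: real)
        = (\<Sum>i\<in>{s<..t}. of_bool (min (letter_index (X i \<omega>)) (m + 1) = l) - of_bool (X i \<omega> = \<alpha> (j (rank l))))"
      proof (rule sum.cong[OF refl])
        fix i assume "i \<in> {s<..t}"
        then have "X i \<omega> \<in> \<alpha> ` {1..}" using X_letter[of i \<omega>] \<omega> by auto
        then show "of_bool (X i \<omega> \<in> U l) - of_bool (X i \<omega> \<in> V l)
          = (of_bool (min (letter_index (X i \<omega>)) (m + 1) = l) - of_bool (X i \<omega> = \<alpha> (j (rank l))) :: real)"
          by (simp add: U_def V_def)
      qed
      ultimately show "(\<Sum>i\<in>{s<..t}. of_bool (min (letter_index (X i \<omega>)) (m + 1) = l) - of_bool (X i \<omega> = \<alpha> (j (rank l)))) \<le> d n"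
        by simp
    qed
    then have "\<bar>real (LI (\<lambda>i. X i \<omega>) n) - best_letters_passage n \<omega>\<bar> \<le> real (m + 1) * d n"
      using best_letters_le_LI[of n \<omega>] by linarith
    then have "\<bar>real (LI (\<lambda>i. X i \<omega>) n) - best_letters_passage n \<omega>\<bar> / sqrt (real n) \<le> real (m + 1) * d n / sqrt (real n)"
      by (rule divide_right_mono) simp
    moreover have "(real (LI (\<lambda>i. X i \<omega>) n) - q * real n) / sqrt (real n) - (best_letters_passage n \<omega> - q * real n) / sqrt (real n)
        = (real (LI (\<lambda>i. X i \<omega>) n) - best_letters_passage n \<omega>) / sqrt (real n)"
      by (simp add: diff_divide_distrib)
    ultimately show ?thesis by (simp add: abs_divide)
  qed
  have best: "(\<integral>y. f (last_passage n k y / sqrt (real n)) \<partial>PiM {1..n} (\<lambda>_. letter_law))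
      = (\<integral>\<omega>. f ((best_letters_passage n \<omega> - q * real n) / sqrt (real n)) \<partial>M)" if n: "n \<ge> 1" for n
  proof -
    have lp: "last_passage n k \<in> borel_measurable (PiM {1..n} (\<lambda>_. letter_law))"
      by (rule last_passage_measurable[OF moment_law_letters])
    have [measurable]: "last_passage n k \<in> borel_measurable (PiM {1..n} (\<lambda>_. PiM {1..k} (\<lambda>_. borel)))"
      using lp unfolding letter_law_def by (simp cong: measurable_cong_sets sets_PiM_cong)
    have vec: "(\<lambda>\<omega>. \<lambda>i\<in>{1..n}. letter_vector i \<omega>) \<in> measurable M (PiM {1..n} (\<lambda>_. PiM {1..k} (\<lambda>_. borel)))"
      by (intro measurable_restrict letter_vector_measurable) auto
    have "(\<integral>y. f (last_passage n k y / sqrt (real n)) \<partial>PiM {1..n} (\<lambda>_. letter_law))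
       = (\<integral>\<omega>. f (last_passage n k (\<lambda>i\<in>{1..n}. letter_vector i \<omega>) / sqrt (real n)) \<partial>M)"
      unfolding letter_vectors_distr[OF n, symmetric] by (rule integral_distr[OF vec]) measurable
    then show ?thesis unfolding last_passage_letter_vectors .
  qed
  note [measurable] = LI_measurable best_letters_measurable
  show ?thesis
  proof (rule Lim_null_comparison)
    show "\<forall>\<^sub>F n in sequentially. norm ((\<integral>\<omega>. f ((real (LI (\<lambda>i. X i \<omega>) n) - q * real n) / sqrt (real n)) \<partial>M)
        - (\<integral>y. f (last_passage n k y / sqrt (real n)) \<partial>PiM {1..n} (\<lambda>_. letter_law)))
      \<le> A * (real (m + 1) * d n / sqrt (real n)) + 2 * A * (\<Sum>l\<in>L. (real n + 1)\<^sup>2 * (u l / q) powr d n)"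
      using eventually_ge_at_top[of 1]
    proof eventually_elim
      case (elim n)
      have "\<bar>(\<integral>\<omega>. f ((real (LI (\<lambda>i. X i \<omega>) n) - q * real n) / sqrt (real n)) \<partial>M)
          - (\<integral>\<omega>. f ((best_letters_passage n \<omega> - q * real n) / sqrt (real n)) \<partial>M)\<bar>
        \<le> A * (real (m + 1) * d n / sqrt (real n)) + 2 * A * prob (Bad n)"
        by (rule abs_integral_diff_le[OF f_meas A(1) bounded_derivative_lipschitz[OF f A(2)] _ _ Bad_event outside])
          (measurable, simp_all add: d_def)
      also have "\<dots> \<le> A * (real (m + 1) * d n / sqrt (real n)) + 2 * A * (\<Sum>l\<in>L. (real n + 1)\<^sup>2 * (u l / q) powr d n)"
        using Bad_prob A0 by (intro add_left_mono mult_left_mono) auto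
      finally show ?case unfolding best[OF elim] real_norm_def .
    qed
    have "(\<lambda>n. real (m + 1) * d n / sqrt (real n)) \<longlonglongrightarrow> 0"
      unfolding d_def by real_asymp
    moreover have "(\<lambda>n. (real n + 1)\<^sup>2 * (u l / q) powr d n) \<longlonglongrightarrow> 0" if l: "l \<in> L" for l
    proof -
      define c where "c = - ln (u l / q)"
      have c: "c > 0"
        using u_pos[OF l] u_less[OF l] by (simp add: c_def)
      have "(\<lambda>n. (real n + 1)\<^sup>2 * exp (- c * (real n powr (1/4)))) \<longlonglongrightarrow> 0"
        using c by real_asymp
      moreover have "(u l / q) powr x = exp (- c * x)" for x
        using u_pos[OF l] u_less[OF l] by (simp add: powr_def c_def mult.commute)
      ultimately show ?thesis by (simp add: d_def)
    qed
    ultimately have "(\<lambda>n. A * (real (m + 1) * d n / sqrt (real n)) + 2 * A * (\<Sum>l\<in>L. (real n + 1)\<^sup>2 * (u l / q) powr d n))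
        \<longlonglongrightarrow> A * 0 + 2 * A * (\<Sum>l\<in>L. 0)"
      by (intro tendsto_add tendsto_mult tendsto_const tendsto_sum)
    then show "(\<lambda>n. A * (real (m + 1) * d n / sqrt (real n)) + 2 * A * (\<Sum>l\<in>L. (real n + 1)\<^sup>2 * (u l / q) powr d n))
        \<longlonglongrightarrow> 0" by simp
  qed
qed

end

section \<open>Last passage values of continuous paths\<close>

text \<open>Summation by parts: at time \<open>i\<close> the increment of path \<open>c i\<close> is that of path \<open>k\<close> plus the increments of
  the differences \<open>b r - b (r + 1)\<close> with \<open>c i \<le> r\<close>, and the latter times form an initial segment.\<close>

lemma labelling_increment_sum:
  fixes b :: "nat \<Rightarrow> real \<Rightarrow> real"
  assumes c: "c \<in> labellings n k" and k: "k \<ge> 1" and n: "n \<ge> 1"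
    and b0: "\<And>r. r \<in> {1..k} \<Longrightarrow> b r 0 = 0"
  defines "\<tau> \<equiv> \<lambda>r. real (card {i \<in> {1..n}. c i \<le> r}) / real n"
  shows "(\<Sum>i=1..n. b (c i) (real i / real n) - b (c i) (real (i - 1) / real n))
    = b k 1 + sqrt 2 * (\<Sum>r=1..k-1. b_tilde b r (\<tau> r))"
proof -
  define \<Delta> where "\<Delta> r i = b r (real i / real n) - b r (real (i - 1) / real n)" for r i
  have tele: "\<Delta> (c i) i = \<Delta> k i + (\<Sum>r=1..k-1. if c i \<le> r then \<Delta> r i - \<Delta> (Suc r) i else 0)"
    if i: "i \<in> {1..n}" for i
  proof -
    have ci: "1 \<le> c i" "c i \<le> k" using labellings_range[OF c i] by auto
    have "(\<Sum>r=1..k-1. if c i \<le> r then \<Delta> r i - \<Delta> (Suc r) i else 0)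
        = (\<Sum>r\<in>{c i..<k}. \<Delta> r i - \<Delta> (Suc r) i)"
      using ci by (intro sum.mono_neutral_cong_right) auto
    also have "\<dots> = \<Delta> (c i) i - \<Delta> k i"
      using sum_Suc_diff'[OF ci(2), of "\<lambda>r. - \<Delta> r i"] by (simp add: algebra_simps)
    finally show ?thesis by simp
  qed
  have sum_\<Delta>: "(\<Sum>i=1..m. \<Delta> r i) = b r (real m / real n)" if "r \<in> {1..k}" "m \<le> n" for r m
    using that(2)
  proof (induction m)
    case (Suc m)
    then show ?case by (simp add: \<Delta>_def)
  qed (simp add: b0[OF that(1)])
  have initial: "{i \<in> {1..n}. c i \<le> r} = {1..card {i \<in> {1..n}. c i \<le> r}}" for r
  proof -
    have "card {i \<in> {1..n}. c i \<le> r} \<le> n"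
      using card_mono[of "{1..n}" "{i \<in> {1..n}. c i \<le> r}"] by force
    then show ?thesis
      using labelling_le_iff[OF c, of _ r] by (intro set_eqI) (simp only: mem_Collect_eq atLeastAtMost_iff, force)
  qed
  have level: "(\<Sum>i=1..n. if c i \<le> r then \<Delta> r i - \<Delta> (Suc r) i else 0) = sqrt 2 * b_tilde b r (\<tau> r)"
    if r: "r \<in> {1..k-1}" for r
  proof -
    have le: "card {i \<in> {1..n}. c i \<le> r} \<le> n"
      using card_mono[of "{1..n}" "{i \<in> {1..n}. c i \<le> r}"] by force
    have "(\<Sum>i=1..n. if c i \<le> r then \<Delta> r i - \<Delta> (Suc r) i else 0)
        = (\<Sum>i\<in>{i \<in> {1..n}. c i \<le> r}. \<Delta> r i - \<Delta> (Suc r) i)"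
      by (rule sum.inter_filter[symmetric]) simp
    also have "\<dots> = (\<Sum>i=1..card {i \<in> {1..n}. c i \<le> r}. \<Delta> r i - \<Delta> (Suc r) i)"
      by (subst initial) (rule refl)
    also have "\<dots> = b r (\<tau> r) - b (Suc r) (\<tau> r)"
    proof -
      have "r \<in> {1..k}" "Suc r \<in> {1..k}" using r by auto
      then show ?thesis
        using sum_\<Delta>[OF _ le, of r] sum_\<Delta>[OF _ le, of "Suc r"] by (simp only: sum_subtractf \<tau>_def)
    qed
    finally show ?thesis by (simp add: b_tilde_def)
  qed
  have "(\<Sum>i=1..n. \<Delta> (c i) i)
      = (\<Sum>i=1..n. \<Delta> k i) + (\<Sum>i=1..n. \<Sum>r=1..k-1. if c i \<le> r then \<Delta> r i - \<Delta> (Suc r) i else 0)"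
    unfolding sum.distrib[symmetric] by (rule sum.cong[OF refl tele])
  also have "\<dots> = b k 1 + (\<Sum>r=1..k-1. sqrt 2 * b_tilde b r (\<tau> r))"
    using sum_\<Delta>[of k n] k n level by (subst sum.swap) simp
  finally show ?thesis
    by (simp add: \<Delta>_def sum_distrib_left)
qed

text \<open>Every admissible time vector is approximated by a labelling, which rounds the times down to the grid.\<close>

lemma labelling_of_times:
  fixes t :: "nat \<Rightarrow> real"
  assumes k: "k \<ge> 1" and t: "mono_on {1..k-1} t" "t ` {1..k-1} \<subseteq> {0..1}"
  obtains c where "c \<in> labellings n k"
    "\<And>r. r \<in> {1..k-1} \<Longrightarrow> card {i \<in> {1..n}. c i \<le> r} = nat \<lfloor>real n * t r\<rfloor>"
proof
  \<comment> \<open>The alternative \<open>r = k\<close> makes the least such \<open>r\<close> exist and plays the part of a last time \<open>1\<close>.\<close>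
  define Q where "Q i r \<longleftrightarrow> 1 \<le> r \<and> (r = k \<or> r < k \<and> real i \<le> real n * t r)" for i r
  define c where "c = (\<lambda>i\<in>{1..n}. LEAST r. Q i r)"
  have Qk: "Q i k" for i using k by (simp add: Q_def)
  have least: "Q i (LEAST r. Q i r)" "(LEAST r. Q i r) \<le> k" for i
    using LeastI[of "Q i", OF Qk] Least_le[of "Q i", OF Qk] by auto
  show "c \<in> labellings n k"
  proof -
    have "(LEAST r. Q i r) \<le> (LEAST r. Q i' r)" if "i \<le> i'" for i i'
    proof (rule Least_le)
      show "Q i (LEAST r. Q i' r)"
        using least(1)[of i'] that by (auto simp: Q_def)
    qed
    then show ?thesis
      using least by (auto simp: labellings_def c_def monotone_on_def Q_def)
  qed
  fix r assume r: "r \<in> {1..k-1}"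
  have iff: "c i \<le> r \<longleftrightarrow> real i \<le> real n * t r" if i: "i \<in> {1..n}" for i
  proof
    assume "real i \<le> real n * t r"
    then have "Q i r" using r by (auto simp: Q_def)
    then show "c i \<le> r" using i by (simp add: c_def Least_le)
  next
    define l where "l = (LEAST r. Q i r)"
    assume "c i \<le> r"
    then have l: "l \<le> r" using i by (simp add: c_def l_def)
    then have "1 \<le> l" "real i \<le> real n * t l"
      using least(1)[of i] r by (auto simp: Q_def l_def)
    moreover have "t l \<le> t r"
      using monotone_onD[OF t(1), of l r] l r \<open>1 \<le> l\<close> by auto
    then have "real n * t l \<le> real n * t r" by (intro mult_left_mono) auto
    ultimately show "real i \<le> real n * t r" by linarith
  qed
  have "t r \<in> {0..1}" using t(2) r by blast
  then have tr: "0 \<le> t r" "t r \<le> 1" by auto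
  have "real n * t r \<le> real n" using mult_left_mono[OF tr(2), of "real n"] by simp
  then have "{i \<in> {1..n}. c i \<le> r} = {1..nat \<lfloor>real n * t r\<rfloor>}"
    using tr by (auto simp: iff le_nat_iff le_floor_iff)
  then show "card {i \<in> {1..n}. c i \<le> r} = nat \<lfloor>real n * t r\<rfloor>" by simp
qed

text \<open>Summation by parts of the drift term of \<open>H_lim\<close> leaves \<open>b k 1\<close> minus the mean of the endpoints,
  which cancels against \<open>Z_lim\<close>.\<close>

lemma Z_H_eq_sup:
  assumes k: "k \<ge> 1"
  shows "Z_lim k b + H_lim k b = b k 1 + sqrt 2 *
    (SUP t \<in> {t :: nat \<Rightarrow> real. mono_on {1..k-1} t \<and> t ` {1..k-1} \<subseteq> {0..1}}. \<Sum>r=1..k-1. b_tilde b r (t r))"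
proof -
  define S where "S = (SUP t \<in> {t :: nat \<Rightarrow> real. mono_on {1..k-1} t \<and> t ` {1..k-1} \<subseteq> {0..1}}.
    \<Sum>r=1..k-1. b_tilde b r (t r))"
  have by_parts: "(\<Sum>r=1..m. real r * (b r 1 - b (r + 1) 1)) = (\<Sum>r=1..m + 1. b r 1) - real (m + 1) * b (m + 1) 1" for m
    by (induction m) (auto simp: algebra_simps)
  have "sqrt 2 * (\<Sum>r=1..k-1. real r * b_tilde b r 1) = (\<Sum>r=1..k-1. real r * (b r 1 - b (r + 1) 1))"
    by (simp add: sum_distrib_left b_tilde_def)
  also have "\<dots> = (\<Sum>r=1..k. b r 1) - real k * b k 1"
    using by_parts[of "k - 1"] k by simp
  finally have sum: "sqrt 2 * (\<Sum>r=1..k-1. real r * b_tilde b r 1) = (\<Sum>r=1..k. b r 1) - real k * b k 1" .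
  have H: "H_lim k b = sqrt 2 * (- (1 / real k) * (\<Sum>r=1..k-1. real r * b_tilde b r 1) + S)"
  proof (cases "k = 1")
    case True
    have "(\<lambda>_. 0) \<in> {t :: nat \<Rightarrow> real. mono_on {1..k-1} t \<and> t ` {1..k-1} \<subseteq> {0..1}}"
      by (auto simp: monotone_on_def)
    then have "S = 0"
      unfolding S_def using True by (subst cSUP_const[symmetric]) auto
    then show ?thesis using True by (simp add: H_lim_def)
  qed (simp add: H_lim_def S_def)
  have "H_lim k b = - (1 / real k) * (sqrt 2 * (\<Sum>r=1..k-1. real r * b_tilde b r 1)) + sqrt 2 * S"
    unfolding H by (simp add: algebra_simps)
  also have "\<dots> = - (1 / real k) * (\<Sum>r=1..k. b r 1) + b k 1 + sqrt 2 * S"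
    unfolding sum using k by (simp add: field_simps)
  finally show ?thesis
    by (simp add: Z_lim_def S_def)
qed

text \<open>The grid values stay below the supremum over all time vectors, and by continuity rounding a single
  near-optimal time vector to the grid already recovers the supremum in the limit.\<close>

theorem last_passage_tendsto:
  fixes b :: "nat \<Rightarrow> real \<Rightarrow> real"
  assumes k: "k \<ge> 1" and cont: "\<And>r. r \<in> {1..k} \<Longrightarrow> continuous_on {0..1} (b r)"
    and b0: "\<And>r. r \<in> {1..k} \<Longrightarrow> b r 0 = 0"
  shows "(\<lambda>n. last_passage n k (\<lambda>i r. b r (real i / real n) - b r (real (i - 1) / real n)))
    \<longlonglongrightarrow> Z_lim k b + H_lim k b"
proof -
  define TT where "TT = {t :: nat \<Rightarrow> real. mono_on {1..k-1} t \<and> t ` {1..k-1} \<subseteq> {0..1}}"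
  define \<Phi> where "\<Phi> t = (\<Sum>r=1..k-1. b_tilde b r (t r))" for t
  define S where "S = (SUP t\<in>TT. \<Phi> t)"
  define L where "L n = last_passage n k (\<lambda>i r. b r (real i / real n) - b r (real (i - 1) / real n))" for n
  have cont_tilde: "continuous_on {0..1} (b_tilde b r)" if "r \<in> {1..k-1}" for r
    unfolding b_tilde_def[abs_def] using that by (intro continuous_intros cont) auto
  have "\<exists>C. \<forall>x\<in>{0..1}. \<bar>b_tilde b r x\<bar> \<le> C" if "r \<in> {1..k-1}" for r
    using compact_imp_bounded[OF compact_continuous_image[OF cont_tilde[OF that] compact_Icc]]
    by (auto simp: bounded_iff)
  then obtain C where C: "\<And>r x. r \<in> {1..k-1} \<Longrightarrow> x \<in> {0..1} \<Longrightarrow> \<bar>b_tilde b r x\<bar> \<le> C r"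
    by metis
  have bdd: "bdd_above (\<Phi> ` TT)"
  proof (rule bdd_aboveI2)
    fix t assume t: "t \<in> TT"
    have "b_tilde b r (t r) \<le> C r" if r: "r \<in> {1..k-1}" for r
    proof -
      have "t r \<in> {0..1}" using t r unfolding TT_def by blast
      then show ?thesis using C[OF r] abs_le_D1 by blast
    qed
    then show "\<Phi> t \<le> (\<Sum>r=1..k-1. C r)"
      unfolding \<Phi>_def by (rule sum_mono)
  qed
  have ne: "TT \<noteq> {}"
  proof -
    have "(\<lambda>_. 0) \<in> TT" by (auto simp: TT_def monotone_on_def)
    then show ?thesis by blast
  qed
  have upper: "L n \<le> b k 1 + sqrt 2 * S" if n: "n \<ge> 1" for n
  proof -
    obtain c where c: "c \<in> labellings n k"
      "L n = (\<Sum>i=1..n. b (c i) (real i / real n) - b (c i) (real (i - 1) / real n))"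
      unfolding L_def using last_passage_attained[OF k] .
    define \<tau> where "\<tau> r = real (card {i \<in> {1..n}. c i \<le> r}) / real n" for r
    have "\<tau> \<in> TT"
    proof -
      have "card {i \<in> {1..n}. c i \<le> r} \<le> n" for r
        using card_mono[of "{1..n}" "{i \<in> {1..n}. c i \<le> r}"] by force
      moreover have "card {i \<in> {1..n}. c i \<le> r} \<le> card {i \<in> {1..n}. c i \<le> s}" if "r \<le> s" for r s
        using that by (intro card_mono) auto
      ultimately show ?thesis
        using n by (auto simp: TT_def \<tau>_def monotone_on_def divide_simps)
    qed
    then have "\<Phi> \<tau> \<le> S"
      unfolding S_def by (intro cSUP_upper bdd)
    moreover have "L n = b k 1 + sqrt 2 * \<Phi> \<tau>"
      using labelling_increment_sum[where b = b, OF c(1) k n b0] c(2) by (simp add: \<Phi>_def \<tau>_def)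
    ultimately show ?thesis by simp
  qed
  have lower: "\<forall>\<^sub>F n in sequentially. a < L n" if a: "a < b k 1 + sqrt 2 * S" for a
  proof -
    have "(a - b k 1) / sqrt 2 < S"
      using a by (simp add: field_simps)
    then obtain t where t: "t \<in> TT" "(a - b k 1) / sqrt 2 < \<Phi> t"
      unfolding S_def using less_cSUP_iff[OF ne bdd] by auto
    define s where "s n r = real (nat \<lfloor>real n * t r\<rfloor>) / real n" for n r
    have s_lim: "(\<lambda>n. \<Phi> (s n)) \<longlonglongrightarrow> \<Phi> t"
      unfolding \<Phi>_def
    proof (rule tendsto_sum)
      fix r assume r: "r \<in> {1..k-1}"
      have "t r \<in> {0..1}" using t(1) r unfolding TT_def by blast
      then have tr: "0 \<le> t r" "t r \<le> 1" by auto
      have s01: "s n r \<in> {0..1}" for n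
      proof -
        have "real n * t r \<le> real n" using mult_left_mono[OF tr(2), of "real n"] by simp
        then have "real (nat \<lfloor>real n * t r\<rfloor>) \<le> real n"
          using tr by (simp add: le_floor_iff) linarith
        then show ?thesis by (auto simp: s_def divide_simps)
      qed
      have "(\<lambda>n. s n r) \<longlonglongrightarrow> t r"
      proof (rule tendsto_sandwich)
        show "\<forall>\<^sub>F n in sequentially. t r - 1 / real n \<le> s n r"
          using eventually_gt_at_top[of 0]
        proof eventually_elim
          case (elim n)
          have "real n * t r - 1 \<le> real (nat \<lfloor>real n * t r\<rfloor>)"
            using tr by simp
          then have "(real n * t r - 1) / real n \<le> s n r"
            unfolding s_def by (rule divide_right_mono) simp
          then show ?case using elim by (simp add: diff_divide_distrib)
        qed
        show "\<forall>\<^sub>F n in sequentially. s n r \<le> t r"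
          using eventually_gt_at_top[of 0]
        proof eventually_elim
          case (elim n)
          have "real (nat \<lfloor>real n * t r\<rfloor>) \<le> real n * t r"
            using tr by simp
          then show ?case using elim by (simp add: s_def field_simps)
        qed
        show "(\<lambda>n. t r - 1 / real n) \<longlonglongrightarrow> t r" by real_asymp
      qed auto
      then show "(\<lambda>n. b_tilde b r (s n r)) \<longlonglongrightarrow> b_tilde b r (t r)"
        using tr s01 by (intro continuous_on_tendsto_compose[OF cont_tilde[OF r]]) auto
    qed
    have below: "b k 1 + sqrt 2 * \<Phi> (s n) \<le> L n" if n: "n \<ge> 1" for n
    proof -
      obtain c where c: "c \<in> labellings n k"
        "\<And>r. r \<in> {1..k-1} \<Longrightarrow> card {i \<in> {1..n}. c i \<le> r} = nat \<lfloor>real n * t r\<rfloor>"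
        using labelling_of_times[OF k, of t n] t(1) by (auto simp: TT_def)
      have "(\<Sum>r=1..k-1. b_tilde b r (real (card {i \<in> {1..n}. c i \<le> r}) / real n)) = \<Phi> (s n)"
        unfolding \<Phi>_def s_def by (intro sum.cong refl) (simp only: c(2))
      then show ?thesis
        using labelling_increment_sum[where b = b, OF c(1) k n b0]
          last_passage_ge[OF c(1), of "\<lambda>i r. b r (real i / real n) - b r (real (i - 1) / real n)"]
        by (simp add: L_def)
    qed
    have "\<forall>\<^sub>F n in sequentially. (a - b k 1) / sqrt 2 < \<Phi> (s n)"
      using order_tendstoD(1)[OF s_lim t(2)] .
    then show ?thesis
      using eventually_ge_at_top[of 1]
    proof eventually_elim
      case (elim n)
      then have "a < b k 1 + sqrt 2 * \<Phi> (s n)" by (simp add: field_simps)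
      then show ?case using below elim by fastforce
    qed
  qed
  have "L \<longlonglongrightarrow> b k 1 + sqrt 2 * S"
  proof (rule order_tendstoI)
    fix a assume "b k 1 + sqrt 2 * S < a"
    show "\<forall>\<^sub>F n in sequentially. L n < a"
      using eventually_ge_at_top[of 1]
      by eventually_elim (use upper \<open>b k 1 + sqrt 2 * S < a\<close> in fastforce)
  qed (rule lower)
  then show ?thesis
    unfolding L_def[abs_def] Z_H_eq_sup[OF k] S_def TT_def \<Phi>_def .
qed

section \<open>Gaussian vectors with the covariance of letter counts\<close>

lemma (in prob_space) indep_vars_array:
  assumes fin: "finite I" "finite J" "I \<noteq> {}" "J \<noteq> {}"
    and rows: "indep_vars (\<lambda>r. PiM J (S r)) (\<lambda>r \<omega>. \<lambda>i\<in>J. X r i \<omega>) I"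
    and row: "\<And>r. r \<in> I \<Longrightarrow> indep_vars (S r) (X r) J"
  shows "indep_vars (\<lambda>z. S (fst z) (snd z)) (\<lambda>z. X (fst z) (snd z)) (I \<times> J)"
proof -
  have rv: "random_variable (S r i) (X r i)" if "r \<in> I" "i \<in> J" for r i
    using row that by (auto simp: indep_vars_def)
  have "prob (\<Inter>z\<in>I \<times> J. X (fst z) (snd z) -` A z \<inter> space M)
      = (\<Prod>z\<in>I \<times> J. prob (X (fst z) (snd z) -` A z \<inter> space M))"
    if A: "A \<in> (\<Pi> z\<in>I \<times> J. sets (S (fst z) (snd z)))" for A
  proof -
    define box where "box r = (\<Pi>\<^sub>E i\<in>J. A (r, i))" for r
    have A': "A (r, i) \<in> sets (S r i)" if "r \<in> I" "i \<in> J" for r i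
      using Pi_mem[OF A, of "(r, i)"] that by simp
    have box: "box r \<in> sets (PiM J (S r))" if "r \<in> I" for r
      unfolding box_def using fin(2) A' that by (intro sets_PiM_I_finite) auto
    have vimage: "(\<lambda>\<omega>. \<lambda>i\<in>J. X r i \<omega>) -` box r \<inter> space M = (\<Inter>i\<in>J. X r i -` A (r, i) \<inter> space M)" for r
      using fin(4) by (auto simp: box_def PiE_iff)
    have "(\<Inter>z\<in>I \<times> J. X (fst z) (snd z) -` A z \<inter> space M)
        = (\<Inter>r\<in>I. (\<lambda>\<omega>. \<lambda>i\<in>J. X r i \<omega>) -` box r \<inter> space M)"
      unfolding vimage by auto
    then have "prob (\<Inter>z\<in>I \<times> J. X (fst z) (snd z) -` A z \<inter> space M)
        = prob (\<Inter>r\<in>I. (\<lambda>\<omega>. \<lambda>i\<in>J. X r i \<omega>) -` box r \<inter> space M)" by simp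
    also have "\<dots> = (\<Prod>r\<in>I. prob ((\<lambda>\<omega>. \<lambda>i\<in>J. X r i \<omega>) -` box r \<inter> space M))"
      by (rule indep_varsD_finite[OF rows fin(3,1) box])
    also have "\<dots> = (\<Prod>r\<in>I. \<Prod>i\<in>J. prob (X r i -` A (r, i) \<inter> space M))"
      unfolding vimage using A' by (intro prod.cong refl indep_varsD_finite[OF row fin(4,2)])
    also have "\<dots> = (\<Prod>z\<in>I \<times> J. prob (X (fst z) (snd z) -` A z \<inter> space M))"
      by (simp add: prod.cartesian_product case_prod_unfold)
    finally show ?thesis .
  qed
  moreover have "indep_vars (\<lambda>z. S (fst z) (snd z)) (\<lambda>z. X (fst z) (snd z)) (I \<times> J) \<longleftrightarrow>
    (\<forall>A\<in>(\<Pi> z\<in>I \<times> J. sets (S (fst z) (snd z))).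
      prob (\<Inter>z\<in>I \<times> J. X (fst z) (snd z) -` A z \<inter> space M)
      = (\<Prod>z\<in>I \<times> J. prob (X (fst z) (snd z) -` A z \<inter> space M)))"
    using fin rv
    by (intro indep_vars_finite) (auto simp: sets.sigma_sets_eq sets.space_closed sets.Int_stable)
  ultimately show ?thesis by blast
qed

definition std_gauss :: "real measure" where
  "std_gauss = density lborel std_normal_density"

definition gauss_vec :: "nat \<Rightarrow> (nat \<Rightarrow> real) measure" where
  "gauss_vec k = PiM {1..k} (\<lambda>_. std_gauss)"

text \<open>Subtracting this multiple of the mean multiplies the mean of the coordinates by \<open>sqrt (1 - p * k)\<close> and
  keeps the deviations from it. Up to the factor \<open>sqrt p\<close> it turns the identity covariance of standard
  Gaussian vectors into \<open>of_bool (r = s) - p\<close>, which is \<open>1 / p\<close> times the covariance of the indicators of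
  disjoint events of probability \<open>p\<close>.\<close>

definition shrink_mean :: "nat \<Rightarrow> real \<Rightarrow> (nat \<Rightarrow> real) \<Rightarrow> nat \<Rightarrow> real" where
  "shrink_mean k p y = (\<lambda>r\<in>{1..k}. sqrt p * (y r - (1 - sqrt (1 - p * real k)) / real k * (\<Sum>s=1..k. y s)))"

definition gaussian_law :: "nat \<Rightarrow> real \<Rightarrow> (nat \<Rightarrow> real) measure" where
  "gaussian_law k p = distr (gauss_vec k) (PiM {1..k} (\<lambda>_. borel)) (shrink_mean k p)"

lemma sets_std_gauss [simp, measurable_cong]: "sets std_gauss = sets borel"
  by (simp add: std_gauss_def)

lemma prob_space_std_gauss: "prob_space std_gauss"
  unfolding std_gauss_def by (rule prob_space_normal_density) simp

lemma sets_gauss_vec [measurable_cong]: "sets (gauss_vec k) = sets (PiM {1..k} (\<lambda>_. borel))"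
  unfolding gauss_vec_def by (intro sets_PiM_cong) auto

lemma prob_space_gauss_vec: "prob_space (gauss_vec k)"
  unfolding gauss_vec_def by (intro prob_space_PiM prob_space_std_gauss)

lemma shrink_mean_measurable: "shrink_mean k p \<in> measurable (PiM {1..k} (\<lambda>_. borel)) (PiM {1..k} (\<lambda>_. borel))"
  unfolding shrink_mean_def by (intro measurable_restrict) measurable

lemma has_integral_std_gauss:
  fixes f :: "real \<Rightarrow> real"
  assumes "f \<in> borel_measurable borel" "has_bochner_integral lborel (\<lambda>x. std_normal_density x * f x) c"
  shows "has_bochner_integral std_gauss f c"
  unfolding std_gauss_def using assms by (intro has_bochner_integral_density) auto

lemma std_gauss_moments:
  shows "has_bochner_integral std_gauss (\<lambda>x. x) 0"
    and "has_bochner_integral std_gauss (\<lambda>x. x * x) 1"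
    and "integrable std_gauss (\<lambda>x. \<bar>x\<bar> ^ 3)"
proof -
  show "has_bochner_integral std_gauss (\<lambda>x. x) 0"
    using std_normal_moment_odd[of 0] by (intro has_integral_std_gauss) auto
  show "has_bochner_integral std_gauss (\<lambda>x. x * x) 1"
    using std_normal_moment_even[of 1]
    by (intro has_integral_std_gauss) (auto simp: power2_eq_square)
  show "integrable std_gauss (\<lambda>x. \<bar>x\<bar> ^ 3)"
    unfolding std_gauss_def using integrable_std_normal_moment_abs[of 3]
    by (subst integrable_density) auto
qed

lemma gauss_vec_component:
  assumes r: "r \<in> {1..k}" and f: "f \<in> borel_measurable borel"
  shows "has_bochner_integral (gauss_vec k) (\<lambda>y. f (y r)) c \<longleftrightarrow> has_bochner_integral std_gauss f (c :: real)"
proof -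
  have comp: "distr (gauss_vec k) std_gauss (\<lambda>y. y r) = std_gauss"
    unfolding gauss_vec_def using r by (intro distr_PiM_component prob_space_std_gauss)
  have [measurable]: "(\<lambda>y. y r) \<in> measurable (gauss_vec k) std_gauss"
    unfolding gauss_vec_def using r by measurable
  have "has_bochner_integral (distr (gauss_vec k) std_gauss (\<lambda>y. y r)) f c
    \<longleftrightarrow> has_bochner_integral (gauss_vec k) (\<lambda>y. f (y r)) c"
    unfolding has_bochner_integral_iff using f
    by (subst integrable_distr_eq integral_distr, measurable)+
  then show ?thesis unfolding comp by simp
qed

lemma gauss_vec_second:
  assumes r: "r \<in> {1..k}" and s: "s \<in> {1..k}"
  shows "has_bochner_integral (gauss_vec k) (\<lambda>y. y r * y s) (of_bool (r = s))"
proof (cases "r = s")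
  case True
  then show ?thesis
    using gauss_vec_component[OF r, of "\<lambda>x. x * x" 1] std_gauss_moments(2) by simp
next
  case False
  interpret product_sigma_finite "\<lambda>_ :: nat. std_gauss"
    unfolding product_sigma_finite_def using prob_space_std_gauss by (blast intro: prob_space_imp_sigma_finite)
  interpret prob_space std_gauss by (rule prob_space_std_gauss)
  define f :: "nat \<Rightarrow> real \<Rightarrow> real" where "f i x = (if i \<in> {r, s} then x else 1)" for i x
  have f_int: "integrable std_gauss (f i)" for i
    using std_gauss_moments(1) by (cases "i \<in> {r, s}") (auto simp: f_def[abs_def] has_bochner_integral_iff)
  have prod: "(\<Prod>i\<in>{1..k}. f i (y i)) = y r * y s" for y
  proof -
    have "(\<Prod>i\<in>{1..k}. f i (y i)) = (\<Prod>i\<in>{r, s}. y i)"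
      using r s by (intro prod.mono_neutral_cong_right) (auto simp: f_def)
    then show ?thesis using False by simp
  qed
  have "integrable (gauss_vec k) (\<lambda>y. \<Prod>i\<in>{1..k}. f i (y i))"
    unfolding gauss_vec_def by (rule product_integrable_prod) (auto intro: f_int)
  moreover have "(\<integral>y. (\<Prod>i\<in>{1..k}. f i (y i)) \<partial>gauss_vec k) = (\<Prod>i\<in>{1..k}. integral\<^sup>L std_gauss (f i))"
    unfolding gauss_vec_def by (rule product_integral_prod) (auto intro: f_int)
  moreover have "integral\<^sup>L std_gauss (f r) = 0"
    using std_gauss_moments(1) by (simp add: f_def[abs_def] has_bochner_integral_iff)
  then have "(\<Prod>i\<in>{1..k}. integral\<^sup>L std_gauss (f i)) = 0"
    using r by (intro prod_zero) auto
  ultimately show ?thesis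
    using False unfolding prod has_bochner_integral_iff by simp
qed

lemma sum_cubed_le:
  fixes a :: "'r \<Rightarrow> real"
  assumes R: "finite R" and a: "\<And>r. r \<in> R \<Longrightarrow> a r \<ge> 0"
  shows "(\<Sum>r\<in>R. a r) ^ 3 \<le> real (card R) ^ 3 * (\<Sum>r\<in>R. a r ^ 3)"
proof (cases "R = {}")
  case False
  obtain m where m: "m \<in> R" "a m = Max (a ` R)"
  proof -
    have "Max (a ` R) \<in> a ` R" using R False by (intro Max_in) auto
    then show ?thesis using that by auto
  qed
  have "(\<Sum>r\<in>R. a r) \<le> (\<Sum>r\<in>R. a m)"
    using R m by (intro sum_mono) auto
  then have "(\<Sum>r\<in>R. a r) ^ 3 \<le> (real (card R) * a m) ^ 3"
    using a by (intro power_mono sum_nonneg) auto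
  also have "\<dots> = real (card R) ^ 3 * a m ^ 3"
    by (simp add: power_mult_distrib)
  also have "\<dots> \<le> real (card R) ^ 3 * (\<Sum>r\<in>R. a r ^ 3)"
    using R m a by (intro mult_left_mono member_le_sum) auto
  finally show ?thesis .
qed simp

text \<open>With \<open>\<gamma> = (1 - sqrt (1 - p * k)) / k\<close> the covariance of the shrunk vector is
  \<open>p * (of_bool (r = s) - 2 * \<gamma> + \<gamma>\<^sup>2 * k)\<close>, and \<open>\<gamma>\<close> solves \<open>\<gamma>\<^sup>2 * k - 2 * \<gamma> = - p\<close>.\<close>

lemma moment_law_gaussian:
  assumes k: "k \<ge> 1" and p: "p \<ge> 0" "p * real k \<le> 1"
  shows "moment_law (gaussian_law k p) {1..k} (\<lambda>_. 0) (\<lambda>r s. p * of_bool (r = s) - p\<^sup>2)"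
proof -
  interpret gauss_vec: prob_space "gauss_vec k" by (rule prob_space_gauss_vec)
  have shrink_mean [measurable]: "shrink_mean k p \<in> measurable (gauss_vec k) (PiM {1..k} (\<lambda>_. borel))"
    using shrink_mean_measurable[of k p] by (simp cong: measurable_cong_sets add: sets_gauss_vec)
  interpret Q: prob_space "gaussian_law k p"
    unfolding gaussian_law_def by (rule gauss_vec.prob_space_distr) (rule shrink_mean)
  define \<gamma> where "\<gamma> = (1 - sqrt (1 - p * real k)) / real k"
  have transfer: "has_bochner_integral (gaussian_law k p) f c \<longleftrightarrow> has_bochner_integral (gauss_vec k) (\<lambda>y. f (shrink_mean k p y)) c"
    if "f \<in> borel_measurable (PiM {1..k} (\<lambda>_. borel))" for f :: "(nat \<Rightarrow> real) \<Rightarrow> real" and c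
    unfolding gaussian_law_def has_bochner_integral_iff using that
    by (subst integrable_distr_eq integral_distr, measurable)+
  have shrink_mean_eq: "shrink_mean k p y r = sqrt p * (y r - \<gamma> * (\<Sum>s=1..k. y s))" if "r \<in> {1..k}" for y r
    using that by (simp add: shrink_mean_def \<gamma>_def)
  have one: "has_bochner_integral (gauss_vec k) (\<lambda>y. y r) 0" if "r \<in> {1..k}" for r
    by (rule iffD2[OF gauss_vec_component[OF that, of "\<lambda>x. x"]]) (simp_all add: std_gauss_moments(1))
  show ?thesis
  proof (intro moment_law.intro moment_law_axioms.intro)
    show "prob_space (gaussian_law k p)" by (rule Q.prob_space_axioms)
    show "finite {1..k}" by simp
    show "sets (gaussian_law k p) = sets (PiM {1..k} (\<lambda>_. borel))"
      by (simp add: gaussian_law_def)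
  next
    fix r assume r: "r \<in> {1..k}"
    have "has_bochner_integral (gauss_vec k) (\<lambda>y. sqrt p * (y r - \<gamma> * (\<Sum>s=1..k. y s))) (sqrt p * (0 - \<gamma> * (\<Sum>s=1..k. 0)))"
      using r by (intro has_bochner_integral_mult_right has_bochner_integral_diff has_bochner_integral_sum one)
    then show "has_bochner_integral (gaussian_law k p) (\<lambda>y. y r) 0"
      using r by (subst transfer) (auto simp: shrink_mean_eq)
  next
    fix r s assume r: "r \<in> {1..k}" and s: "s \<in> {1..k}"
    have expand: "shrink_mean k p y r * shrink_mean k p y s = p * (y r * y s - \<gamma> * (\<Sum>u=1..k. y u * y s) - \<gamma> * (\<Sum>u=1..k. y r * y u)
        + \<gamma>\<^sup>2 * (\<Sum>u=1..k. \<Sum>v=1..k. y u * y v))" for y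
    proof -
      define \<Sigma> where "\<Sigma> = (\<Sum>u=1..k. y u)"
      have "shrink_mean k p y r * shrink_mean k p y s = (sqrt p * sqrt p) * ((y r - \<gamma> * \<Sigma>) * (y s - \<gamma> * \<Sigma>))"
        using r s by (simp add: shrink_mean_eq \<Sigma>_def)
      also have "\<dots> = p * (y r * y s - \<gamma> * (\<Sigma> * y s) - \<gamma> * (y r * \<Sigma>) + \<gamma>\<^sup>2 * (\<Sigma> * \<Sigma>))"
        using p by (simp add: algebra_simps power2_eq_square)
      finally show ?thesis
        by (simp only: \<Sigma>_def sum_product sum_distrib_right[of y "{1..k}" "y s"] sum_distrib_left[of "y r" y "{1..k}"])
    qed
    have "has_bochner_integral (gauss_vec k) (\<lambda>y. shrink_mean k p y r * shrink_mean k p y s)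
      (p * (of_bool (r = s) - \<gamma> * (\<Sum>u=1..k. of_bool (u = s)) - \<gamma> * (\<Sum>u=1..k. of_bool (r = u))
        + \<gamma>\<^sup>2 * (\<Sum>u=1..k. \<Sum>v=1..k. of_bool (u = v))))"
      unfolding expand using r s
      by (intro has_bochner_integral_mult_right has_bochner_integral_add has_bochner_integral_diff
          has_bochner_integral_sum gauss_vec_second)
    moreover have "(\<Sum>u=1..k. of_bool (u = s)) = (1::real)" "(\<Sum>u=1..k. of_bool (r = u)) = (1::real)"
      using r s by (simp_all add: of_bool_def)
    moreover have "(\<Sum>u=1..k. \<Sum>v=1..k. of_bool (u = v)) = real k"
      by (simp add: of_bool_def)
    moreover have "p * (of_bool (r = s) - \<gamma> * 1 - \<gamma> * 1 + \<gamma>\<^sup>2 * real k) = p * of_bool (r = s) - p\<^sup>2"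
    proof -
      have "\<gamma>\<^sup>2 * real k - 2 * \<gamma> = ((1 - \<gamma> * real k)\<^sup>2 - 1) / real k"
        using k by (simp add: field_simps power2_eq_square)
      also have "1 - \<gamma> * real k = sqrt (1 - p * real k)"
        using k by (simp add: \<gamma>_def)
      also have "((sqrt (1 - p * real k))\<^sup>2 - 1) / real k = - p"
        using k p by simp
      finally have "\<gamma>\<^sup>2 * real k - 2 * \<gamma> = - p" .
      then have "of_bool (r = s) - \<gamma> * 1 - \<gamma> * 1 + \<gamma>\<^sup>2 * real k = of_bool (r = s) - p" by simp
      then show ?thesis by (simp only:) (simp add: power2_eq_square algebra_simps)
    qed
    ultimately have "has_bochner_integral (gauss_vec k) (\<lambda>y. shrink_mean k p y r * shrink_mean k p y s) (p * of_bool (r = s) - p\<^sup>2)"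
      by simp
    then show "has_bochner_integral (gaussian_law k p) (\<lambda>y. y r * y s) (p * of_bool (r = s) - p\<^sup>2)"
      using r s by (subst transfer) auto
  next
    define C where "C = sqrt p * (1 + \<bar>\<gamma>\<bar>)"
    have C0: "C \<ge> 0" using p by (simp add: C_def)
    have bound: "(\<Sum>r=1..k. \<bar>shrink_mean k p y r\<bar>) ^ 3 \<le> (real k * C) ^ 3 * (real k ^ 3 * (\<Sum>s=1..k. \<bar>y s\<bar> ^ 3))" for y
    proof -
      have "\<bar>shrink_mean k p y r\<bar> \<le> C * (\<Sum>s=1..k. \<bar>y s\<bar>)" if r: "r \<in> {1..k}" for r
      proof -
        have "\<bar>y r\<bar> \<le> (\<Sum>s=1..k. \<bar>y s\<bar>)"
          using r by (intro member_le_sum[of r "{1..k}" "\<lambda>s. \<bar>y s\<bar>"]) auto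
        moreover have "\<bar>\<gamma> * (\<Sum>s=1..k. y s)\<bar> \<le> \<bar>\<gamma>\<bar> * (\<Sum>s=1..k. \<bar>y s\<bar>)"
          unfolding abs_mult by (intro mult_left_mono sum_abs) auto
        ultimately have "\<bar>y r - \<gamma> * (\<Sum>s=1..k. y s)\<bar> \<le> (1 + \<bar>\<gamma>\<bar>) * (\<Sum>s=1..k. \<bar>y s\<bar>)"
          unfolding distrib_right by linarith
        then have "sqrt p * \<bar>y r - \<gamma> * (\<Sum>s=1..k. y s)\<bar> \<le> sqrt p * ((1 + \<bar>\<gamma>\<bar>) * (\<Sum>s=1..k. \<bar>y s\<bar>))"
          using p by (intro mult_left_mono) auto
        then show ?thesis
          using p by (simp add: shrink_mean_eq[OF r] abs_mult C_def mult.assoc)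
      qed
      then have "(\<Sum>r=1..k. \<bar>shrink_mean k p y r\<bar>) \<le> (\<Sum>r=1..k. C * (\<Sum>s=1..k. \<bar>y s\<bar>))"
        by (rule sum_mono)
      then have "(\<Sum>r=1..k. \<bar>shrink_mean k p y r\<bar>) ^ 3 \<le> ((real k * C) * (\<Sum>s=1..k. \<bar>y s\<bar>)) ^ 3"
        by (intro power_mono sum_nonneg) (auto simp: mult.assoc)
      also have "\<dots> = (real k * C) ^ 3 * (\<Sum>s=1..k. \<bar>y s\<bar>) ^ 3"
        by (rule power_mult_distrib)
      also have "\<dots> \<le> (real k * C) ^ 3 * (real k ^ 3 * (\<Sum>s=1..k. \<bar>y s\<bar> ^ 3))"
        using sum_cubed_le[of "{1..k}" "\<lambda>s. \<bar>y s\<bar>"] C0 by (intro mult_left_mono) auto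
      finally show ?thesis .
    qed
    have cube: "integrable (gauss_vec k) (\<lambda>y. \<bar>y r\<bar> ^ 3)" if "r \<in> {1..k}" for r
      using gauss_vec_component[OF that, of "\<lambda>x. \<bar>x\<bar> ^ 3" "integral\<^sup>L std_gauss (\<lambda>x. \<bar>x\<bar> ^ 3)"] std_gauss_moments(3)
      by (auto simp: has_bochner_integral_iff)
    have "integrable (gauss_vec k) (\<lambda>y. (\<Sum>r=1..k. \<bar>shrink_mean k p y r\<bar>) ^ 3)"
    proof (rule Bochner_Integration.integrable_bound)
      show "integrable (gauss_vec k) (\<lambda>y. (real k * C) ^ 3 * (real k ^ 3 * (\<Sum>s=1..k. \<bar>y s\<bar> ^ 3)))"
        by (intro integrable_mult_right Bochner_Integration.integrable_sum cube)
      show "(\<lambda>y. (\<Sum>r=1..k. \<bar>shrink_mean k p y r\<bar>) ^ 3) \<in> borel_measurable (gauss_vec k)"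
        using measurable_compose[OF shrink_mean measurable_component_singleton] by measurable
      show "AE y in gauss_vec k. norm ((\<Sum>r=1..k. \<bar>shrink_mean k p y r\<bar>) ^ 3)
          \<le> norm ((real k * C) ^ 3 * (real k ^ 3 * (\<Sum>s=1..k. \<bar>y s\<bar> ^ 3)))"
        using bound C0 by (intro AE_I2) (auto intro!: order_trans[OF bound] simp: sum_nonneg)
    qed
    moreover have meas: "(\<lambda>y. (\<Sum>r=1..k. \<bar>y r\<bar>) ^ 3) \<in> borel_measurable (PiM {1..k} (\<lambda>_. borel :: real measure))"
      by measurable
    ultimately show "integrable (gaussian_law k p) (\<lambda>y. (\<Sum>r=1..k. \<bar>y r\<bar>) ^ 3)"
      unfolding gaussian_law_def integrable_distr_eq[OF shrink_mean meas] by blast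
  qed
qed

section \<open>Last passage values of Brownian increments\<close>

context standard_multidim_brownian_motion
begin

definition increment :: "nat \<Rightarrow> nat \<Rightarrow> nat \<Rightarrow> 'b \<Rightarrow> real" where
  "increment n r i \<omega> = B r (real i / real n) \<omega> - B r (real (i - 1) / real n) \<omega>"

definition scaled_increment :: "nat \<Rightarrow> nat \<Rightarrow> nat \<Rightarrow> 'b \<Rightarrow> real" where
  "scaled_increment n r i \<omega> = sqrt (real n) * increment n r i \<omega>"

lemma grid_in_unit: "i \<in> {1..n} \<Longrightarrow> real i / real n \<in> {0..1} \<and> real (i - 1) / real n \<in> {0..1}"
  by (auto simp: divide_simps)

lemma B_measurable: "r \<in> {1..k} \<Longrightarrow> t \<in> {0..1} \<Longrightarrow> B r t \<in> borel_measurable N"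
  using components standard_brownian_motion.measurable by blast

lemma increment_measurable: "r \<in> {1..k} \<Longrightarrow> i \<in> {1..n} \<Longrightarrow> increment n r i \<in> borel_measurable N"
  unfolding increment_def[abs_def] using grid_in_unit by (intro borel_measurable_diff B_measurable) blast+

lemma scaled_increment_measurable:
  "r \<in> {1..k} \<Longrightarrow> i \<in> {1..n} \<Longrightarrow> scaled_increment n r i \<in> borel_measurable N"
  unfolding scaled_increment_def[abs_def] by (intro borel_measurable_times increment_measurable) auto

lemma scaled_increment_distr:
  assumes r: "r \<in> {1..k}" and i: "i \<in> {1..n}"
  shows "distr N borel (scaled_increment n r i) = std_gauss"
proof -
  interpret W: standard_brownian_motion N "B r" using components r by blast
  have n: "n > 0" using i by auto
  have diff: "real i / real n - real (i - 1) / real n = 1 / real n"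
    using i by (simp add: diff_divide_distrib[symmetric] of_nat_diff)
  have "distributed N lborel (\<lambda>\<omega>. B r (real i / real n) \<omega> - B r (real (i - 1) / real n) \<omega>)
      (normal_density 0 (sqrt (real i / real n - real (i - 1) / real n)))"
    using i n grid_in_unit[OF i] by (intro W.normal_increments) (auto simp: divide_strict_right_mono)
  then have "distributed N lborel (increment n r i) (normal_density 0 (sqrt (1 / real n)))"
    unfolding diff increment_def[abs_def] .
  then have "distributed N lborel (\<lambda>\<omega>. 0 + sqrt (real n) * increment n r i \<omega>)
      (normal_density (0 + sqrt (real n) * 0) (\<bar>sqrt (real n)\<bar> * sqrt (1 / real n)))"
    using n by (intro normal_density_affine) auto
  moreover have "\<bar>sqrt (real n)\<bar> * sqrt (1 / real n) = 1"
    using n by (simp add: real_sqrt_divide)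
  ultimately have "distributed N lborel (scaled_increment n r i) std_normal_density"
    by (simp add: scaled_increment_def[abs_def])
  then have "distr N lborel (scaled_increment n r i) = std_gauss"
    by (simp add: distributed_def std_gauss_def)
  then show ?thesis
    by (metis distr_cong sets_lborel)
qed

lemma indep_row:
  assumes r: "r \<in> {1..k}"
  shows "indep_vars (\<lambda>_. borel) (scaled_increment n r) {1..n}"
proof (cases "n = 0")
  case True
  then show ?thesis by (simp add: indep_vars_def indep_sets_def)
next
  case False
  interpret W: standard_brownian_motion N "B r" using components r by blast
  have "indep_vars (\<lambda>_. borel) (\<lambda>j \<omega>. B r (real (Suc j) / real n) \<omega> - B r (real j / real n) \<omega>) {..<n}"
    using False by (intro W.indep_increments[where \<tau> = "\<lambda>j. real j / real n"])
      (auto simp: strict_mono_on_def divide_strict_right_mono divide_simps)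
  then have "indep_vars (\<lambda>_. borel) (\<lambda>j \<omega>. sqrt (real n) * (B r (real (Suc j) / real n) \<omega> - B r (real j / real n) \<omega>)) {..<n}"
    by (rule indep_vars_compose2) auto
  \<comment> \<open>Shift the index set to \<open>{1..n}\<close>: the variable of index \<open>i\<close> is read off from the block \<open>{i - 1}\<close>.\<close>
  then have "indep_vars (\<lambda>i. PiM {i - 1} (\<lambda>_. borel))
      (\<lambda>i \<omega>. \<lambda>j\<in>{i - 1}. sqrt (real n) * (B r (real (Suc j) / real n) \<omega> - B r (real j / real n) \<omega>)) {1..n}"
    by (rule indep_vars_restrict) (auto simp: disjoint_family_on_def)
  then have "indep_vars (\<lambda>_. borel) (\<lambda>i \<omega>. (\<lambda>f. f (i - 1))
      (\<lambda>j\<in>{i - 1}. sqrt (real n) * (B r (real (Suc j) / real n) \<omega> - B r (real j / real n) \<omega>))) {1..n}"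
    by (rule indep_vars_compose2) simp
  then show ?thesis
    by (rule iffD1[OF indep_vars_cong, rotated -1])
      (auto simp: scaled_increment_def increment_def fun_eq_iff)
qed

lemma indep_rows: "indep_vars (\<lambda>r. PiM {1..n} (\<lambda>_. borel)) (\<lambda>r \<omega>. \<lambda>i\<in>{1..n}. scaled_increment n r i \<omega>) {1..k}"
proof -
  define h where "h w = (\<lambda>i\<in>{1..n}. sqrt (real n) * (w (real i / real n) - w (real (i - 1) / real n)))"
    for w :: "real \<Rightarrow> real"
  have "h \<in> measurable (PiM {0..1} (\<lambda>_. borel)) (PiM {1..n} (\<lambda>_. borel))"
    unfolding h_def
  proof (rule measurable_restrict)
    fix i assume "i \<in> {1..n}"
    then have [measurable]: "(\<lambda>w. w (real i / real n)) \<in> borel_measurable (PiM {0..1} (\<lambda>_. borel :: real measure))"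
      "(\<lambda>w. w (real (i - 1) / real n)) \<in> borel_measurable (PiM {0..1} (\<lambda>_. borel :: real measure))"
      using grid_in_unit by (blast intro: measurable_component_singleton)+
    show "(\<lambda>w. sqrt (real n) * (w (real i / real n) - w (real (i - 1) / real n)))
        \<in> borel_measurable (PiM {0..1} (\<lambda>_. borel))"
      by measurable
  qed
  then have "indep_vars (\<lambda>_. PiM {1..n} (\<lambda>_. borel)) (\<lambda>r \<omega>. h (\<lambda>t\<in>{0..1}. B r t \<omega>)) {1..k}"
    by (intro indep_vars_compose2[OF indep_components]) auto
  moreover have "h (\<lambda>t\<in>{0..1}. B r t \<omega>) = (\<lambda>i\<in>{1..n}. scaled_increment n r i \<omega>)" for r \<omega>
    unfolding h_def scaled_increment_def increment_def
    by (intro restrict_ext) (use grid_in_unit in simp)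
  ultimately show ?thesis by simp
qed

definition column :: "nat \<Rightarrow> nat \<Rightarrow> 'b \<Rightarrow> nat \<Rightarrow> real" where
  "column n i \<omega> = (\<lambda>r\<in>{1..k}. scaled_increment n r i \<omega>)"

lemma column_measurable: "i \<in> {1..n} \<Longrightarrow> column n i \<in> measurable N (PiM {1..k} (\<lambda>_. borel))"
  unfolding column_def[abs_def] by (intro measurable_restrict scaled_increment_measurable)

text \<open>Independence is given along rows, that is, of the \<open>k\<close> processes and of the increments of each process.
  For the last passage value it is needed along columns: the vectors of increments belonging to
  different time steps.\<close>

lemma indep_columns:
  assumes k: "k \<ge> 1" and n: "n \<ge> 1"
  shows "indep_vars (\<lambda>_. PiM {1..k} (\<lambda>_. borel)) (column n) {1..n}"
proof -
  have array: "indep_vars (\<lambda>_. borel) (\<lambda>z. scaled_increment n (fst z) (snd z)) ({1..k} \<times> {1..n})"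
    using k n indep_vars_array[of "{1..k}" "{1..n}" "\<lambda>_ _. borel" "scaled_increment n", OF _ _ _ _ indep_rows indep_row]
    by simp
  have "indep_vars (\<lambda>i. PiM ({1..k} \<times> {i}) (\<lambda>_. borel))
      (\<lambda>i \<omega>. \<lambda>z\<in>{1..k} \<times> {i}. scaled_increment n (fst z) (snd z) \<omega>) {1..n}"
    by (rule indep_vars_restrict[OF array]) (auto simp: disjoint_family_on_def)
  then have "indep_vars (\<lambda>_. PiM {1..k} (\<lambda>_. borel))
      (\<lambda>i \<omega>. (\<lambda>f. \<lambda>r\<in>{1..k}. f (r, i)) (\<lambda>z\<in>{1..k} \<times> {i}. scaled_increment n (fst z) (snd z) \<omega>)) {1..n}"
    by (rule indep_vars_compose2) (intro measurable_restrict measurable_component_singleton, simp)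
  moreover have "(\<lambda>f. \<lambda>r\<in>{1..k}. f (r, i)) (\<lambda>z\<in>{1..k} \<times> {i}. scaled_increment n (fst z) (snd z) \<omega>) = column n i \<omega>" for i \<omega>
    by (auto simp: column_def fun_eq_iff)
  ultimately show ?thesis by simp
qed

lemma column_distr:
  assumes k: "k \<ge> 1" and i: "i \<in> {1..n}"
  shows "distr N (PiM {1..k} (\<lambda>_. borel)) (column n i) = gauss_vec k"
proof -
  have "indep_vars (\<lambda>_. borel) (\<lambda>r \<omega>. (\<lambda>f. f i) (\<lambda>i\<in>{1..n}. scaled_increment n r i \<omega>)) {1..k}"
    using i by (intro indep_vars_compose2[OF indep_rows] measurable_component_singleton)
  then have "indep_vars (\<lambda>_. borel) (\<lambda>r. scaled_increment n r i) {1..k}"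
    using i by simp
  then have "distr N (PiM {1..k} (\<lambda>_. borel)) (\<lambda>\<omega>. \<lambda>r\<in>{1..k}. scaled_increment n r i \<omega>)
      = PiM {1..k} (\<lambda>r. distr N borel (scaled_increment n r i))"
    using k i by (subst (asm) indep_vars_iff_distr_eq_PiM') (auto intro: scaled_increment_measurable)
  also have "\<dots> = gauss_vec k"
    unfolding gauss_vec_def using i by (intro PiM_cong refl scaled_increment_distr)
  finally show ?thesis by (simp add: column_def[abs_def])
qed

lemma shrunk_columns_distr:
  assumes k: "k \<ge> 1" and n: "n \<ge> 1"
  shows "distr N (PiM {1..n} (\<lambda>_. PiM {1..k} (\<lambda>_. borel))) (\<lambda>\<omega>. \<lambda>i\<in>{1..n}. shrink_mean k p (column n i \<omega>))
    = PiM {1..n} (\<lambda>_. gaussian_law k p)"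
proof -
  have "indep_vars (\<lambda>_. PiM {1..k} (\<lambda>_. borel)) (\<lambda>i \<omega>. shrink_mean k p (column n i \<omega>)) {1..n}"
    by (rule indep_vars_compose2[OF indep_columns[OF k n]]) (rule shrink_mean_measurable)
  then have "distr N (PiM {1..n} (\<lambda>_. PiM {1..k} (\<lambda>_. borel))) (\<lambda>\<omega>. \<lambda>i\<in>{1..n}. shrink_mean k p (column n i \<omega>))
     = PiM {1..n} (\<lambda>i. distr N (PiM {1..k} (\<lambda>_. borel)) (\<lambda>\<omega>. shrink_mean k p (column n i \<omega>)))"
    using n measurable_compose[OF column_measurable shrink_mean_measurable]
    by (subst (asm) indep_vars_iff_distr_eq_PiM') (simp, blast, blast)
  also have "\<dots> = PiM {1..n} (\<lambda>_. gaussian_law k p)"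
  proof (intro PiM_cong refl)
    fix i assume i: "i \<in> {1..n}"
    show "distr N (PiM {1..k} (\<lambda>_. borel)) (\<lambda>\<omega>. shrink_mean k p (column n i \<omega>)) = gaussian_law k p"
      unfolding gaussian_law_def column_distr[OF k i, symmetric]
      by (subst distr_distr[OF shrink_mean_measurable column_measurable[OF i]]) (simp add: comp_def)
  qed
  finally show ?thesis .
qed

text \<open>The variable of the limit theorem with the times restricted to multiples of \<open>1 / n\<close>.\<close>

definition grid_functional :: "real \<Rightarrow> nat \<Rightarrow> 'b \<Rightarrow> real" where
  "grid_functional p n \<omega> = sqrt p * (last_passage n k (\<lambda>i r. increment n r i \<omega>)
     - (1 - sqrt (1 - p * real k)) * Z_lim k (\<lambda>i t. B i t \<omega>))"

lemma last_passage_shrunk_columns: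
  assumes k: "k \<ge> 1" and n: "n \<ge> 1" and p: "p \<ge> 0" and \<omega>: "\<omega> \<in> space N"
  shows "last_passage n k (\<lambda>i\<in>{1..n}. shrink_mean k p (column n i \<omega>)) / sqrt (real n) = grid_functional p n \<omega>"
proof -
  define \<gamma> where "\<gamma> = (1 - sqrt (1 - p * real k)) / real k"
  have endpoint: "(\<Sum>i=1..n. increment n s i \<omega>) = B s 1 \<omega>" if s: "s \<in> {1..k}" for s
  proof -
    interpret W: standard_brownian_motion N "B s" using components s by blast
    have "(\<Sum>i=1..m. increment n s i \<omega>) = B s (real m / real n) \<omega>" for m
      by (induction m) (auto simp: increment_def W.initial[OF \<omega>])
    then show ?thesis using n by simp
  qed
  have "last_passage n k (\<lambda>i\<in>{1..n}. shrink_mean k p (column n i \<omega>))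
     = last_passage n k (\<lambda>i r. (sqrt (real n) * sqrt p) * increment n r i \<omega>
         + - (sqrt (real n) * sqrt p * \<gamma> * (\<Sum>s=1..k. increment n s i \<omega>)))"
    by (rule last_passage_cong)
      (simp add: shrink_mean_def column_def scaled_increment_def \<gamma>_def sum_distrib_left[symmetric] algebra_simps)
  also have "\<dots> = (sqrt (real n) * sqrt p) * last_passage n k (\<lambda>i r. increment n r i \<omega>)
      + (\<Sum>i=1..n. - (sqrt (real n) * sqrt p * \<gamma> * (\<Sum>s=1..k. increment n s i \<omega>)))"
    using k p by (intro last_passage_affine) auto
  also have "(\<Sum>i=1..n. - (sqrt (real n) * sqrt p * \<gamma> * (\<Sum>s=1..k. increment n s i \<omega>)))
      = - (sqrt (real n) * sqrt p * \<gamma> * (\<Sum>s=1..k. B s 1 \<omega>))"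
  proof -
    have "(\<Sum>i=1..n. \<Sum>s=1..k. increment n s i \<omega>) = (\<Sum>s=1..k. B s 1 \<omega>)"
      by (subst sum.swap) (intro sum.cong refl endpoint)
    then show ?thesis
      unfolding sum_negf sum_distrib_left[symmetric] by simp
  qed
  finally have "last_passage n k (\<lambda>i\<in>{1..n}. shrink_mean k p (column n i \<omega>))
      = sqrt (real n) * (sqrt p * (last_passage n k (\<lambda>i r. increment n r i \<omega>) - \<gamma> * (\<Sum>s=1..k. B s 1 \<omega>)))"
    by (simp only: algebra_simps)
  moreover have "\<gamma> * (\<Sum>s=1..k. B s 1 \<omega>) = (1 - sqrt (1 - p * real k)) * Z_lim k (\<lambda>i t. B i t \<omega>)"
    by (simp add: \<gamma>_def Z_lim_def)
  ultimately show ?thesis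
    using n unfolding grid_functional_def by simp
qed

lemma grid_functional_tendsto:
  assumes k: "k \<ge> 1" and \<omega>: "\<omega> \<in> space N"
  shows "(\<lambda>n. grid_functional p n \<omega>) \<longlonglongrightarrow>
    sqrt p * (sqrt (1 - p * real k) * Z_lim k (\<lambda>i t. B i t \<omega>) + H_lim k (\<lambda>i t. B i t \<omega>))"
proof -
  let ?b = "\<lambda>i t. B i t \<omega>"
  have "(\<lambda>n. last_passage n k (\<lambda>i r. increment n r i \<omega>)) \<longlonglongrightarrow> Z_lim k ?b + H_lim k ?b"
    unfolding increment_def
    using components standard_brownian_motion.continuous_paths[OF _ \<omega>] standard_brownian_motion.initial[OF _ \<omega>]
    by (intro last_passage_tendsto k) blast+
  then have "(\<lambda>n. grid_functional p n \<omega>) \<longlonglongrightarrow> sqrt p * (Z_lim k ?b + H_lim k ?b - (1 - sqrt (1 - p * real k)) * Z_lim k ?b)"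
    unfolding grid_functional_def by (intro tendsto_intros)
  then show ?thesis by (simp add: algebra_simps)
qed

lemma grid_functional_measurable: "n \<ge> 1 \<Longrightarrow> grid_functional p n \<in> borel_measurable N"
proof -
  assume n: "n \<ge> 1"
  have [measurable]: "increment n (c i) i \<in> borel_measurable N" if "c \<in> labellings n k" "i \<in> {1..n}" for c i
    using increment_measurable labellings_range that by blast
  have [measurable]: "(\<lambda>\<omega>. last_passage n k (\<lambda>i r. increment n r i \<omega>)) \<in> borel_measurable N"
    unfolding last_passage_def by (rule borel_measurable_Max[OF finite_labellings]) measurable
  have [measurable]: "B r 1 \<in> borel_measurable N" if "r \<in> {1..k}" for r
    using B_measurable[OF that] by simp
  show ?thesis
    unfolding grid_functional_def[abs_def] Z_lim_def by measurable
qed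

text \<open>The supremum over uncountably many time vectors is a pointwise limit of maxima over grids.\<close>

lemma limit_measurable:
  assumes k: "k \<ge> 1"
  shows "(\<lambda>\<omega>. sqrt p * (sqrt (1 - p * real k) * Z_lim k (\<lambda>i t. B i t \<omega>) + H_lim k (\<lambda>i t. B i t \<omega>)))
    \<in> borel_measurable N"
proof (rule borel_measurable_LIMSEQ_real)
  show "(\<lambda>n. grid_functional p (Suc n) \<omega>) \<longlonglongrightarrow>
    sqrt p * (sqrt (1 - p * real k) * Z_lim k (\<lambda>i t. B i t \<omega>) + H_lim k (\<lambda>i t. B i t \<omega>))"
    if "\<omega> \<in> space N" for \<omega>
    using grid_functional_tendsto[OF k that] by (rule LIMSEQ_Suc)
qed (simp add: grid_functional_measurable)

theorem gaussian_last_passage_tendsto: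
  fixes f :: "real \<Rightarrow> real"
  assumes k: "k \<ge> 1" and p: "p \<ge> 0" "p * real k \<le> 1"
    and f: "continuous_on UNIV f" "\<And>x. \<bar>f x\<bar> \<le> A"
  shows "(\<lambda>n. \<integral>y. f (last_passage n k y / sqrt (real n)) \<partial>PiM {1..n} (\<lambda>_. gaussian_law k p)) \<longlonglongrightarrow>
    (\<integral>\<omega>. f (sqrt p * (sqrt (1 - p * real k) * Z_lim k (\<lambda>i t. B i t \<omega>) + H_lim k (\<lambda>i t. B i t \<omega>))) \<partial>N)"
proof -
  define L where "L \<omega> = sqrt p * (sqrt (1 - p * real k) * Z_lim k (\<lambda>i t. B i t \<omega>) + H_lim k (\<lambda>i t. B i t \<omega>))" for \<omega>
  have [measurable]: "L \<in> borel_measurable N" unfolding L_def using limit_measurable[OF k] .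
  have [measurable]: "f \<in> borel_measurable borel" using f(1) by (rule borel_measurable_continuous_onI)
  have [measurable]: "grid_functional p (Suc n) \<in> borel_measurable N" for n
    by (rule grid_functional_measurable) simp
  have eq: "(\<integral>y. f (last_passage n k y / sqrt (real n)) \<partial>PiM {1..n} (\<lambda>_. gaussian_law k p))
      = (\<integral>\<omega>. f (grid_functional p n \<omega>) \<partial>N)" if n: "n \<ge> 1" for n
  proof -
    have lp: "last_passage n k \<in> borel_measurable (PiM {1..n} (\<lambda>_. gaussian_law k p))"
      by (rule last_passage_measurable[OF moment_law_gaussian[OF k p]])
    have [measurable]: "last_passage n k \<in> borel_measurable (PiM {1..n} (\<lambda>_. PiM {1..k} (\<lambda>_. borel)))"
      using lp unfolding gaussian_law_def by (simp cong: measurable_cong_sets sets_PiM_cong)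
    have col: "(\<lambda>\<omega>. \<lambda>i\<in>{1..n}. shrink_mean k p (column n i \<omega>)) \<in> measurable N (PiM {1..n} (\<lambda>_. PiM {1..k} (\<lambda>_. borel)))"
      by (intro measurable_restrict measurable_compose[OF column_measurable shrink_mean_measurable])
    have "(\<integral>y. f (last_passage n k y / sqrt (real n)) \<partial>PiM {1..n} (\<lambda>_. gaussian_law k p))
       = (\<integral>\<omega>. f (last_passage n k (\<lambda>i\<in>{1..n}. shrink_mean k p (column n i \<omega>)) / sqrt (real n)) \<partial>N)"
      unfolding shrunk_columns_distr[OF k n, symmetric] by (rule integral_distr[OF col]) measurable
    also have "\<dots> = (\<integral>\<omega>. f (grid_functional p n \<omega>) \<partial>N)"
      using last_passage_shrunk_columns[OF k n p(1)] by (intro Bochner_Integration.integral_cong) auto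
    finally show ?thesis .
  qed
  have "(\<lambda>n. \<integral>\<omega>. f (grid_functional p (Suc n) \<omega>) \<partial>N) \<longlonglongrightarrow> (\<integral>\<omega>. f (L \<omega>) \<partial>N)"
  proof (rule integral_dominated_convergence)
    show "AE \<omega> in N. (\<lambda>n. f (grid_functional p (Suc n) \<omega>)) \<longlonglongrightarrow> f (L \<omega>)"
    proof (rule AE_I2)
      fix \<omega> assume "\<omega> \<in> space N"
      from LIMSEQ_Suc[OF grid_functional_tendsto[OF k this]]
      show "(\<lambda>n. f (grid_functional p (Suc n) \<omega>)) \<longlonglongrightarrow> f (L \<omega>)"
        unfolding L_def using f(1)
        by (intro isCont_tendsto_compose[of _ f]) (auto simp: continuous_on_eq_continuous_at)
    qed
    show "AE \<omega> in N. norm (f (grid_functional p (Suc n) \<omega>)) \<le> A" for n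
      using f(2) by auto
  qed auto
  then have "(\<lambda>n. \<integral>y. f (last_passage (Suc n) k y / sqrt (real (Suc n))) \<partial>PiM {1..Suc n} (\<lambda>_. gaussian_law k p))
      \<longlonglongrightarrow> (\<integral>\<omega>. f (L \<omega>) \<partial>N)"
    by (subst eq) simp_all
  then show ?thesis
    unfolding L_def by (rule LIMSEQ_imp_Suc)
qed

end

section \<open>Convergence in distribution\<close>

lemma char_distr_eq:
  assumes "prob_space M" and g [measurable]: "g \<in> borel_measurable M"
  shows "char (distr M borel g) t = complex_of_real (\<integral>\<omega>. cos (t * g \<omega>) \<partial>M) + \<i> * complex_of_real (\<integral>\<omega>. sin (t * g \<omega>) \<partial>M)"
proof -
  interpret prob_space M by fact
  have int: "integrable M (\<lambda>\<omega>. cos (t * g \<omega>))" "integrable M (\<lambda>\<omega>. sin (t * g \<omega>))"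
    by (rule integrable_const_bound[of _ 1]; simp)+
  have "char (distr M borel g) t = (\<integral>\<omega>. iexp (t * g \<omega>) \<partial>M)"
    unfolding char_def by (rule integral_distr) measurable
  also have "\<dots> = (\<integral>\<omega>. complex_of_real (cos (t * g \<omega>)) + \<i> * complex_of_real (sin (t * g \<omega>)) \<partial>M)"
    by (intro Bochner_Integration.integral_cong refl) (simp add: exp_Euler cos_of_real sin_of_real flip: of_real_mult)
  also have "\<dots> = complex_of_real (\<integral>\<omega>. cos (t * g \<omega>) \<partial>M) + \<i> * complex_of_real (\<integral>\<omega>. sin (t * g \<omega>) \<partial>M)"
    using int by simp
  finally show ?thesis .
qed

text \<open>Sine and cosine are among the test functions, so the characteristic functions converge.\<close>

lemma weak_conv_if_smooth_test_functions:
  assumes M: "prob_space M" and N: "prob_space N"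
    and g [measurable]: "\<And>n. g n \<in> borel_measurable M" and h [measurable]: "h \<in> borel_measurable N"
    and conv: "\<And>f f1 f2 f3 A.
      \<lbrakk>\<And>x. (f has_real_derivative f1 x) (at x); \<And>x. (f1 has_real_derivative f2 x) (at x);
       \<And>x. (f2 has_real_derivative f3 x) (at x); \<And>x. \<bar>f x\<bar> \<le> A; \<And>x. \<bar>f1 x\<bar> \<le> A; \<And>x. \<bar>f2 x\<bar> \<le> A; \<And>x. \<bar>f3 x\<bar> \<le> A\<rbrakk>
      \<Longrightarrow> (\<lambda>n. \<integral>\<omega>. f (g n \<omega>) \<partial>M) \<longlonglongrightarrow> (\<integral>\<omega>. f (h \<omega>) \<partial>N)"
  shows "weak_conv_m (\<lambda>n. distr M borel (g n)) (distr N borel h)"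
proof (rule levy_continuity)
  interpret M: prob_space M by fact
  interpret N: prob_space N by fact
  show "real_distribution (distr M borel (g n))" for n by (rule M.real_distribution_distr) (rule g)
  show "real_distribution (distr N borel h)" by (rule N.real_distribution_distr) (rule h)
  fix t :: real
  define A where "A = 1 + \<bar>t\<bar> + \<bar>t\<bar> ^ 2 + \<bar>t\<bar> ^ 3"
  have A: "1 \<le> A" "\<bar>t\<bar> \<le> A" "\<bar>t\<bar> ^ 2 \<le> A" "\<bar>t\<bar> ^ 3 \<le> A"
    unfolding A_def using zero_le_power[of "\<bar>t\<bar>" 2] zero_le_power[of "\<bar>t\<bar>" 3] by linarith+
  have bounds: "\<bar>c * cos x\<bar> \<le> A" "\<bar>c * sin x\<bar> \<le> A" if "\<bar>c\<bar> \<le> A" for c x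
    using that mult_mono[OF that abs_cos_le_one[of x]] mult_mono[OF that abs_sin_le_one[of x]] A(1)
    by (simp_all add: abs_mult)
  have abs_le: "\<bar>1\<bar> \<le> A" "\<bar>- 1\<bar> \<le> A" "\<bar>t\<bar> \<le> A" "\<bar>- t\<bar> \<le> A" "\<bar>- (t ^ 2)\<bar> \<le> A" "\<bar>t ^ 3\<bar> \<le> A" "\<bar>- (t ^ 3)\<bar> \<le> A"
    using A by (simp_all add: power_abs)
  have cos_conv: "(\<lambda>n. \<integral>\<omega>. 1 * cos (t * g n \<omega>) \<partial>M) \<longlonglongrightarrow> (\<integral>\<omega>. 1 * cos (t * h \<omega>) \<partial>N)"
  proof (rule conv[where f = "\<lambda>x. 1 * cos (t * x)" and ?f1.0 = "\<lambda>x. - t * sin (t * x)"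
        and ?f2.0 = "\<lambda>x. - (t ^ 2) * cos (t * x)" and ?f3.0 = "\<lambda>x. t ^ 3 * sin (t * x)" and A = A])
    show "\<bar>1 * cos (t * x)\<bar> \<le> A" "\<bar>- t * sin (t * x)\<bar> \<le> A" "\<bar>- (t ^ 2) * cos (t * x)\<bar> \<le> A" "\<bar>t ^ 3 * sin (t * x)\<bar> \<le> A" for x
      by (intro bounds abs_le)+
  qed (auto intro!: derivative_eq_intros simp: power2_eq_square power3_eq_cube)
  have sin_conv: "(\<lambda>n. \<integral>\<omega>. 1 * sin (t * g n \<omega>) \<partial>M) \<longlonglongrightarrow> (\<integral>\<omega>. 1 * sin (t * h \<omega>) \<partial>N)"
  proof (rule conv[where f = "\<lambda>x. 1 * sin (t * x)" and ?f1.0 = "\<lambda>x. t * cos (t * x)"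
        and ?f2.0 = "\<lambda>x. - (t ^ 2) * sin (t * x)" and ?f3.0 = "\<lambda>x. - (t ^ 3) * cos (t * x)" and A = A])
    show "\<bar>1 * sin (t * x)\<bar> \<le> A" "\<bar>t * cos (t * x)\<bar> \<le> A" "\<bar>- (t ^ 2) * sin (t * x)\<bar> \<le> A" "\<bar>- (t ^ 3) * cos (t * x)\<bar> \<le> A" for x
      by (intro bounds abs_le)+
  qed (auto intro!: derivative_eq_intros simp: power2_eq_square power3_eq_cube)
  show "(\<lambda>n. char (distr M borel (g n)) t) \<longlonglongrightarrow> char (distr N borel h) t"
    unfolding char_distr_eq[OF M g] char_distr_eq[OF N h]
    using cos_conv sin_conv by (intro tendsto_intros) simp_all
qed

theorem theorem5p1:
  fixes M :: "'m measure" and N :: "'b measure"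
    and \<alpha> :: "nat \<Rightarrow> 'a::linorder" and X :: "nat \<Rightarrow> 'm \<Rightarrow> 'a"
    and p :: "nat \<Rightarrow> real" and p_max :: real
    and k :: nat and j :: "nat \<Rightarrow> nat"
    and B :: "nat \<Rightarrow> real \<Rightarrow> 'b \<Rightarrow> real"
  assumes "prob_space M"
    and "strict_mono_on {1..} \<alpha>"
    and "prob_space.indep_vars M (\<lambda>_. count_space (\<alpha> ` {1..})) X {1..}"
    and "\<And>i. i \<ge> 1 \<Longrightarrow> distr M (count_space (\<alpha> ` {1..})) (X i) = distr M (count_space (\<alpha> ` {1..})) (X 1)"
    and "\<And>i. i \<ge> 1 \<Longrightarrow> \<P>(\<omega> in M. X 1 \<omega> = \<alpha> i) = p i"
    and "\<And>i. i \<ge> 1 \<Longrightarrow> p i > 0"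
    and "p_max \<in> p ` {1..}" and "\<And>i. i \<ge> 1 \<Longrightarrow> p i \<le> p_max"
    and "k \<ge> 1" and "strict_mono_on {1..k} j" and "j ` {1..k} \<subseteq> {1..}"
    and "\<And>r. r \<in> {1..k} \<Longrightarrow> p (j r) = p_max"
    and "\<And>i. i \<ge> 1 \<Longrightarrow> i \<notin> j ` {1..k} \<Longrightarrow> p i < p_max"
    and "standard_multidim_brownian_motion N k B"
  shows "weak_conv_m
    (\<lambda>n. distr M borel (\<lambda>\<omega>. (real (LI (\<lambda>i. X i \<omega>) n) - p_max * real n) / sqrt (real n)))
    (distr N borel (\<lambda>\<omega>. sqrt p_max *
       (sqrt (1 - p_max * real k) * Z_lim k (\<lambda>i t. B i t \<omega>) + H_lim k (\<lambda>i t. B i t \<omega>))))"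
proof -
  interpret prob_space M by (rule assms(1))
  interpret iid_letters_max M \<alpha> X p k j p_max
    by (intro iid_letters_max.intro iid_letters.intro iid_letters_axioms.intro
        iid_letters_max_axioms.intro) (fact assms)+
  interpret BM: standard_multidim_brownian_motion N k B by (rule assms(14))
  note [measurable] = LI_measurable
  show ?thesis
  proof (rule weak_conv_if_smooth_test_functions)
    show "prob_space M" by (rule assms(1))
    show "prob_space N" by (rule BM.prob_space_axioms)
    show "(\<lambda>\<omega>. (real (LI (\<lambda>i. X i \<omega>) n) - p_max * real n) / sqrt (real n)) \<in> borel_measurable M" for n
      by measurable
    show "(\<lambda>\<omega>. sqrt p_max * (sqrt (1 - p_max * real k) * Z_lim k (\<lambda>i t. B i t \<omega>) + H_lim k (\<lambda>i t. B i t \<omega>)))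
        \<in> borel_measurable N"
      by (rule BM.limit_measurable[OF k])
    fix f f1 f2 f3 :: "real \<Rightarrow> real" and A
    assume f: "\<And>x. (f has_real_derivative f1 x) (at x)" "\<And>x. (f1 has_real_derivative f2 x) (at x)"
        "\<And>x. (f2 has_real_derivative f3 x) (at x)"
      and A: "\<And>x. \<bar>f x\<bar> \<le> A" "\<And>x. \<bar>f1 x\<bar> \<le> A" "\<And>x. \<bar>f2 x\<bar> \<le> A" "\<And>x. \<bar>f3 x\<bar> \<le> A"
    have cont: "continuous_on UNIV f"
      using f(1) by (intro continuous_at_imp_continuous_on) (auto intro: DERIV_isCont)
    have q0: "p_max \<ge> 0" using q_pos by simp
    note words = LI_last_passage_comparison[where f = f and ?f1.0 = f1, OF f(1) A(1,2)]
    note universality = last_passage_universality[where f = f and ?f1.0 = f1 and ?f2.0 = f2 and ?f3.0 = f3,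
      OF moment_law_letters moment_law_gaussian[OF k q0 q_times_k] k f A]
    note gaussian = BM.gaussian_last_passage_tendsto[where f = f, OF k q0 q_times_k cont A(1)]
    show "(\<lambda>n. \<integral>\<omega>. f ((real (LI (\<lambda>i. X i \<omega>) n) - p_max * real n) / sqrt (real n)) \<partial>M)
      \<longlonglongrightarrow> (\<integral>\<omega>. f (sqrt p_max * (sqrt (1 - p_max * real k) * Z_lim k (\<lambda>i t. B i t \<omega>) + H_lim k (\<lambda>i t. B i t \<omega>))) \<partial>N)"
      using tendsto_add[OF tendsto_add[OF words universality] gaussian] by simp
  qed
qed

end
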